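(* Let $\Omega\subset\mathbb{R}^n$ be a smooth bounded domain and let $m\in C(\overline{\Omega})$ change sign in $\Omega$. For $1<p<\infty$ let $\lambda_{2,p}$ be the second (positive, variational) eigenvalue of the $p$-Laplacian problem $-\Delta_p u=\lambda m|u|^{p-2}u$ in $\Omega$, $u=0$ on $\partial\Omega$, defined by $$\lambda_{2,p}=\inf_{A\in\Sigma_2}\ \sup_{u\in A}\int_\Omega|\nabla u|^p .$$ Then the limit $\lambda_{2,\infty}:=\lim_{p\to\infty}\left(\lambda_{2,p}\right)^{1/p}$ exists and $$\lambda_{2,\infty}=\frac{1}{R_{2,+}},$$ where $$R_{2,+}:=\sup\{r>0:\ \text{there are two disjoint balls } B_r(x_1),B_r(x_2)\subset\Omega \text{ with } x_1,x_2\in\Omega_+\}.$$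
   Context: "$m$ changes sign in $\Omega$" means that both $\{m>0\}:=\{x\in\Omega: m(x)>0\}$ and $\{x\in\Omega: m(x)<0\}$ are nonempty. We set $\Omega_+:=\overline{\{m>0\}}$. $B_r(x)$ is the open Euclidean ball of radius $r$ centered at $x$. $\Delta_p u:=\mathrm{div}(|\nabla u|^{p-2}\nabla u)$. Let $\mathcal{A}^+(m):=\{u\in W^{1,p}_0(\Omega):\int_\Omega m|u|^p=1\}$. For a real Banach space $E$ and a closed symmetric set $A\subset E$ (i.e. $v\in A\Rightarrow -v\in A$), the (Krasnoselskii) genus $\gamma(A)$ is the smallest integer $j$ such that there exists a continuous odd mapping $\phi:A\to\mathbb{R}^j\setminus\{0\}$; if no such integer exists, $\gamma(A)=\infty$. For fixed $p$, $\Sigma_2$ is the collection of all symmetric compact subsets $A\subset\mathcal{A}^+(m)$ (in $E=W^{1,p}_0(\Omega)$) with $\gamma(A)\ge 2$. *)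

theory Defs
  imports "HOL-Analysis.Analysis"
begin

section \<open>Smooth functions and smooth bounded domains\<close>

fun Ck_on :: "nat \<Rightarrow> 'a::euclidean_space set \<Rightarrow> ('a \<Rightarrow> real) \<Rightarrow> bool" where
  "Ck_on 0 S f \<longleftrightarrow> continuous_on S f"
| "Ck_on (Suc k) S f \<longleftrightarrow>
     (\<forall>x\<in>S. f differentiable (at x)) \<and>
     (\<forall>i\<in>Basis. Ck_on k S (\<lambda>x. frechet_derivative f (at x) i))"

text \<open>Only used for open \<open>S\<close>, since derivatives are taken in the whole space.\<close>

definition smooth_on :: "'a::euclidean_space set \<Rightarrow> ('a \<Rightarrow> real) \<Rightarrow> bool" where
  "smooth_on S f \<longleftrightarrow> (\<forall>k. Ck_on k S f)"

text \<open>
  Near each boundary point the set is, in suitable orthonormal coordinates, the region strictly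
  above a smooth graph. The height is measured along a unit vector \<open>\<nu>\<close>, and the graph function is
  evaluated only on the hyperplane orthogonal to \<open>\<nu>\<close>; since a smooth function on that hyperplane
  extends to the whole space (constantly along \<open>\<nu>\<close>), we may take \<open>\<gamma>\<close> to be defined everywhere.
\<close>

definition smooth_boundary :: "'a::euclidean_space set \<Rightarrow> bool" where
  "smooth_boundary \<Omega> \<longleftrightarrow>
     (\<forall>x0\<in>frontier \<Omega>. \<exists>r>0. \<exists>\<nu> \<gamma>. norm \<nu> = 1 \<and> smooth_on UNIV \<gamma> \<and>
        \<Omega> \<inter> ball x0 r = {x \<in> ball x0 r. \<gamma> (x - (x \<bullet> \<nu>) *\<^sub>R \<nu>) < x \<bullet> \<nu>})"

definition smooth_bounded_domain :: "'a::euclidean_space set \<Rightarrow> bool" where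
  "smooth_bounded_domain \<Omega> \<longleftrightarrow>
     open \<Omega> \<and> connected \<Omega> \<and> \<Omega> \<noteq> {} \<and> bounded \<Omega> \<and> smooth_boundary \<Omega>"

section \<open>Weak gradients and Sobolev functions\<close>

definition test_functions :: "'a::euclidean_space set \<Rightarrow> ('a \<Rightarrow> real) set" where
  "test_functions \<Omega> =
     {\<phi>. smooth_on UNIV \<phi> \<and> compact (closure {x. \<phi> x \<noteq> 0}) \<and> closure {x. \<phi> x \<noteq> 0} \<subseteq> \<Omega>}"

definition locally_integrable_on ::
    "('a::euclidean_space \<Rightarrow> 'b::euclidean_space) \<Rightarrow> 'a set \<Rightarrow> bool" where
  "locally_integrable_on f \<Omega> \<longleftrightarrow> (\<forall>K. compact K \<and> K \<subseteq> \<Omega> \<longrightarrow> f absolutely_integrable_on K)"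

definition is_weak_gradient ::
    "'a::euclidean_space set \<Rightarrow> ('a \<Rightarrow> real) \<Rightarrow> ('a \<Rightarrow> 'a) \<Rightarrow> bool" where
  "is_weak_gradient \<Omega> u g \<longleftrightarrow>
     locally_integrable_on u \<Omega> \<and> locally_integrable_on g \<Omega> \<and>
     (\<forall>\<phi>\<in>test_functions \<Omega>. \<forall>i\<in>Basis.
        (LINT x|lebesgue_on \<Omega>. u x * frechet_derivative \<phi> (at x) i) =
        - (LINT x|lebesgue_on \<Omega>. (g x \<bullet> i) * \<phi> x))"

text \<open>Some representative of the weak gradient, which is unique up to null sets if it exists.\<close>

definition weak_grad :: "'a::euclidean_space set \<Rightarrow> ('a \<Rightarrow> real) \<Rightarrow> 'a \<Rightarrow> 'a" where
  "weak_grad \<Omega> u = (SOME g. is_weak_gradient \<Omega> u g)"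

definition Lp_function ::
    "'a::euclidean_space set \<Rightarrow> real \<Rightarrow> ('a \<Rightarrow> 'b::euclidean_space) \<Rightarrow> bool" where
  "Lp_function \<Omega> p f \<longleftrightarrow>
     f \<in> borel_measurable (lebesgue_on \<Omega>) \<and> integrable (lebesgue_on \<Omega>) (\<lambda>x. norm (f x) powr p)"

definition W1p_function :: "'a::euclidean_space set \<Rightarrow> real \<Rightarrow> ('a \<Rightarrow> real) \<Rightarrow> bool" where
  "W1p_function \<Omega> p u \<longleftrightarrow>
     Lp_function \<Omega> p u \<and> (\<exists>g. is_weak_gradient \<Omega> u g \<and> Lp_function \<Omega> p g)"

definition W1p_norm :: "'a::euclidean_space set \<Rightarrow> real \<Rightarrow> ('a \<Rightarrow> real) \<Rightarrow> real" where
  "W1p_norm \<Omega> p u =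
     ((LINT x|lebesgue_on \<Omega>. \<bar>u x\<bar> powr p) +
      (LINT x|lebesgue_on \<Omega>. norm (weak_grad \<Omega> u x) powr p)) powr (1 / p)"

definition W1p0_function :: "'a::euclidean_space set \<Rightarrow> real \<Rightarrow> ('a \<Rightarrow> real) \<Rightarrow> bool" where
  "W1p0_function \<Omega> p u \<longleftrightarrow>
     W1p_function \<Omega> p u \<and>
     (\<forall>\<epsilon>>0. \<exists>\<phi>\<in>test_functions \<Omega>. W1p_norm \<Omega> p (\<lambda>x. u x - \<phi> x) < \<epsilon>)"

section \<open>The space of equivalence classes\<close>

text \<open>
  Elements of the Sobolev space are classes of functions that agree almost everywhere in \<open>\<Omega>\<close>;
  the values outside \<open>\<Omega>\<close> are irrelevant. Integral quantities are evaluated on an arbitrary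
  representative.
\<close>

definition ae_class :: "'a::euclidean_space set \<Rightarrow> ('a \<Rightarrow> real) \<Rightarrow> ('a \<Rightarrow> real) set" where
  "ae_class \<Omega> u = {v. AE x in lebesgue_on \<Omega>. v x = u x}"

definition rep :: "('a \<Rightarrow> real) set \<Rightarrow> 'a \<Rightarrow> real" where
  "rep U = (SOME u. u \<in> U)"

definition neg_class :: "('a \<Rightarrow> real) set \<Rightarrow> ('a \<Rightarrow> real) set" where
  "neg_class U = (\<lambda>u x. - u x) ` U"

definition W1p0 :: "'a::euclidean_space set \<Rightarrow> real \<Rightarrow> ('a \<Rightarrow> real) set set" where
  "W1p0 \<Omega> p = ae_class \<Omega> ` {u. W1p0_function \<Omega> p u}"

definition W1p0_dist ::
    "'a::euclidean_space set \<Rightarrow> real \<Rightarrow> ('a \<Rightarrow> real) set \<Rightarrow> ('a \<Rightarrow> real) set \<Rightarrow> real" where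
  "W1p0_dist \<Omega> p U V = W1p_norm \<Omega> p (\<lambda>x. rep U x - rep V x)"

definition W1p0_topology ::
    "'a::euclidean_space set \<Rightarrow> real \<Rightarrow> ('a \<Rightarrow> real) set topology" where
  "W1p0_topology \<Omega> p = Metric_space.mtopology (W1p0 \<Omega> p) (W1p0_dist \<Omega> p)"

definition grad_energy :: "'a::euclidean_space set \<Rightarrow> real \<Rightarrow> ('a \<Rightarrow> real) set \<Rightarrow> real" where
  "grad_energy \<Omega> p U = (LINT x|lebesgue_on \<Omega>. norm (weak_grad \<Omega> (rep U) x) powr p)"

definition A_plus ::
    "'a::euclidean_space set \<Rightarrow> ('a \<Rightarrow> real) \<Rightarrow> real \<Rightarrow> ('a \<Rightarrow> real) set set" where
  "A_plus \<Omega> m p =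
     {U \<in> W1p0 \<Omega> p. (LINT x|lebesgue_on \<Omega>. m x * \<bar>rep U x\<bar> powr p) = 1}"

section \<open>Genus and the second variational eigenvalue\<close>

text \<open>
  \<open>neg\<close> is the map \<open>v \<mapsto> -v\<close> on the space carrying the topology \<open>X\<close>, and \<open>Euclidean_space j\<close> is
  \<open>\<real>\<^sup>j\<close>. The infimum in \<^typ>\<open>enat\<close> is a minimum, or \<open>\<infinity>\<close> if there is no admissible \<open>j\<close>; the empty
  set has genus \<open>0\<close>.
\<close>

definition genus :: "'v topology \<Rightarrow> ('v \<Rightarrow> 'v) \<Rightarrow> 'v set \<Rightarrow> enat" where
  "genus X neg A =
     Inf {enat j | j. \<exists>\<phi>.
       continuous_map (subtopology X A) (subtopology (Euclidean_space j) (- {\<lambda>i. 0})) \<phi> \<and>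
       (\<forall>v\<in>A. \<forall>i. \<phi> (neg v) i = - \<phi> v i)}"

definition Sigma2 ::
    "'a::euclidean_space set \<Rightarrow> ('a \<Rightarrow> real) \<Rightarrow> real \<Rightarrow> ('a \<Rightarrow> real) set set set" where
  "Sigma2 \<Omega> m p =
     {A. A \<subseteq> A_plus \<Omega> m p \<and> (\<forall>U\<in>A. neg_class U \<in> A) \<and>
         compactin (W1p0_topology \<Omega> p) A \<and> genus (W1p0_topology \<Omega> p) neg_class A \<ge> 2}"

text \<open>
  For \<open>p > 1\<close> and a sign-changing weight the infimum and suprema are over nonempty bounded sets of
  reals: members of \<open>Sigma2\<close> are compact, and nonempty because their genus is positive.
\<close>

definition lambda2 :: "'a::euclidean_space set \<Rightarrow> ('a \<Rightarrow> real) \<Rightarrow> real \<Rightarrow> real" where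
  "lambda2 \<Omega> m p = (INF A\<in>Sigma2 \<Omega> m p. SUP U\<in>A. grad_energy \<Omega> p U)"

section \<open>The weight and the inradius quantity\<close>

definition changes_sign :: "'a set \<Rightarrow> ('a \<Rightarrow> real) \<Rightarrow> bool" where
  "changes_sign \<Omega> m \<longleftrightarrow> {x\<in>\<Omega>. m x > 0} \<noteq> {} \<and> {x\<in>\<Omega>. m x < 0} \<noteq> {}"

definition Omega_plus :: "'a::euclidean_space set \<Rightarrow> ('a \<Rightarrow> real) \<Rightarrow> 'a set" where
  "Omega_plus \<Omega> m = closure {x\<in>\<Omega>. m x > 0}"

definition R2_plus :: "'a::euclidean_space set \<Rightarrow> ('a \<Rightarrow> real) \<Rightarrow> real" where
  "R2_plus \<Omega> m =
     Sup {r. r > 0 \<and> (\<exists>x1\<in>Omega_plus \<Omega> m. \<exists>x2\<in>Omega_plus \<Omega> m.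
            ball x1 r \<inter> ball x2 r = {} \<and> ball x1 r \<subseteq> \<Omega> \<and> ball x2 r \<subseteq> \<Omega>)}"

end

theory Submission
  imports Defs "HOL-Computational_Algebra.Polynomial"
begin

text \<open>
  Write \<open>R\<close> for \<open>R2_plus \<Omega> m\<close> and \<open>n\<close> for the dimension. The limit is \<open>1 / R\<close> because for large \<open>p\<close> an
  optimal function is, in effect, a pair of cones of opposite sign: its two peaks of
  height about \<open>1\<close> sit where \<open>m\<close> is positive, and its slope is about the \<open>p\<close>-th root of its energy.

  Upper bound. Take two disjoint balls in \<open>\<Omega>\<close> of radius almost \<open>R\<close> with centres in \<open>Omega_plus\<close>. Move
  the centres slightly to points with \<open>m > 0\<close>, decrease the radius to \<open>\<rho>\<close> accordingly, and put over
  each ball a smooth version of the cone of height \<open>1\<close> (\<open>exists_smooth_cone\<close>). Since the supports are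
  disjoint, the linear combinations that lie on the constraint set form an odd closed curve, and the
  intermediate value theorem shows that its genus is at least two (\<open>odd_circle_genus_ge_2\<close>,
  \<open>two_bumps_Sigma2\<close>). As \<open>p\<close> grows, the weighted mass of a cone concentrates at its peak, where the
  weight is positive, so the \<open>p\<close>-th root of the mass is asymptotically at least any number below the
  height (\<open>eventually_weighted_mass_ge\<close>), while the gradient is at most \<open>1 / \<rho>\<close>. This yields
  \<open>eventually_lambda2_less\<close>.

  Lower bound. On a set \<open>A\<close> of genus at least two the odd continuous functional
  \<open>\<integral> m max(u,0)\<^sup>p - \<integral> m max(-u,0)\<^sup>p\<close> has a zero, so some \<open>u\<close> in \<open>A\<close> has weighted mass \<open>1/2\<close> in its
  positive and in its negative part (\<open>Sigma2_balanced_element\<close>). A test function \<open>f\<close> close to \<open>u\<close>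
  has almost these masses and at most slightly more energy (\<open>Sigma2_test_function\<close>). The masses force
  points \<open>x1\<close>, \<open>x2\<close> with \<open>m > 0\<close>, \<open>f x1 > c\<close> and \<open>f x2 < -c\<close>, where \<open>c\<close> tends to \<open>1\<close>. For \<open>p > n\<close> the
  function \<open>f\<close> is, up to an error at an arbitrarily small fixed scale \<open>d\<close>, Lipschitz with a constant
  asymptotic to the \<open>p\<close>-norm \<open>G\<close> of its gradient (\<open>almost_Lipschitz\<close>). As \<open>f\<close> vanishes outside \<open>\<Omega>\<close>
  and differs by \<open>2 c\<close> between \<open>x1\<close> and \<open>x2\<close>, the balls of radius about \<open>c / G\<close> around these points
  lie in \<open>\<Omega>\<close> and are disjoint, hence \<open>c / G\<close> is at most about \<open>R\<close> (\<open>R2_plus_ge\<close>, \<open>lambda2_ge\<close>).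

  Two tools carry the groundwork. Weak gradients are unique almost everywhere
  (\<open>fundamental_lemma_variations\<close>), so energies of classes can be computed on representatives. And the
  pointwise inequality \<open>powr_add_le\<close>, a form of the convexity of \<open>t\<^sup>p\<close> with a free parameter, gives
  Minkowski's inequality for the Sobolev norm as well as the continuity of the mass and of the energy.
\<close>

section \<open>Smooth functions on the whole space\<close>

definition grad :: "('a::euclidean_space \<Rightarrow> real) \<Rightarrow> 'a \<Rightarrow> 'a" where
  "grad f x = (\<Sum>i\<in>Basis. frechet_derivative f (at x) i *\<^sub>R i)"

lemma has_derivative_grad:
  assumes "f differentiable (at x)"
  shows "(f has_derivative (\<lambda>h. grad f x \<bullet> h)) (at x)"
proof -
  have D: "(f has_derivative frechet_derivative f (at x)) (at x)"
    using assms frechet_derivative_works by blast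
  interpret linear "frechet_derivative f (at x)"
    using D has_derivative_linear by blast
  have "frechet_derivative f (at x) = (\<lambda>h. grad f x \<bullet> h)"
  proof
    fix h
    have "frechet_derivative f (at x) h = frechet_derivative f (at x) (\<Sum>i\<in>Basis. (h \<bullet> i) *\<^sub>R i)"
      by (simp add: euclidean_representation)
    also have "\<dots> = (\<Sum>i\<in>Basis. (h \<bullet> i) * frechet_derivative f (at x) i)"
      by (simp add: sum scale)
    also have "\<dots> = grad f x \<bullet> h"
      unfolding grad_def inner_sum_left by (intro sum.cong) (auto simp: inner_commute)
    finally show "frechet_derivative f (at x) h = grad f x \<bullet> h" .
  qed
  with D show ?thesis by simp
qed

lemma grad_inner_Basis: "i \<in> Basis \<Longrightarrow> grad f x \<bullet> i = frechet_derivative f (at x) i"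
  by (simp add: grad_def inner_sum_left inner_Basis if_distrib cong: if_cong)

lemma has_derivative_imp_frechet:
  "(f has_derivative f') (at x) \<Longrightarrow> frechet_derivative f (at x) = f'"
  by (metis frechet_derivative_at)

lemma grad_eqI:
  assumes "(f has_derivative (\<lambda>h. g \<bullet> h)) (at x)"
  shows "grad f x = g"
  unfolding grad_def has_derivative_imp_frechet[OF assms]
  by (simp add: euclidean_representation)

lemma Ck_on_SucD: "Ck_on (Suc k) S f \<Longrightarrow> Ck_on k S f"
proof (induction k arbitrary: f)
  case 0
  then show ?case
    by (auto intro!: continuous_at_imp_continuous_on differentiable_imp_continuous_within)
next
  case (Suc k)
  have "\<forall>x\<in>S. f differentiable at x"
    and *: "\<forall>i\<in>Basis. Ck_on (Suc k) S (\<lambda>x. frechet_derivative f (at x) i)"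
    using Suc.prems unfolding Ck_on.simps(2)[of "Suc k" S f] by blast+
  moreover have "\<forall>i\<in>Basis. Ck_on k S (\<lambda>x. frechet_derivative f (at x) i)"
    using * Suc.IH by blast
  ultimately show ?case by simp
qed

lemma Ck_on_const: "Ck_on k UNIV (\<lambda>x. c)"
  by (induction k arbitrary: c) (auto simp: has_derivative_imp_frechet[OF has_derivative_const])

lemma Ck_on_inner: "Ck_on k UNIV (\<lambda>x. x \<bullet> v)"
proof (cases k)
  case (Suc j)
  have *: "((\<lambda>x. x \<bullet> v) has_derivative (\<lambda>h. h \<bullet> v)) (at x)" for x
    by (auto intro!: derivative_eq_intros)
  then show ?thesis
    unfolding Suc by (auto simp: has_derivative_imp_frechet[OF *] differentiable_def Ck_on_const)
qed (auto intro!: continuous_intros)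

lemma Ck_on_add:
  "Ck_on k UNIV f \<Longrightarrow> Ck_on k UNIV g \<Longrightarrow> Ck_on k UNIV (\<lambda>x. f x + g x)"
proof (induction k arbitrary: f g)
  case 0
  then show ?case by (auto intro: continuous_on_add)
next
  case (Suc k)
  have *: "((\<lambda>x. f x + g x) has_derivative
      (\<lambda>h. frechet_derivative f (at x) h + frechet_derivative g (at x) h)) (at x)" for x
    using Suc.prems by (auto intro!: has_derivative_add simp: frechet_derivative_works)
  show ?case
    using Suc by (auto simp: has_derivative_imp_frechet[OF *])
qed

lemma Ck_on_mult:
  "Ck_on k UNIV f \<Longrightarrow> Ck_on k UNIV g \<Longrightarrow> Ck_on k UNIV (\<lambda>x. f x * g x)"
proof (induction k arbitrary: f g)
  case 0
  then show ?case by (auto intro: continuous_on_mult)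
next
  case (Suc k)
  have *: "((\<lambda>x. f x * g x) has_derivative
      (\<lambda>h. f x * frechet_derivative g (at x) h + frechet_derivative f (at x) h * g x)) (at x)" for x
    using Suc.prems by (auto intro!: has_derivative_mult simp: frechet_derivative_works)
  have "Ck_on k UNIV f" "Ck_on k UNIV g"
    using Suc.prems Ck_on_SucD by blast+
  then show ?case
    using Suc by (auto simp: has_derivative_imp_frechet[OF *] differentiable_mult intro!: Ck_on_add)
qed

text \<open>The outer function is given with the sequence of its derivatives, because the induction
  runs through all of them.\<close>

lemma Ck_on_compose:
  assumes h: "\<And>n t. t \<in> T \<Longrightarrow> (h n has_real_derivative h (Suc n) t) (at t)"
    and T: "\<And>x. f x \<in> T" and f: "Ck_on k UNIV f"
  shows "Ck_on k UNIV (\<lambda>x. h n (f x))"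
  using f
proof (induction k arbitrary: n)
  case 0
  have "isCont (h n) (f x)" for x
    using h[OF T] DERIV_isCont by blast
  moreover have "isCont f x" for x
    using 0 by (simp add: continuous_on_eq_continuous_at)
  ultimately have "isCont (\<lambda>x. h n (f x)) x" for x
    by (rule isCont_o2[rotated])
  then show ?case by (simp add: continuous_at_imp_continuous_on)
next
  case (Suc k)
  have *: "((\<lambda>x. h n (f x)) has_derivative
      (\<lambda>v. frechet_derivative f (at x) v * h (Suc n) (f x))) (at x)" for x
  proof -
    have "(f has_derivative frechet_derivative f (at x)) (at x)"
      using Suc.prems by (auto simp: frechet_derivative_works)
    from DERIV_compose_FDERIV[OF h[OF T] this] show ?thesis .
  qed
  have "Ck_on k UNIV (\<lambda>x. h (Suc n) (f x))"
    using Suc.IH Suc.prems Ck_on_SucD by blast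
  then show ?case
    using Suc.prems * by (auto simp: has_derivative_imp_frechet[OF *] intro!: Ck_on_mult
       simp: differentiable_def)
qed

lemma Ck_on_sum:
  "(\<And>i. i \<in> I \<Longrightarrow> Ck_on k UNIV (f i)) \<Longrightarrow> Ck_on k UNIV (\<lambda>x. \<Sum>i\<in>I. f i x)"
  by (induction I rule: infinite_finite_induct) (auto intro: Ck_on_add simp: Ck_on_const)

lemma Ck_on_prod:
  "(\<And>i. i \<in> I \<Longrightarrow> Ck_on k UNIV (f i)) \<Longrightarrow> Ck_on k UNIV (\<lambda>x. \<Prod>i\<in>I. f i x)"
  by (induction I rule: infinite_finite_induct) (auto intro: Ck_on_mult simp: Ck_on_const)

lemma smooth_on_differentiable: "smooth_on UNIV f \<Longrightarrow> f differentiable (at x)"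
  by (metis Ck_on.simps(2) UNIV_I smooth_on_def)

lemma smooth_on_continuous: "smooth_on UNIV f \<Longrightarrow> continuous_on S f"
  by (metis Ck_on.simps(1) smooth_on_def continuous_on_subset subset_UNIV)

lemma smooth_on_frechet:
  "smooth_on UNIV f \<Longrightarrow> i \<in> Basis \<Longrightarrow> smooth_on UNIV (\<lambda>x. frechet_derivative f (at x) i)"
  unfolding smooth_on_def by (metis Ck_on.simps(2))

lemma smooth_on_grad_continuous: "smooth_on UNIV f \<Longrightarrow> continuous_on S (grad f)"
  unfolding grad_def
  by (intro continuous_intros smooth_on_continuous smooth_on_frechet)

lemma smooth_on_sqrt:
  assumes f: "smooth_on UNIV f" and pos: "\<And>x. f x > 0"
  shows "smooth_on UNIV (\<lambda>x. sqrt (f x))"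
proof -
  define h :: "nat \<Rightarrow> real \<Rightarrow> real" where
    "h n t = (\<Prod>j<n. 1/2 - real j) * t powr (1/2 - real n)" for n t
  have "(h n has_real_derivative h (Suc n) t) (at t)" if "t \<in> {0<..}" for n t
  proof -
    have "1/2 - real n - 1 = 1/2 - real (Suc n)" by simp
    then show ?thesis
      using DERIV_cmult[OF has_real_derivative_powr[of t "1/2 - real n"], of "\<Prod>j<n. 1/2 - real j"] that
      by (simp add: h_def[abs_def] mult.assoc)
  qed
  then have "Ck_on k UNIV (\<lambda>x. h 0 (f x))" for k
    using f pos by (intro Ck_on_compose[where T="{0<..}" and h=h]) (auto simp: smooth_on_def)
  moreover have "h 0 (f x) = sqrt (f x)" for x
    using pos[of x] by (simp add: h_def powr_half_sqrt)
  ultimately show ?thesis by (simp add: smooth_on_def)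
qed

section \<open>A flat function\<close>

text \<open>The functions \<open>q(1/t) exp(-1/t)\<close>, extended by zero to \<open>t \<le> 0\<close>, form a family that is closed under
  differentiation, which provides all derivatives of \<open>exp(-1/t)\<close> at once.\<close>

definition flat_poly :: "real poly \<Rightarrow> real \<Rightarrow> real" where
  "flat_poly q t = (if t > 0 then poly q (1 / t) * exp (- 1 / t) else 0)"

lemma poly_exp_neg_tendsto_0:
  fixes q :: "real poly"
  shows "((\<lambda>s. poly q s * exp (- s)) \<longlongrightarrow> 0) at_top"
proof -
  have *: "((\<lambda>s::real. coeff q i * (s ^ i / exp s)) \<longlongrightarrow> coeff q i * 0) at_top" for i
    by (intro tendsto_mult tendsto_const tendsto_power_div_exp_0)
  have "((\<lambda>s. \<Sum>i\<le>degree q. coeff q i * (s ^ i / exp s)) \<longlongrightarrow> (\<Sum>i\<le>degree q. coeff q i * 0)) at_top"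
    by (rule tendsto_sum) (rule *)
  moreover have "(\<Sum>i\<le>degree q. coeff q i * (s ^ i / exp s)) = poly q s * exp (- s)" for s
    by (simp add: poly_altdef sum_distrib_right exp_minus divide_inverse mult.assoc)
  ultimately show ?thesis by simp
qed

lemma flat_poly_tendsto_0: "((\<lambda>t. flat_poly q t) \<longlongrightarrow> 0) (at 0)"
proof -
  have "((\<lambda>t. poly q (1 / t) * exp (- (1 / t))) \<longlongrightarrow> 0) (at_right 0)"
  proof (rule filterlim_compose[OF poly_exp_neg_tendsto_0])
    show "LIM t at_right (0::real). 1 / t :> at_top"
      using filterlim_inverse_at_top_right by (simp add: inverse_eq_divide)
  qed
  moreover have "eventually (\<lambda>t. poly q (1 / t) * exp (- (1 / t)) = flat_poly q t) (at_right 0)"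
    by (auto simp: flat_poly_def eventually_at_filter)
  ultimately have "((\<lambda>t. flat_poly q t) \<longlongrightarrow> 0) (at_right 0)"
    using tendsto_cong by fast
  moreover have "eventually (\<lambda>t. 0 = flat_poly q t) (at_left 0)"
    by (auto simp: flat_poly_def eventually_at_filter)
  then have "((\<lambda>t. flat_poly q t) \<longlongrightarrow> 0) (at_left 0)"
    using tendsto_cong tendsto_const by fast
  ultimately show ?thesis by (simp add: filterlim_at_split)
qed

text \<open>Away from zero this is the product rule; at zero the difference quotient is again a member of the
  family, and every member tends to zero there.\<close>

lemma flat_poly_derivative:
  "(flat_poly q has_real_derivative flat_poly ([:0,0,1:] * (q - pderiv q)) t) (at t)"
proof -
  consider "t < 0" | "t = 0" | "t > 0" by linarith
  then show ?thesis
  proof cases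
    case 1
    have "((\<lambda>t. 0) has_real_derivative 0) (at t)" by simp
    then have "(flat_poly q has_real_derivative 0) (at t)"
      by (rule has_field_derivative_transform_within_open[where S="{..<0}"])
        (use 1 in \<open>auto simp: flat_poly_def\<close>)
    then show ?thesis using 1 by (simp add: flat_poly_def)
  next
    case 2
    have "flat_poly q y / y = flat_poly ([:0,1:] * q) y" for y
      by (simp add: flat_poly_def)
    then have "((\<lambda>y. (flat_poly q y - flat_poly q 0) / (y - 0)) \<longlongrightarrow> 0) (at 0)"
      using flat_poly_tendsto_0[of "[:0,1:] * q"] by (simp add: flat_poly_def)
    then show ?thesis using 2
      by (simp add: has_field_derivative_iff) (simp add: flat_poly_def)
  next
    case 3
    have "((\<lambda>t. poly q (1 / t) * exp (- 1 / t)) has_real_derivative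
        flat_poly ([:0,0,1:] * (q - pderiv q)) t) (at t)"
      using 3 by (auto intro!: derivative_eq_intros DERIV_chain'[where g="poly q"]
          simp: flat_poly_def field_simps power2_eq_square)
    then show ?thesis
      by (rule has_field_derivative_transform_within_open[where S="{0<..}"])
        (use 3 in \<open>auto simp: flat_poly_def\<close>)
  qed
qed

definition flat :: "real \<Rightarrow> real" where
  "flat t = (if t > 0 then exp (- 1 / t) else 0)"

lemma smooth_on_flat:
  assumes f: "smooth_on UNIV f"
  shows "smooth_on UNIV (\<lambda>x. flat (f x))"
proof -
  define Q where "Q n = ((\<lambda>q. [:0,0,1:] * (q - pderiv q)) ^^ n) (1::real poly)" for n
  have "Ck_on k UNIV (\<lambda>x. flat_poly (Q 0) (f x))" for k
    by (intro Ck_on_compose[where T=UNIV and h="\<lambda>n. flat_poly (Q n)"])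
      (use f flat_poly_derivative in \<open>auto simp: smooth_on_def Q_def\<close>)
  moreover have "flat_poly (Q 0) t = flat t" for t
    by (cases "t > 0") (simp_all add: flat_def flat_poly_def Q_def)
  ultimately show ?thesis by (simp add: smooth_on_def)
qed

section \<open>Test functions and integration by parts\<close>

lemma smooth_on_const: "smooth_on UNIV (\<lambda>x. c)"
  and smooth_on_inner: "smooth_on UNIV (\<lambda>x. x \<bullet> v)"
  and smooth_on_add: "smooth_on UNIV f \<Longrightarrow> smooth_on UNIV g \<Longrightarrow> smooth_on UNIV (\<lambda>x. f x + g x)"
  and smooth_on_mult: "smooth_on UNIV f \<Longrightarrow> smooth_on UNIV g \<Longrightarrow> smooth_on UNIV (\<lambda>x. f x * g x)"
  and smooth_on_sum: "(\<And>i. i \<in> I \<Longrightarrow> smooth_on UNIV (h i)) \<Longrightarrow> smooth_on UNIV (\<lambda>x. \<Sum>i\<in>I. h i x)"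
  and smooth_on_prod: "(\<And>i. i \<in> I \<Longrightarrow> smooth_on UNIV (h i)) \<Longrightarrow> smooth_on UNIV (\<lambda>x. \<Prod>i\<in>I. h i x)"
  by (simp_all add: smooth_on_def Ck_on_const Ck_on_inner Ck_on_add Ck_on_mult Ck_on_sum Ck_on_prod)

lemma smooth_chain:
  assumes f: "smooth_on UNIV f" and g: "(g has_vector_derivative g') (at t within U)"
  shows "((\<lambda>t. f (g t)) has_vector_derivative (grad f (g t) \<bullet> g')) (at t within U)"
  using has_derivative_compose[OF g[unfolded has_vector_derivative_def]
      has_derivative_grad[OF smooth_on_differentiable[OF f]]]
  by (simp add: has_vector_derivative_def mult.commute)

lemma grad_eq_0_outside:
  assumes "compact K" and "\<And>x. x \<notin> K \<Longrightarrow> f x = 0" and x: "x \<notin> K"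
  shows "grad f x = 0"
proof (rule grad_eqI)
  have "((\<lambda>x. 0) has_derivative (\<lambda>h. 0 \<bullet> h)) (at x)" by simp
  then show "(f has_derivative (\<lambda>h. 0 \<bullet> h)) (at x)"
    by (rule has_derivative_transform_within_open[where s="- K"])
      (use assms compact_imp_closed in auto)
qed

lemma test_functionsI:
  assumes "smooth_on UNIV \<phi>" "compact K" "K \<subseteq> \<Omega>" "\<And>x. x \<notin> K \<Longrightarrow> \<phi> x = 0"
  shows "\<phi> \<in> test_functions \<Omega>"
proof -
  have sub: "closure {x. \<phi> x \<noteq> 0} \<subseteq> K"
    using assms by (intro closure_minimal) (auto simp: compact_imp_closed)
  then have "compact (closure {x. \<phi> x \<noteq> 0})"
    using assms(2) by (meson bounded_subset closed_closure compact_eq_bounded_closed)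
  then show ?thesis using sub assms by (auto simp: test_functions_def)
qed

lemma test_functionsE:
  assumes "\<phi> \<in> test_functions \<Omega>"
  obtains K where "compact K" "K \<subseteq> \<Omega>" "\<And>x. x \<notin> K \<Longrightarrow> \<phi> x = 0" "\<And>x. x \<notin> K \<Longrightarrow> grad \<phi> x = 0"
    "smooth_on UNIV \<phi>"
proof -
  let ?K = "closure {x. \<phi> x \<noteq> 0}"
  have K: "compact ?K" "?K \<subseteq> \<Omega>" "smooth_on UNIV \<phi>"
    using assms by (auto simp: test_functions_def)
  have 0: "\<phi> x = 0" if "x \<notin> ?K" for x
    using that subsetD[OF closure_subset, of x "{x. \<phi> x \<noteq> 0}"] by blast
  have g: "grad \<phi> x = 0" if "x \<notin> ?K" for x
    using K(1) 0 that by (rule grad_eq_0_outside)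
  show ?thesis by (rule that[OF K(1,2) 0 g K(3)])
qed

lemma grad_add_scaled:
  assumes "smooth_on UNIV f" "smooth_on UNIV g"
  shows "grad (\<lambda>x. a * f x + b * g x) x = a *\<^sub>R grad f x + b *\<^sub>R grad g x"
proof (rule grad_eqI)
  have "((\<lambda>x. a * f x + b * g x) has_derivative (\<lambda>h. a * (grad f x \<bullet> h) + b * (grad g x \<bullet> h))) (at x)"
    using assms by (auto intro!: derivative_intros has_derivative_grad smooth_on_differentiable)
  then show "((\<lambda>x. a * f x + b * g x) has_derivative (\<lambda>h. (a *\<^sub>R grad f x + b *\<^sub>R grad g x) \<bullet> h)) (at x)"
    by (simp add: inner_add_left)
qed

lemma test_functions_add_scaled:
  assumes "\<phi> \<in> test_functions \<Omega>" "\<psi> \<in> test_functions \<Omega>"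
  shows "(\<lambda>x. a * \<phi> x + b * \<psi> x) \<in> test_functions \<Omega>"
proof -
  obtain K L where "compact K" "K \<subseteq> \<Omega>" "\<And>x. x \<notin> K \<Longrightarrow> \<phi> x = 0" "smooth_on UNIV \<phi>"
    and "compact L" "L \<subseteq> \<Omega>" "\<And>x. x \<notin> L \<Longrightarrow> \<psi> x = 0" "smooth_on UNIV \<psi>"
    using assms by (metis test_functionsE)
  then show ?thesis
    by (intro test_functionsI[where K="K \<union> L"] smooth_on_add smooth_on_mult smooth_on_const) auto
qed

lemma
  fixes f :: "'a::euclidean_space \<Rightarrow> 'b::euclidean_space"
  assumes f: "continuous_on UNIV f" "compact K" "\<And>x. x \<notin> K \<Longrightarrow> f x = 0"
  shows compact_support_integrable_lborel: "integrable lborel f"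
    and compact_support_integrable_lebesgue: "integrable lebesgue f"
    and compact_support_integral_lebesgue: "integral\<^sup>L lebesgue f = integral\<^sup>L lborel f"
    and compact_support_integral_cbox: "K \<subseteq> cbox a b \<Longrightarrow> integral (cbox a b) f = integral\<^sup>L lborel f"
proof -
  have "(\<lambda>x. indicator K x *\<^sub>R f x) = f"
    using f(3) by (auto simp: indicator_def fun_eq_iff)
  then show int: "integrable lborel f"
    using borel_integrable_compact[OF f(2), of f] continuous_on_subset[OF f(1)] by force
  have meas: "f \<in> borel_measurable lborel"
    using int by auto
  show "integrable lebesgue f"
    using int integrable_completion[OF meas] by simp
  show "integral\<^sup>L lebesgue f = integral\<^sup>L lborel f"
    using integral_completion[OF meas] .
  assume "K \<subseteq> cbox a b"
  then have "(\<lambda>x. if x \<in> cbox a b then f x else 0) = f"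
    using f(3) by (auto simp: fun_eq_iff)
  then show "integral (cbox a b) f = integral\<^sup>L lborel f"
    using has_integral_integral_lborel[OF int] Henstock_Kurzweil_Integration.integral_restrict_UNIV[of "cbox a b" f]
    by (simp add: integral_unique)
qed

lemma
  fixes f :: "'a::euclidean_space \<Rightarrow> 'b::euclidean_space"
  assumes S: "S \<in> sets lebesgue" and f: "\<And>x. x \<notin> S \<Longrightarrow> f x = 0"
  shows integral_lebesgue_on_support: "integral\<^sup>L (lebesgue_on S) f = integral\<^sup>L lebesgue f"
    and integrable_lebesgue_on_support: "integrable (lebesgue_on S) f \<longleftrightarrow> integrable lebesgue f"
proof -
  have "(\<lambda>x. if x \<in> S then f x else 0) = f"
    using f by (auto simp: fun_eq_iff)
  then show "integral\<^sup>L (lebesgue_on S) f = integral\<^sup>L lebesgue f"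
    "integrable (lebesgue_on S) f \<longleftrightarrow> integrable lebesgue f"
    using Lebesgue_Measure.integral_restrict_UNIV[OF S, of f]
      Lebesgue_Measure.integrable_restrict_UNIV[OF S, of f] by simp_all
qed

lemma integral_lborel_translate:
  fixes f :: "'a::euclidean_space \<Rightarrow> real"
  assumes "f \<in> borel_measurable borel"
  shows "(LINT x|lborel. f (c + x)) = integral\<^sup>L lborel f"
  using integral_distr[of "(+) c" lborel borel f] assms by (simp add: lborel_distr_plus)

text \<open>The integral of the translate \<open>f(t v + \<cdot>)\<close> does not depend on \<open>t\<close>; differentiating it at \<open>t = 0\<close> under
  the integral sign gives the integral of the directional derivative.\<close>

lemma integral_partial_derivative_eq_0:
  fixes f :: "'a::euclidean_space \<Rightarrow> real"
  assumes f: "smooth_on UNIV f" and K: "compact K" and 0: "\<And>x. x \<notin> K \<Longrightarrow> f x = 0"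
  shows "(LINT x|lborel. grad f x \<bullet> v) = 0"
proof -
  \<comment> \<open>A compact set outside of which all translates \<open>f (t v + \<cdot>)\<close> with \<open>t\<close> in the unit interval vanish.\<close>
  define L where "L = {x + y | x y. x \<in> K \<and> y \<in> (\<lambda>t. (- t) *\<^sub>R v) ` {0..1}}"
  have L: "compact L"
    unfolding L_def by (intro compact_sums K compact_continuous_image) (auto intro!: continuous_intros)
  then obtain a where a: "L \<subseteq> cbox (- a) a"
    using bounded_subset_cbox_symmetric compact_imp_bounded by blast
  have KL: "K \<subseteq> L"
    unfolding L_def by (force intro: image_eqI[where x=0])
  define F where "F t = integral (cbox (- a) a) (\<lambda>x. f (t *\<^sub>R v + x))" for t
  have F: "F t = integral\<^sup>L lborel f" if t: "t \<in> {0..1}" for t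
  proof -
    have "f (t *\<^sub>R v + x) = 0" if "x \<notin> L" for x
    proof (rule 0, rule notI)
      assume "t *\<^sub>R v + x \<in> K"
      then have "(t *\<^sub>R v + x) + (- t) *\<^sub>R v \<in> L"
        unfolding L_def using t by blast
      then show False using that by simp
    qed
    moreover have "continuous_on UNIV (\<lambda>x. f (t *\<^sub>R v + x))"
      by (intro continuous_on_compose2[OF smooth_on_continuous[OF f, of UNIV]] continuous_intros) auto
    ultimately have "F t = (LINT x|lborel. f (t *\<^sub>R v + x))"
      unfolding F_def using a L by (intro compact_support_integral_cbox[of _ L]) auto
    also have "\<dots> = integral\<^sup>L lborel f"
      using smooth_on_continuous[OF f] by (intro integral_lborel_translate borel_measurable_continuous_onI)
    finally show ?thesis .
  qed
  have cont: "continuous_on S (\<lambda>x. grad f (t *\<^sub>R v + x) \<bullet> v)" for S t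
    by (intro continuous_intros continuous_on_compose2[OF smooth_on_grad_continuous[OF f, of UNIV]]) auto
  have "(F has_vector_derivative integral (cbox (- a) a) (\<lambda>x. grad f (0 *\<^sub>R v + x) \<bullet> v)) (at 0 within {0..1})"
    unfolding F_def
  proof (rule leibniz_rule_vector_derivative)
    show "((\<lambda>t. f (t *\<^sub>R v + x)) has_vector_derivative grad f (t *\<^sub>R v + x) \<bullet> v) (at t within {0..1})"
      for x t
      by (rule smooth_chain[OF f]) (auto intro!: derivative_eq_intros)
    show "(\<lambda>x. f (t *\<^sub>R v + x)) integrable_on cbox (- a) a" for t
      by (intro integrable_continuous continuous_on_compose2[OF smooth_on_continuous[OF f, of UNIV]]
          continuous_intros) auto
    show "continuous_on ({0..1} \<times> cbox (- a) a) (\<lambda>(t, x). grad f (t *\<^sub>R v + x) \<bullet> v)"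
      unfolding case_prod_unfold
      by (intro continuous_intros continuous_on_compose2[OF smooth_on_grad_continuous[OF f, of UNIV]]) auto
  qed auto
  moreover have "(F has_vector_derivative 0) (at 0 within {0..1})"
    by (rule has_vector_derivative_transform[OF _ _ has_vector_derivative_const[of "integral\<^sup>L lborel f"]])
      (auto simp: F)
  ultimately have "integral (cbox (- a) a) (\<lambda>x. grad f x \<bullet> v) = 0"
    using vector_derivative_unique_within_closed_interval[of 0 1 0 F] by simp
  moreover have "integral (cbox (- a) a) (\<lambda>x. grad f x \<bullet> v) = (LINT x|lborel. grad f x \<bullet> v)"
    using a KL grad_eq_0_outside[OF K 0] cont[of _ 0]
    by (intro compact_support_integral_cbox[OF _ K]) auto
  ultimately show ?thesis by simp
qed

lemma grad_mult:
  assumes "smooth_on UNIV f" "smooth_on UNIV g"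
  shows "grad (\<lambda>x. f x * g x) x = f x *\<^sub>R grad g x + g x *\<^sub>R grad f x"
proof (rule grad_eqI)
  have "((\<lambda>x. f x * g x) has_derivative (\<lambda>h. f x * (grad g x \<bullet> h) + (grad f x \<bullet> h) * g x)) (at x)"
    using assms by (intro has_derivative_mult has_derivative_grad smooth_on_differentiable)
  then show "((\<lambda>x. f x * g x) has_derivative (\<lambda>h. (f x *\<^sub>R grad g x + g x *\<^sub>R grad f x) \<bullet> h)) (at x)"
    by (simp add: inner_add_left mult.commute)
qed

lemma locally_integrable_on_continuous:
  fixes f :: "'a::euclidean_space \<Rightarrow> 'b::euclidean_space"
  assumes "continuous_on \<Omega> f"
  shows "locally_integrable_on f \<Omega>"
  unfolding locally_integrable_on_def
proof (intro allI impI)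
  fix K assume K: "compact K \<and> K \<subseteq> \<Omega>"
  then have "integrable lborel (\<lambda>x. indicator K x *\<^sub>R f x)"
    using assms by (intro borel_integrable_compact) (auto intro: continuous_on_subset)
  moreover from this have "(\<lambda>x. indicator K x *\<^sub>R f x) \<in> borel_measurable lborel" by auto
  ultimately show "f absolutely_integrable_on K"
    unfolding set_integrable_def using integrable_completion by blast
qed

text \<open>Integration by parts is the vanishing of the integral of a partial derivative, applied to
  \<open>f \<phi>\<close>.\<close>

lemma is_weak_gradient_smooth:
  assumes \<Omega>: "open \<Omega>" and f: "smooth_on UNIV f"
  shows "is_weak_gradient \<Omega> f (grad f)"
  unfolding is_weak_gradient_def
proof (intro conjI ballI)
  show "locally_integrable_on f \<Omega>" "locally_integrable_on (grad f) \<Omega>"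
    using f by (auto intro: locally_integrable_on_continuous smooth_on_continuous smooth_on_grad_continuous)
  fix \<phi> i assume \<phi>: "\<phi> \<in> test_functions \<Omega>" and i: "i \<in> (Basis :: 'a set)"
  obtain K where K: "compact K" "K \<subseteq> \<Omega>" "\<And>x. x \<notin> K \<Longrightarrow> \<phi> x = 0"
    "\<And>x. x \<notin> K \<Longrightarrow> grad \<phi> x = 0" "smooth_on UNIV \<phi>"
    using test_functionsE[OF \<phi>] by blast
  have sets: "\<Omega> \<in> sets lebesgue" using \<Omega> by simp
  note cont = smooth_on_continuous[OF f] smooth_on_continuous[OF K(5)]
    smooth_on_grad_continuous[OF f] smooth_on_grad_continuous[OF K(5)]
  have int: "integrable lborel (\<lambda>x. f x * (grad \<phi> x \<bullet> i))" "integrable lborel (\<lambda>x. (grad f x \<bullet> i) * \<phi> x)"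
    by (rule compact_support_integrable_lborel[OF _ K(1)]; use K in \<open>auto intro!: continuous_intros cont\<close>)+
  have eq: "integral\<^sup>L (lebesgue_on \<Omega>) h = integral\<^sup>L lborel h" if "continuous_on UNIV h" "\<And>x. x \<notin> K \<Longrightarrow> h x = 0"
    for h :: "'a \<Rightarrow> real"
    using integral_lebesgue_on_support[OF sets, of h] compact_support_integral_lebesgue[OF that(1) K(1) that(2)]
      that(2) K(2) by auto
  have "0 = (LINT x|lborel. grad (\<lambda>x. f x * \<phi> x) x \<bullet> i)"
    using K f by (intro integral_partial_derivative_eq_0[of _ K, symmetric] smooth_on_mult) auto
  also have "\<dots> = (LINT x|lborel. f x * (grad \<phi> x \<bullet> i) + (grad f x \<bullet> i) * \<phi> x)"
    unfolding grad_mult[OF f K(5)] by (simp add: inner_add_left mult.commute)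
  also have "\<dots> = (LINT x|lborel. f x * (grad \<phi> x \<bullet> i)) + (LINT x|lborel. (grad f x \<bullet> i) * \<phi> x)"
    using int by (rule Bochner_Integration.integral_add)
  finally have "(LINT x|lborel. f x * (grad \<phi> x \<bullet> i)) = - (LINT x|lborel. (grad f x \<bullet> i) * \<phi> x)"
    by simp
  then have "(LINT x|lebesgue_on \<Omega>. f x * (grad \<phi> x \<bullet> i)) = - (LINT x|lebesgue_on \<Omega>. (grad f x \<bullet> i) * \<phi> x)"
    using K by (subst (1 2) eq) (auto intro!: continuous_intros cont)
  then show "(LINT x|lebesgue_on \<Omega>. f x * frechet_derivative \<phi> (at x) i) =
      - (LINT x|lebesgue_on \<Omega>. (grad f x \<bullet> i) * \<phi> x)"
    using i by (simp add: grad_inner_Basis)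
qed

section \<open>Uniqueness of weak gradients\<close>

lemma locally_integrable_times_compact_support:
  fixes f :: "'a::euclidean_space \<Rightarrow> 'b::euclidean_space"
  assumes \<Omega>: "open \<Omega>" and f: "locally_integrable_on f \<Omega>" and K: "compact K" "K \<subseteq> \<Omega>"
    and \<psi>: "continuous_on UNIV \<psi>" "\<And>x. x \<notin> K \<Longrightarrow> \<psi> x = 0"
  shows "integrable (lebesgue_on \<Omega>) (\<lambda>x. \<psi> x *\<^sub>R f x)"
proof -
  have sets: "\<Omega> \<in> sets lebesgue" "K \<in> sets lebesgue"
    using \<Omega> fmeasurableD[OF lmeasurable_compact[OF K(1)]] by auto
  have "f absolutely_integrable_on K"
    using f K by (auto simp: locally_integrable_on_def)
  moreover have "continuous_on K \<psi>"
    using \<psi> continuous_on_subset by blast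
  ultimately have "(\<lambda>x. \<psi> x *\<^sub>R f x) absolutely_integrable_on K"
    using K sets by (intro absolutely_integrable_bounded_measurable_product[where h="(*\<^sub>R)"])
      (auto simp: bilinear_def linear_iff algebra_simps intro!: continuous_imp_measurable_on_sets_lebesgue
         compact_imp_bounded compact_continuous_image)
  moreover have "(\<lambda>x. indicator K x *\<^sub>R (\<psi> x *\<^sub>R f x)) = (\<lambda>x. \<psi> x *\<^sub>R f x)"
    using \<psi>(2) by (auto simp: fun_eq_iff indicator_def)
  ultimately have "integrable lebesgue (\<lambda>x. \<psi> x *\<^sub>R f x)"
    by (simp add: set_integrable_def)
  then show ?thesis
    using integrable_lebesgue_on_support[OF sets(1), of "\<lambda>x. \<psi> x *\<^sub>R f x"] \<psi>(2) K by auto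
qed

text \<open>Since \<open>flat (k t)\<close> tends to \<open>1\<close> for every \<open>t > 0\<close> as \<open>k\<close> grows, these smooth functions converge to the
  indicator of the open box while all of them vanish outside it.\<close>

definition box_bump :: "'a::euclidean_space \<Rightarrow> 'a \<Rightarrow> nat \<Rightarrow> 'a \<Rightarrow> real" where
  "box_bump a b k x =
     (\<Prod>i\<in>Basis. flat (real (Suc k) * (x \<bullet> i - a \<bullet> i)) * flat (real (Suc k) * (b \<bullet> i - x \<bullet> i)))"

lemma flat_nonneg: "0 \<le> flat t" and flat_le_1: "flat t \<le> 1"
  by (auto simp: flat_def)

lemma smooth_on_box_bump: "smooth_on UNIV (box_bump a b k)"
proof -
  have *: "smooth_on UNIV (\<lambda>x::'a. real (Suc k) * (x \<bullet> i - a \<bullet> i))"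
    "smooth_on UNIV (\<lambda>x::'a. real (Suc k) * (b \<bullet> i - x \<bullet> i))" for i
    using smooth_on_mult[OF smooth_on_const smooth_on_add[OF smooth_on_inner[of i] smooth_on_const[of "- (a \<bullet> i)"]], of "real (Suc k)"]
    using smooth_on_mult[OF smooth_on_const smooth_on_add[OF smooth_on_inner[of "- i"] smooth_on_const[of "b \<bullet> i"]], of "real (Suc k)"]
    by (simp_all add: algebra_simps)
  show ?thesis
    unfolding box_bump_def[abs_def]
    by (intro smooth_on_prod smooth_on_mult smooth_on_flat *)
qed

lemma box_bump_bounds: "0 \<le> box_bump a b k x" "box_bump a b k x \<le> 1"
  unfolding box_bump_def
  by (auto intro!: prod_nonneg prod_le_1 mult_nonneg_nonneg mult_le_one flat_nonneg flat_le_1)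

lemma box_bump_eq_0: "x \<notin> box a b \<Longrightarrow> box_bump a b k x = 0"
proof -
  assume "x \<notin> box a b"
  then obtain i where "i \<in> Basis" "x \<bullet> i \<le> a \<bullet> i \<or> b \<bullet> i \<le> x \<bullet> i"
    by (auto simp: mem_box not_less)
  then have "flat (real (Suc k) * (x \<bullet> i - a \<bullet> i)) * flat (real (Suc k) * (b \<bullet> i - x \<bullet> i)) = 0"
    unfolding flat_def by (auto simp: zero_less_mult_iff)
  then show ?thesis
    unfolding box_bump_def using \<open>i \<in> Basis\<close> by (auto intro!: prod_zero)
qed

lemma flat_scaled_tendsto:
  assumes "t > 0"
  shows "(\<lambda>k. flat (real (Suc k) * t)) \<longlonglongrightarrow> 1"
proof -
  have "(\<lambda>k. exp (- (1 / t) * (1 / real (Suc k)))) \<longlonglongrightarrow> exp (- (1 / t) * 0)"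
    by (intro tendsto_intros LIMSEQ_Suc lim_1_over_n)
  moreover have "exp (- (1 / t) * (1 / real (Suc k))) = flat (real (Suc k) * t)" for k
    using assms by (simp add: flat_def mult.commute)
  ultimately show ?thesis by simp
qed

lemma box_bump_tendsto: "(\<lambda>k. box_bump a b k x) \<longlonglongrightarrow> indicator (box a b) x"
proof (cases "x \<in> box a b")
  case True
  have "(\<lambda>k. box_bump a b k x) \<longlonglongrightarrow> (\<Prod>i\<in>(Basis::'a set). 1 * 1)"
    unfolding box_bump_def
    by (intro tendsto_prod tendsto_mult flat_scaled_tendsto) (use True in \<open>auto simp: mem_box\<close>)
  then show ?thesis using True by simp
qed (simp add: box_bump_eq_0)

lemma AE_lebesgue_on_iff:
  "S \<in> sets lebesgue \<Longrightarrow> (AE x in lebesgue_on S. P x) \<longleftrightarrow> (AE x in lebesgue. x \<in> S \<longrightarrow> P x)"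
  by (simp add: AE_restrict_space_iff)

lemma locally_integrable_scaleR_add:
  fixes f g :: "'a::euclidean_space \<Rightarrow> 'b::euclidean_space"
  assumes "locally_integrable_on f \<Omega>" "locally_integrable_on g \<Omega>"
  shows "locally_integrable_on (\<lambda>x. a *\<^sub>R f x + b *\<^sub>R g x) \<Omega>"
  using assms unfolding locally_integrable_on_def
  by (auto intro!: set_integral_add)

text \<open>Boxes form an intersection-stable generator of the Borel sets, so the integral of \<open>G\<close> vanishes over
  every Borel set, in particular over \<open>{G > 0}\<close> and \<open>{G < 0}\<close>. The bounded support makes the whole
  space one of the sets with vanishing integral, which the complement step needs.\<close>

lemma box_integrals_eq_0_imp_AE_0:
  fixes G :: "'a::euclidean_space \<Rightarrow> real"
  assumes G: "integrable lebesgue G" and 0: "\<And>a b. (LINT x:box a b|lebesgue. G x) = 0"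
    and supp: "\<And>x. x \<notin> box c d \<Longrightarrow> G x = 0"
  shows "AE x in lebesgue. G x = 0"
proof -
  have int: "set_integrable lebesgue A G" if "A \<in> sets borel" for A
    unfolding set_integrable_def using G that by (intro integrable_mult_indicator) auto
  have UNIV: "integral\<^sup>L lebesgue G = 0"
  proof -
    have "integral\<^sup>L lebesgue G = (LINT x:box c d|lebesgue. G x)"
      unfolding set_lebesgue_integral_def
      by (intro Bochner_Integration.integral_cong) (auto simp: supp indicator_def)
    then show ?thesis using 0 by simp
  qed
  have *: "(LINT x:A|lebesgue. G x) = 0" if "A \<in> sets borel" for A
  proof -
    have A: "A \<in> sigma_sets UNIV (range (\<lambda>(a, b). box a b :: 'a set))"
      using that unfolding borel_eq_box by simp
    have meas: "B \<in> sets borel" if "B \<in> sigma_sets UNIV (range (\<lambda>(a, b). box a b :: 'a set))" for B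
      using that unfolding borel_eq_box by simp
    have "Int_stable (range (\<lambda>(a, b). box a b :: 'a set))"
      by (auto simp: Int_stable_def box_Int_box)
    moreover have "range (\<lambda>(a, b). box a b :: 'a set) \<subseteq> Pow UNIV" by simp
    ultimately show ?thesis using A
    proof (induction rule: sigma_sets_induct_disjoint)
      case (basic A)
      then show ?case using 0 by auto
    next
      case empty
      then show ?case by (simp add: set_lebesgue_integral_def)
    next
      case (compl A)
      have "(LINT x:A \<union> (UNIV - A)|lebesgue. G x) = (LINT x:A|lebesgue. G x) + (LINT x:UNIV - A|lebesgue. G x)"
        using meas[OF compl(1)] by (intro set_integral_Un int) auto
      then show ?case using compl UNIV by (simp add: set_lebesgue_integral_def)
    next
      case (union A)
      have "(LINT x:(\<Union>i. A i)|lebesgue. G x) = (\<Sum>i. LINT x:A i|lebesgue. G x)"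
      proof (rule lebesgue_integral_countable_add)
        have Ai: "A i \<in> sets borel" for i using meas[of "A i"] union by auto
        then show "A i \<in> sets lebesgue" for i by simp
        from Ai show "set_integrable lebesgue (\<Union> (range A)) G" by (intro int) auto
        show "A i \<inter> A j = {}" if "i \<noteq> j" for i j
          using union(1) that by (auto simp: disjoint_family_on_def)
      qed
      then show ?case using union by simp
    qed
  qed
  have "AE x in lebesgue. s * G x \<le> 0" if "s = 1 \<or> s = -1" for s
  proof -
    have "G \<in> borel_measurable lebesgue" using G by auto
    then have "{x \<in> space lebesgue. s * G x > 0} \<in> sets lebesgue" by measurable
    then have "{x. s * G x > 0} \<in> sets lebesgue" by simp
    then obtain A N N' where A: "{x. s * G x > 0} = A \<union> N" "N \<subseteq> N'" "N' \<in> null_sets lborel" "A \<in> sets lborel"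
      by (rule sets_completionE)
    let ?h = "\<lambda>x. s * (indicator A x *\<^sub>R G x)"
    have "integrable lebesgue ?h"
      using int[of A] A(4) unfolding set_integrable_def by (intro integrable_mult_right) simp
    moreover have "integral\<^sup>L lebesgue ?h = 0"
      using *[of A] A(4) by (simp add: set_lebesgue_integral_def)
    moreover have "0 \<le> ?h x" for x
    proof -
      have "0 < s * G x" if "x \<in> A" using A(1) that by blast
      then show ?thesis by (auto simp: indicator_def)
    qed
    ultimately have "AE x in lebesgue. ?h x = 0"
      by (subst (asm) integral_nonneg_eq_0_iff_AE) auto
    moreover have "AE x in lebesgue. x \<notin> N'"
      by (intro AE_completion AE_not_in A)
    ultimately show ?thesis
    proof eventually_elim
      case (elim x)
      have "\<not> 0 < s * G x"
      proof
        assume "0 < s * G x"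
        moreover from this have "x \<in> A" using A(1,2) elim(2) by blast
        ultimately show False using elim(1) by auto
      qed
      then show ?case by simp
    qed
  qed
  from this[of 1] this[of "-1"] show ?thesis by auto
qed

text \<open>Testing with the bumps and passing to the limit shows that the integral of \<open>g\<close> over every box whose
  closure lies in \<open>\<Omega>\<close> is zero; countably many such boxes cover \<open>\<Omega>\<close>.\<close>

lemma fundamental_lemma_variations:
  fixes g :: "'a::euclidean_space \<Rightarrow> real"
  assumes \<Omega>: "open \<Omega>" and g: "locally_integrable_on g \<Omega>"
    and 0: "\<And>\<phi>. \<phi> \<in> test_functions \<Omega> \<Longrightarrow> (LINT x|lebesgue_on \<Omega>. g x * \<phi> x) = 0"
  shows "AE x in lebesgue_on \<Omega>. g x = 0"
proof -
  have sets: "\<Omega> \<in> sets lebesgue" using \<Omega> by simp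
  have abs: "integrable lebesgue (\<lambda>x. indicator (cbox a b) x * g x)" if "cbox a b \<subseteq> \<Omega>" for a b
    using g that unfolding locally_integrable_on_def set_integrable_def by auto
  have box0: "(LINT x|lebesgue. indicator (box a b) x * g x) = 0" if sub: "cbox a b \<subseteq> \<Omega>" for a b
  proof -
    have *: "(LINT x|lebesgue. box_bump a b k x * g x) = 0" for k
    proof -
      have out: "box_bump a b k x = 0" if "x \<notin> cbox a b" for x
        using that box_bump_eq_0[of x a b k] box_subset_cbox[of a b] by blast
      have "box_bump a b k \<in> test_functions \<Omega>"
        using sub out
        by (intro test_functionsI[where K="cbox a b"] smooth_on_box_bump) auto
      from 0[OF this] have "(LINT x|lebesgue_on \<Omega>. box_bump a b k x * g x) = 0"
        by (simp add: mult.commute)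
      then show ?thesis
        using sub out by (subst (asm) integral_lebesgue_on_support[OF sets]) auto
    qed
    have "(\<lambda>k. LINT x|lebesgue. box_bump a b k x * g x) \<longlonglongrightarrow> (LINT x|lebesgue. indicator (box a b) x * g x)"
    proof (rule integral_dominated_convergence)
      have eq: "box_bump a b k x * g x = box_bump a b k x * (indicator (cbox a b) x * g x)"
        "indicator (box a b) x * g x = indicator (box a b) x * (indicator (cbox a b) x * g x)" for k x
        using box_bump_eq_0[of x a b k] box_subset_cbox[of a b] by (auto simp: indicator_def)
      have m: "(\<lambda>x. indicator (cbox a b) x * g x) \<in> borel_measurable lebesgue"
        using abs[OF sub] by auto
      have bm: "box_bump a b k \<in> borel_measurable lebesgue" for k
        using borel_measurable_continuous_onI[OF smooth_on_continuous[OF smooth_on_box_bump]]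
        by (intro measurable_completion) simp
      show "(\<lambda>x. box_bump a b k x * g x) \<in> borel_measurable lebesgue" for k
        unfolding eq(1) by (rule borel_measurable_times[OF bm m])
      show "(\<lambda>x. indicator (box a b) x * g x) \<in> borel_measurable lebesgue"
        unfolding eq(2) by (rule borel_measurable_times[OF borel_measurable_indicator m]) simp
      show "integrable lebesgue (\<lambda>x. \<bar>indicator (cbox a b) x * g x\<bar>)"
        using abs[OF sub] by (rule integrable_abs)
      show "AE x in lebesgue. (\<lambda>k. box_bump a b k x * g x) \<longlonglongrightarrow> indicator (box a b) x * g x"
        by (intro AE_I2 tendsto_mult box_bump_tendsto tendsto_const)
      show "AE x in lebesgue. norm (box_bump a b k x * g x) \<le> \<bar>indicator (cbox a b) x * g x\<bar>" for k
        unfolding eq(1)[of k] using box_bump_bounds[of a b k]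
        by (intro AE_I2) (auto simp: abs_mult intro!: mult_left_le_one_le)
    qed
    then show ?thesis using * by (simp add: LIMSEQ_const_iff)
  qed
  have on_box: "AE x in lebesgue. x \<in> box c d \<longrightarrow> g x = 0" if sub: "cbox c d \<subseteq> \<Omega>" for c d
  proof -
    define h where "h x = indicator (box c d) x * (indicator (cbox c d) x * g x)" for x
    have h: "integrable lebesgue h"
      unfolding h_def using integrable_mult_indicator[OF _ abs[OF sub], of "box c d"] by simp
    have "AE x in lebesgue. h x = 0"
    proof (rule box_integrals_eq_0_imp_AE_0[OF h])
      show "h x = 0" if "x \<notin> box c d" for x using that by (simp add: h_def)
      fix a b
      obtain a' b' where ab: "box a b \<inter> box c d = box a' b'" by (rule that[OF box_Int_box])
      have "(LINT x:box a b|lebesgue. h x) = (LINT x|lebesgue. indicator (box a' b') x * g x)"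
        unfolding set_lebesgue_integral_def using box_subset_cbox[of c d]
        by (intro Bochner_Integration.integral_cong) (auto simp: ab[symmetric] h_def indicator_def)
      also have "\<dots> = 0"
      proof (cases "box a' b' = {}")
        case False
        have "closure (box a' b') \<subseteq> cbox c d"
          by (intro closure_minimal closed_cbox) (use ab box_subset_cbox[of c d] in blast)
        then have "cbox a' b' \<subseteq> cbox c d" using closure_box[OF False] by simp
        then show ?thesis using box0 sub by auto
      qed simp
      finally show "(LINT x:box a b|lebesgue. h x) = 0" .
    qed
    then show ?thesis
      by eventually_elim
        (auto simp: h_def indicator_def split: if_splits dest: subsetD[OF box_subset_cbox])
  qed
  obtain \<D> where \<D>: "countable \<D>" "\<D> \<subseteq> Pow \<Omega>" "\<And>X. X \<in> \<D> \<Longrightarrow> \<exists>a b. X = cbox a b" "\<Union>\<D> = \<Omega>"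
    using open_countable_Union_open_cbox[OF \<Omega>] by blast
  have "AE x in lebesgue. \<forall>X\<in>\<D>. x \<in> X \<longrightarrow> g x = 0"
  proof (subst AE_ball_countable[OF \<D>(1)], intro ballI)
    fix X assume X: "X \<in> \<D>"
    then obtain a b where ab: "X = cbox a b" "cbox a b \<subseteq> \<Omega>" using \<D> by blast
    have "cbox a b - box a b \<in> null_sets lebesgue"
      using negligible_frontier_interval[of a b] negligible_iff_null_sets by blast
    then have "AE x in lebesgue. x \<notin> cbox a b - box a b"
      by (rule AE_not_in)
    with on_box[OF ab(2)] show "AE x in lebesgue. x \<in> X \<longrightarrow> g x = 0"
      unfolding ab by eventually_elim auto
  qed
  then have "AE x in lebesgue. x \<in> \<Omega> \<longrightarrow> g x = 0"
    using \<D>(4) by (auto elim!: eventually_mono)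
  then show ?thesis by (simp add: AE_lebesgue_on_iff[OF sets])
qed

lemma is_weak_gradient_integrable:
  assumes \<Omega>: "open \<Omega>" and g: "is_weak_gradient \<Omega> u g" and \<phi>: "\<phi> \<in> test_functions \<Omega>"
  shows "integrable (lebesgue_on \<Omega>) (\<lambda>x. u x * (grad \<phi> x \<bullet> i))"
    and "integrable (lebesgue_on \<Omega>) (\<lambda>x. (g x \<bullet> i) * \<phi> x)"
proof -
  obtain K where K: "compact K" "K \<subseteq> \<Omega>" "\<And>x. x \<notin> K \<Longrightarrow> \<phi> x = 0"
    "\<And>x. x \<notin> K \<Longrightarrow> grad \<phi> x = 0" "smooth_on UNIV \<phi>"
    using test_functionsE[OF \<phi>] by blast
  have "integrable (lebesgue_on \<Omega>) (\<lambda>x. (grad \<phi> x \<bullet> i) *\<^sub>R u x)"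
    using g K by (intro locally_integrable_times_compact_support[OF \<Omega> _ K(1,2)])
      (auto simp: is_weak_gradient_def intro!: continuous_intros smooth_on_grad_continuous)
  then show "integrable (lebesgue_on \<Omega>) (\<lambda>x. u x * (grad \<phi> x \<bullet> i))"
    by (simp add: mult.commute)
  have "integrable (lebesgue_on \<Omega>) (\<lambda>x. \<phi> x *\<^sub>R g x)"
    using g K by (intro locally_integrable_times_compact_support[OF \<Omega> _ K(1,2)])
      (auto simp: is_weak_gradient_def intro!: smooth_on_continuous)
  then have "integrable (lebesgue_on \<Omega>) (\<lambda>x. (\<phi> x *\<^sub>R g x) \<bullet> i)"
    by (rule integrable_inner_left)
  then show "integrable (lebesgue_on \<Omega>) (\<lambda>x. (g x \<bullet> i) * \<phi> x)"
    by (simp add: mult.commute)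
qed

lemma is_weak_gradient_eq:
  assumes "is_weak_gradient \<Omega> u g" "\<phi> \<in> test_functions \<Omega>" "i \<in> Basis"
  shows "(LINT x|lebesgue_on \<Omega>. u x * (grad \<phi> x \<bullet> i)) = - (LINT x|lebesgue_on \<Omega>. (g x \<bullet> i) * \<phi> x)"
  using assms by (simp add: is_weak_gradient_def grad_inner_Basis)

lemma is_weak_gradient_add_scaled:
  assumes \<Omega>: "open \<Omega>" and g: "is_weak_gradient \<Omega> u g" and h: "is_weak_gradient \<Omega> v h"
  shows "is_weak_gradient \<Omega> (\<lambda>x. a * u x + b * v x) (\<lambda>x. a *\<^sub>R g x + b *\<^sub>R h x)"
  unfolding is_weak_gradient_def
proof (intro conjI ballI)
  show "locally_integrable_on (\<lambda>x. a * u x + b * v x) \<Omega>"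
    using locally_integrable_scaleR_add[of u \<Omega> v a b] g h by (simp add: is_weak_gradient_def)
  show "locally_integrable_on (\<lambda>x. a *\<^sub>R g x + b *\<^sub>R h x) \<Omega>"
    using locally_integrable_scaleR_add[of g \<Omega> h a b] g h by (simp add: is_weak_gradient_def)
  fix \<phi> i assume \<phi>: "\<phi> \<in> test_functions \<Omega>" and i: "i \<in> (Basis :: 'a set)"
  note int = is_weak_gradient_integrable[OF \<Omega> g \<phi>, of i] is_weak_gradient_integrable[OF \<Omega> h \<phi>, of i]
  have "(LINT x|lebesgue_on \<Omega>. (a * u x + b * v x) * (grad \<phi> x \<bullet> i)) =
      (LINT x|lebesgue_on \<Omega>. a * (u x * (grad \<phi> x \<bullet> i)) + b * (v x * (grad \<phi> x \<bullet> i)))"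
    by (simp add: algebra_simps)
  also have "\<dots> = a * (LINT x|lebesgue_on \<Omega>. u x * (grad \<phi> x \<bullet> i)) + b * (LINT x|lebesgue_on \<Omega>. v x * (grad \<phi> x \<bullet> i))"
    using int by (subst Bochner_Integration.integral_add) auto
  also have "\<dots> = - (a * (LINT x|lebesgue_on \<Omega>. (g x \<bullet> i) * \<phi> x) + b * (LINT x|lebesgue_on \<Omega>. (h x \<bullet> i) * \<phi> x))"
    by (simp add: is_weak_gradient_eq[OF g \<phi> i] is_weak_gradient_eq[OF h \<phi> i])
  also have "a * (LINT x|lebesgue_on \<Omega>. (g x \<bullet> i) * \<phi> x) + b * (LINT x|lebesgue_on \<Omega>. (h x \<bullet> i) * \<phi> x) =
      (LINT x|lebesgue_on \<Omega>. a * ((g x \<bullet> i) * \<phi> x) + b * ((h x \<bullet> i) * \<phi> x))"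
    using int by (subst Bochner_Integration.integral_add) auto
  also have "\<dots> = (LINT x|lebesgue_on \<Omega>. ((a *\<^sub>R g x + b *\<^sub>R h x) \<bullet> i) * \<phi> x)"
    by (simp add: inner_add_left algebra_simps)
  finally show "(LINT x|lebesgue_on \<Omega>. (a * u x + b * v x) * frechet_derivative \<phi> (at x) i) =
      - (LINT x|lebesgue_on \<Omega>. ((a *\<^sub>R g x + b *\<^sub>R h x) \<bullet> i) * \<phi> x)"
    using i by (simp add: grad_inner_Basis)
qed

lemma is_weak_gradient_unique:
  assumes \<Omega>: "open \<Omega>" and g: "is_weak_gradient \<Omega> u g" and h: "is_weak_gradient \<Omega> u h"
  shows "AE x in lebesgue_on \<Omega>. g x = h x"
proof -
  have "AE x in lebesgue_on \<Omega>. (g x - h x) \<bullet> i = 0" if i: "i \<in> Basis" for i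
  proof (rule fundamental_lemma_variations[OF \<Omega>])
    have *: "is_weak_gradient \<Omega> (\<lambda>x. 1 * u x + (-1) * u x) (\<lambda>x. 1 *\<^sub>R g x + (-1) *\<^sub>R h x)"
      by (rule is_weak_gradient_add_scaled[OF \<Omega> g h])
    then have gh: "is_weak_gradient \<Omega> (\<lambda>x. 0) (\<lambda>x. g x - h x)" by simp
    then have "locally_integrable_on (\<lambda>x. g x - h x) \<Omega>" by (simp add: is_weak_gradient_def)
    then show "locally_integrable_on (\<lambda>x. (g x - h x) \<bullet> i) \<Omega>"
      unfolding locally_integrable_on_def
      by (auto intro!: absolutely_integrable_component)
    fix \<phi> assume "\<phi> \<in> test_functions \<Omega>"
    from is_weak_gradient_eq[OF gh this i]
    show "(LINT x|lebesgue_on \<Omega>. (g x - h x) \<bullet> i * \<phi> x) = 0" by simp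
  qed
  then have "AE x in lebesgue_on \<Omega>. \<forall>i\<in>Basis. (g x - h x) \<bullet> i = 0"
    by (intro AE_finite_allI) auto
  then show ?thesis
    by eventually_elim (auto simp: euclidean_all_zero_iff)
qed

lemma weak_grad_AE_eq:
  assumes "open \<Omega>" "is_weak_gradient \<Omega> u g"
  shows "AE x in lebesgue_on \<Omega>. weak_grad \<Omega> u x = g x"
  using is_weak_gradient_unique[OF assms(1) _ assms(2)] someI[of "is_weak_gradient \<Omega> u" g] assms(2)
  unfolding weak_grad_def by blast

lemma is_weak_gradient_cong_AE:
  assumes \<Omega>: "open \<Omega>" and uv: "AE x in lebesgue_on \<Omega>. v x = u x" and g: "is_weak_gradient \<Omega> u g"
  shows "is_weak_gradient \<Omega> v g"
  unfolding is_weak_gradient_def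
proof (intro conjI ballI)
  have sets: "\<Omega> \<in> sets lebesgue" using \<Omega> by simp
  obtain N where N: "negligible N" and sub: "{x. \<not> (x \<in> \<Omega> \<longrightarrow> v x = u x)} \<subseteq> N"
    using uv[unfolded AE_lebesgue_on_iff[OF sets] eventually_ae_filter_negligible] by (elim exE conjE)
  have vu: "v x = u x" if x: "x \<in> \<Omega> - N" for x
  proof (rule ccontr)
    assume "v x \<noteq> u x"
    with x have "x \<in> {x. \<not> (x \<in> \<Omega> \<longrightarrow> v x = u x)}" by simp
    with sub x show False by (meson DiffD2 subsetD)
  qed
  show v: "locally_integrable_on v \<Omega>"
    unfolding locally_integrable_on_def
  proof (intro allI impI)
    fix K assume K: "compact K \<and> K \<subseteq> \<Omega>"
    with g have "u absolutely_integrable_on K"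
      by (simp add: is_weak_gradient_def locally_integrable_on_def)
    then show "v absolutely_integrable_on K"
      by (rule absolutely_integrable_spike[OF _ N]) (use vu K in blast)
  qed
  show "locally_integrable_on g \<Omega>" using g by (simp add: is_weak_gradient_def)
  fix \<phi> i assume \<phi>: "\<phi> \<in> test_functions \<Omega>" and i: "i \<in> (Basis :: 'a set)"
  obtain K where K: "compact K" "K \<subseteq> \<Omega>" "\<And>x. x \<notin> K \<Longrightarrow> \<phi> x = 0"
    "\<And>x. x \<notin> K \<Longrightarrow> grad \<phi> x = 0" "smooth_on UNIV \<phi>"
    using test_functionsE[OF \<phi>] by blast
  have "integrable (lebesgue_on \<Omega>) (\<lambda>x. (grad \<phi> x \<bullet> i) *\<^sub>R v x)"
    using v K by (intro locally_integrable_times_compact_support[OF \<Omega> v K(1,2)])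
      (auto intro!: continuous_intros smooth_on_grad_continuous)
  then have "(LINT x|lebesgue_on \<Omega>. v x * (grad \<phi> x \<bullet> i)) = (LINT x|lebesgue_on \<Omega>. u x * (grad \<phi> x \<bullet> i))"
    using is_weak_gradient_integrable(1)[OF \<Omega> g \<phi>, of i] uv
    by (intro integral_cong_AE) (auto simp: mult.commute)
  then show "(LINT x|lebesgue_on \<Omega>. v x * frechet_derivative \<phi> (at x) i) = - (LINT x|lebesgue_on \<Omega>. g x \<bullet> i * \<phi> x)"
    using is_weak_gradient_eq[OF g \<phi> i] i by (simp add: grad_inner_Basis)
qed

lemma weak_grad_cong_AE:
  assumes "open \<Omega>" and uv: "AE x in lebesgue_on \<Omega>. v x = u x"
  shows "weak_grad \<Omega> v = weak_grad \<Omega> u"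
proof -
  have "AE x in lebesgue_on \<Omega>. u x = v x" using uv by eventually_elim simp
  then have "is_weak_gradient \<Omega> v = is_weak_gradient \<Omega> u"
    using is_weak_gradient_cong_AE[OF assms(1)] uv by blast
  then show ?thesis by (simp add: weak_grad_def)
qed

section \<open>Integrals of powers and convexity\<close>

abbreviation powr_integral ::
    "'a::euclidean_space set \<Rightarrow> real \<Rightarrow> ('a \<Rightarrow> 'b::real_normed_vector) \<Rightarrow> real" where
  "powr_integral S p f \<equiv> LINT x|lebesgue_on S. norm (f x) powr p"

lemma powr_convex_combination:
  fixes x y :: real
  assumes p: "1 \<le> p" and xy: "0 \<le> x" "0 \<le> y" and t: "0 < t" "t < 1"
  shows "((1 - t) * x + t * y) powr p \<le> (1 - t) * x powr p + t * y powr p"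
proof -
  have scaled: "(s * z) powr p \<le> s * z powr p" if "0 < s" "s < 1" for s z :: real
  proof -
    have "s powr p \<le> s powr 1" using that p by (intro powr_mono') auto
    then show ?thesis using that by (simp add: powr_mult mult_right_mono)
  qed
  consider "x = 0" | "y = 0" | "x > 0" "y > 0" using xy by linarith
  then show ?thesis
  proof cases
    case 3
    then show ?thesis
      using convex_onD[OF powr_convex[OF p], of t x y] t by simp
  qed (use scaled[of t y] scaled[of "1 - t" x] t p in auto)
qed

text \<open>This is convexity of \<open>t\<^sup>p\<close> at the points \<open>x / (1 - t)\<close> and \<open>y / t\<close>. With \<open>t\<close> small it says that a
  perturbation \<open>y\<close> changes \<open>x\<^sup>p\<close> by a factor close to one plus a multiple of \<open>y\<^sup>p\<close>; with the optimal
  \<open>t = y / (x + y)\<close> it is an equality.\<close>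

lemma powr_add_le:
  fixes x y :: real
  assumes p: "1 \<le> p" and xy: "0 \<le> x" "0 \<le> y" and t: "0 < t" "t < 1"
  shows "(x + y) powr p \<le> (1 - t) powr (1 - p) * x powr p + t powr (1 - p) * y powr p"
proof -
  have *: "s * (z / s) powr p = s powr (1 - p) * z powr p" if "0 < s" for s z :: real
    using that by (simp add: powr_divide powr_diff)
  have "(x + y) powr p = ((1 - t) * (x / (1 - t)) + t * (y / t)) powr p"
    using t by simp
  also have "\<dots> \<le> (1 - t) * (x / (1 - t)) powr p + t * (y / t) powr p"
    using t xy by (intro powr_convex_combination p) auto
  finally show ?thesis using t by (simp add: *)
qed

lemma norm_powr_add_le:
  fixes f g :: "'b::real_normed_vector"
  assumes "1 \<le> p" "0 < t" "t < 1"
  shows "norm (f + g) powr p \<le> (1 - t) powr (1 - p) * norm f powr p + t powr (1 - p) * norm g powr p"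
  using powr_add_le[of p "norm f" "norm g" t] assms norm_triangle_ineq[of f g]
    powr_mono2[of p "norm (f + g)" "norm f + norm g"] by auto

lemma borel_measurable_lebesgue_on_cong_AE:
  fixes f g :: "'a::euclidean_space \<Rightarrow> 'b::euclidean_space"
  assumes S: "S \<in> sets lebesgue" and fg: "AE x in lebesgue_on S. f x = g x"
  shows "f \<in> borel_measurable (lebesgue_on S) \<longleftrightarrow> g \<in> borel_measurable (lebesgue_on S)"
proof -
  have 1: "AE x in lebesgue. (if x \<in> S then f x else 0) = (if x \<in> S then g x else 0)"
    using fg unfolding AE_lebesgue_on_iff[OF S] by eventually_elim auto
  then have 2: "AE x in lebesgue. (if x \<in> S then g x else 0) = (if x \<in> S then f x else 0)"
    by eventually_elim auto
  have "(\<lambda>x. if x \<in> S then f x else 0) \<in> borel_measurable lebesgue \<longleftrightarrow>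
      (\<lambda>x. if x \<in> S then g x else 0) \<in> borel_measurable lebesgue"
    by (intro iffI) (erule borel_measurable_AE[OF _ 1], erule borel_measurable_AE[OF _ 2])
  then show ?thesis using S by (simp add: borel_measurable_if)
qed

text \<open>Lebesgue measure is complete, so measurability of one side implies that of the other, and if both
  fail to be measurable then both integrals are zero by convention.\<close>

lemma integral_lebesgue_on_cong_AE:
  fixes f g :: "'a::euclidean_space \<Rightarrow> real"
  assumes S: "S \<in> sets lebesgue" and fg: "AE x in lebesgue_on S. f x = g x"
  shows "integral\<^sup>L (lebesgue_on S) f = integral\<^sup>L (lebesgue_on S) g"
proof (cases "f \<in> borel_measurable (lebesgue_on S)")
  case True
  then show ?thesis
    using borel_measurable_lebesgue_on_cong_AE[OF assms] fg by (intro integral_cong_AE) auto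
next
  case False
  then have "\<not> integrable (lebesgue_on S) f" "\<not> integrable (lebesgue_on S) g"
    using borel_measurable_lebesgue_on_cong_AE[OF assms] by auto
  then show ?thesis by (simp add: not_integrable_integral_eq)
qed

lemma Lp_function_cong_AE:
  assumes S: "S \<in> sets lebesgue" and fg: "AE x in lebesgue_on S. g x = f x"
    and f: "Lp_function S p f"
  shows "Lp_function S p g"
  unfolding Lp_function_def
proof
  show g: "g \<in> borel_measurable (lebesgue_on S)"
    using borel_measurable_lebesgue_on_cong_AE[OF S fg] f by (simp add: Lp_function_def)
  show "integrable (lebesgue_on S) (\<lambda>x. norm (g x) powr p)"
  proof (rule integrable_cong_AE_imp)
    show "integrable (lebesgue_on S) (\<lambda>x. norm (f x) powr p)"
      using f by (simp add: Lp_function_def)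
    show "(\<lambda>x. norm (g x) powr p) \<in> borel_measurable (lebesgue_on S)"
      using g by measurable
    show "AE x in lebesgue_on S. norm (f x) powr p = norm (g x) powr p"
      using fg by eventually_elim simp
  qed
qed

lemma Lp_function_scaleR:
  assumes "Lp_function S p f"
  shows "Lp_function S p (\<lambda>x. a *\<^sub>R f x)"
  using assms by (auto simp: Lp_function_def powr_mult)

lemma Lp_function_add:
  assumes p: "1 \<le> p" and f: "Lp_function S p f" and g: "Lp_function S p g"
  shows "Lp_function S p (\<lambda>x. f x + g x)"
  unfolding Lp_function_def
proof
  show m: "(\<lambda>x. f x + g x) \<in> borel_measurable (lebesgue_on S)"
    using f g by (auto simp: Lp_function_def)
  let ?h = "\<lambda>x. (1/2) powr (1 - p) * norm (f x) powr p + (1/2) powr (1 - p) * norm (g x) powr p"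
  have "integrable (lebesgue_on S) ?h"
    using f g by (auto simp: Lp_function_def)
  then show "integrable (lebesgue_on S) (\<lambda>x. norm (f x + g x) powr p)"
  proof (rule Bochner_Integration.integrable_bound)
    show "(\<lambda>x. norm (f x + g x) powr p) \<in> borel_measurable (lebesgue_on S)"
      using m by measurable
    show "AE x in lebesgue_on S. norm (norm (f x + g x) powr p) \<le> norm (?h x)"
      using norm_powr_add_le[OF p, of "1/2"] by auto
  qed
qed

lemma Lp_integral_add_le:
  assumes p: "1 \<le> p" and f: "Lp_function S p f" and g: "Lp_function S p g" and t: "0 < t" "t < 1"
  shows "(LINT x|lebesgue_on S. norm (f x + g x) powr p) \<le>
     (1 - t) powr (1 - p) * powr_integral S p f +
     t powr (1 - p) * powr_integral S p g"
proof -
  have int: "integrable (lebesgue_on S) (\<lambda>x. norm (f x) powr p)" "integrable (lebesgue_on S) (\<lambda>x. norm (g x) powr p)"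
    "integrable (lebesgue_on S) (\<lambda>x. norm (f x + g x) powr p)"
    using f g Lp_function_add[OF p f g] by (auto simp: Lp_function_def)
  then have "(LINT x|lebesgue_on S. norm (f x + g x) powr p) \<le>
     (LINT x|lebesgue_on S. (1 - t) powr (1 - p) * norm (f x) powr p + t powr (1 - p) * norm (g x) powr p)"
    by (intro integral_mono norm_powr_add_le p t) auto
  then show ?thesis using int by simp
qed

lemma Lp_function_compact_support:
  fixes f :: "'a::euclidean_space \<Rightarrow> 'b::euclidean_space"
  assumes S: "S \<in> sets lebesgue" and p: "0 < p"
    and f: "continuous_on UNIV f" and K: "compact K" "K \<subseteq> S" "\<And>x. x \<notin> K \<Longrightarrow> f x = 0"
  shows "Lp_function S p f"
  unfolding Lp_function_def
proof
  show "f \<in> borel_measurable (lebesgue_on S)"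
    using S f by (intro continuous_imp_measurable_on_sets_lebesgue) (auto intro: continuous_on_subset)
  have "continuous_on UNIV (\<lambda>x. norm (f x) powr p)"
    using p f by (intro continuous_on_powr' continuous_intros) auto
  then have "integrable lebesgue (\<lambda>x. norm (f x) powr p)"
    by (rule compact_support_integrable_lebesgue[OF _ K(1)]) (use K p in auto)
  then show "integrable (lebesgue_on S) (\<lambda>x. norm (f x) powr p)"
    using K p by (subst integrable_lebesgue_on_support[OF S]) auto
qed

section \<open>The metric on the Sobolev space\<close>

lemma W1p_function_weak_grad:
  assumes \<Omega>: "open \<Omega>" and u: "W1p_function \<Omega> p u"
  shows "is_weak_gradient \<Omega> u (weak_grad \<Omega> u)" "Lp_function \<Omega> p (weak_grad \<Omega> u)"
proof -
  obtain g where g: "is_weak_gradient \<Omega> u g" "Lp_function \<Omega> p g"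
    using u by (auto simp: W1p_function_def)
  show "is_weak_gradient \<Omega> u (weak_grad \<Omega> u)"
    unfolding weak_grad_def by (rule someI[of _ g]) (rule g)
  show "Lp_function \<Omega> p (weak_grad \<Omega> u)"
    using Lp_function_cong_AE[OF _ weak_grad_AE_eq[OF \<Omega> g(1)] g(2)] \<Omega> by simp
qed

lemma W1p_function_cong_AE:
  assumes \<Omega>: "open \<Omega>" and uv: "AE x in lebesgue_on \<Omega>. v x = u x" and u: "W1p_function \<Omega> p u"
  shows "W1p_function \<Omega> p v"
  using u is_weak_gradient_cong_AE[OF \<Omega> uv] Lp_function_cong_AE[OF _ uv, of p] \<Omega>
  by (auto simp: W1p_function_def)

lemma W1p_norm_cong_AE:
  assumes \<Omega>: "open \<Omega>" and uv: "AE x in lebesgue_on \<Omega>. v x = u x"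
  shows "W1p_norm \<Omega> p v = W1p_norm \<Omega> p u"
proof -
  have "(LINT x|lebesgue_on \<Omega>. \<bar>v x\<bar> powr p) = (LINT x|lebesgue_on \<Omega>. \<bar>u x\<bar> powr p)"
    using \<Omega> uv by (intro integral_lebesgue_on_cong_AE) auto
  then show ?thesis by (simp add: W1p_norm_def weak_grad_cong_AE[OF assms])
qed

lemma W1p_function_scale:
  assumes \<Omega>: "open \<Omega>" and u: "W1p_function \<Omega> p u"
  shows "W1p_function \<Omega> p (\<lambda>x. a * u x)"
proof -
  note g = W1p_function_weak_grad[OF \<Omega> u]
  have "is_weak_gradient \<Omega> (\<lambda>x. a * u x) (\<lambda>x. a *\<^sub>R weak_grad \<Omega> u x)"
    using is_weak_gradient_add_scaled[OF \<Omega> g(1) g(1), of a 0] by simp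
  moreover have "Lp_function \<Omega> p (\<lambda>x. a * u x)"
    using Lp_function_scaleR[of \<Omega> p u a] u by (simp add: W1p_function_def)
  ultimately show ?thesis using Lp_function_scaleR[OF g(2)] by (auto simp: W1p_function_def)
qed

lemma W1p_function_add:
  assumes \<Omega>: "open \<Omega>" and p: "1 \<le> p" and u: "W1p_function \<Omega> p u" and v: "W1p_function \<Omega> p v"
  shows "W1p_function \<Omega> p (\<lambda>x. u x + v x)"
    and "AE x in lebesgue_on \<Omega>. weak_grad \<Omega> (\<lambda>x. u x + v x) x = weak_grad \<Omega> u x + weak_grad \<Omega> v x"
proof -
  note g = W1p_function_weak_grad[OF \<Omega> u] W1p_function_weak_grad[OF \<Omega> v]
  have *: "is_weak_gradient \<Omega> (\<lambda>x. u x + v x) (\<lambda>x. weak_grad \<Omega> u x + weak_grad \<Omega> v x)"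
    using is_weak_gradient_add_scaled[OF \<Omega> g(1) g(3), of 1 1] by simp
  then show "AE x in lebesgue_on \<Omega>. weak_grad \<Omega> (\<lambda>x. u x + v x) x = weak_grad \<Omega> u x + weak_grad \<Omega> v x"
    by (rule weak_grad_AE_eq[OF \<Omega>])
  show "W1p_function \<Omega> p (\<lambda>x. u x + v x)"
  proof -
    have "Lp_function \<Omega> p (\<lambda>x. u x + v x)"
      using u v by (intro Lp_function_add[OF p]) (auto simp: W1p_function_def)
    then show ?thesis
      unfolding W1p_function_def using * Lp_function_add[OF p g(2,4)] by blast
  qed
qed

lemma W1p_function_diff:
  assumes "open \<Omega>" "1 \<le> p" "W1p_function \<Omega> p u" "W1p_function \<Omega> p v"
  shows "W1p_function \<Omega> p (\<lambda>x. u x - v x)"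
  using W1p_function_add(1)[OF assms(1-3) W1p_function_scale[OF assms(1,4), of "-1"]] by simp

lemma W1p_norm_powr:
  assumes "0 < p"
  shows "W1p_norm \<Omega> p u powr p =
    (LINT x|lebesgue_on \<Omega>. \<bar>u x\<bar> powr p) + powr_integral \<Omega> p (weak_grad \<Omega> u)"
  unfolding W1p_norm_def using assms by (simp add: powr_powr add_nonneg_nonneg)

lemma W1p_norm_nonneg: "0 \<le> W1p_norm \<Omega> p u"
  by (simp add: W1p_norm_def)

lemma W1p_norm_add_powr_le:
  assumes \<Omega>: "open \<Omega>" and p: "1 \<le> p" and u: "W1p_function \<Omega> p u" and v: "W1p_function \<Omega> p v"
    and t: "0 < t" "t < 1"
  shows "W1p_norm \<Omega> p (\<lambda>x. u x + v x) powr p \<le>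
    (1 - t) powr (1 - p) * W1p_norm \<Omega> p u powr p + t powr (1 - p) * W1p_norm \<Omega> p v powr p"
proof -
  note g = W1p_function_weak_grad[OF \<Omega> u] W1p_function_weak_grad[OF \<Omega> v]
  have p0: "0 < p" using p by simp
  have 1: "(LINT x|lebesgue_on \<Omega>. \<bar>u x + v x\<bar> powr p) \<le>
     (1 - t) powr (1 - p) * (LINT x|lebesgue_on \<Omega>. \<bar>u x\<bar> powr p) +
     t powr (1 - p) * (LINT x|lebesgue_on \<Omega>. \<bar>v x\<bar> powr p)"
    using Lp_integral_add_le[OF p _ _ t, of \<Omega> u v] u v by (simp add: W1p_function_def)
  have "powr_integral \<Omega> p (weak_grad \<Omega> (\<lambda>x. u x + v x)) =
     (LINT x|lebesgue_on \<Omega>. norm (weak_grad \<Omega> u x + weak_grad \<Omega> v x) powr p)"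
    using \<Omega> W1p_function_add(2)[OF \<Omega> p u v] by (intro integral_lebesgue_on_cong_AE) auto
  also have "\<dots> \<le> (1 - t) powr (1 - p) * powr_integral \<Omega> p (weak_grad \<Omega> u) +
     t powr (1 - p) * powr_integral \<Omega> p (weak_grad \<Omega> v)"
    by (rule Lp_integral_add_le[OF p g(2,4) t])
  finally show ?thesis using 1 by (simp add: W1p_norm_powr[OF p0] algebra_simps)
qed

text \<open>Minkowski's inequality is the previous estimate with the weight \<open>t = b / (a + b)\<close>, where \<open>a\<close> and
  \<open>b\<close> are the norms of the two summands. Enlarging both by \<open>e / 2\<close> keeps \<open>t\<close> strictly between \<open>0\<close> and
  \<open>1\<close> even if a norm vanishes.\<close>

lemma W1p_norm_triangle:
  assumes \<Omega>: "open \<Omega>" and p: "1 \<le> p" and u: "W1p_function \<Omega> p u" and v: "W1p_function \<Omega> p v"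
  shows "W1p_norm \<Omega> p (\<lambda>x. u x + v x) \<le> W1p_norm \<Omega> p u + W1p_norm \<Omega> p v"
proof (rule field_le_epsilon)
  fix e :: real assume e: "0 < e"
  define a where "a = W1p_norm \<Omega> p u + e / 2"
  define b where "b = W1p_norm \<Omega> p v + e / 2"
  define t where "t = b / (a + b)"
  have ab: "0 < a" "0 < b" using e W1p_norm_nonneg[of \<Omega> p] by (auto simp: a_def b_def add_nonneg_pos)
  then have t: "0 < t" "t < 1" "1 - t = a / (a + b)" by (auto simp: t_def field_simps)
  have pow: "(c / s) powr (1 - p) * c powr p = c * s powr (p - 1)" if "0 < c" "0 < s" for c s :: real
    using that by (simp add: powr_divide powr_diff)
  have "W1p_norm \<Omega> p (\<lambda>x. u x + v x) powr p \<le>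
      (1 - t) powr (1 - p) * W1p_norm \<Omega> p u powr p + t powr (1 - p) * W1p_norm \<Omega> p v powr p"
    by (rule W1p_norm_add_powr_le[OF \<Omega> p u v t(1,2)])
  also have "\<dots> \<le> (1 - t) powr (1 - p) * a powr p + t powr (1 - p) * b powr p"
    using e p W1p_norm_nonneg[of \<Omega> p]
    by (intro add_mono mult_left_mono powr_mono2) (auto simp: a_def b_def)
  also have "\<dots> = a * (a + b) powr (p - 1) + b * (a + b) powr (p - 1)"
    using ab by (simp add: t(3) pow) (simp add: t_def pow)
  also have "\<dots> = (a + b) powr p"
  proof -
    have "(a + b) * (a + b) powr (p - 1) = (a + b) powr p" using ab by (simp add: powr_diff)
    then show ?thesis by (simp only: distrib_right[symmetric])
  qed
  finally have "W1p_norm \<Omega> p (\<lambda>x. u x + v x) \<le> a + b"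
    using ab p powr_less_mono2[of p "a + b" "W1p_norm \<Omega> p (\<lambda>x. u x + v x)"] by force
  then show "W1p_norm \<Omega> p (\<lambda>x. u x + v x) \<le> W1p_norm \<Omega> p u + W1p_norm \<Omega> p v + e"
    by (simp add: a_def b_def)
qed

text \<open>Symmetry of the distance is required for arbitrary sets of functions, whose representatives need not
  have a weak gradient; in that case \<open>u\<close> and \<open>-u\<close> select the same default value.\<close>

lemma W1p_norm_uminus:
  assumes \<Omega>: "open \<Omega>"
  shows "W1p_norm \<Omega> p (\<lambda>x. - u x) = W1p_norm \<Omega> p u"
proof -
  have neg: "is_weak_gradient \<Omega> (\<lambda>x. - w x) (\<lambda>x. - g x)" if "is_weak_gradient \<Omega> w g" for w g
    using is_weak_gradient_add_scaled[OF \<Omega> that that, of "-1" 0] by simp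
  have "AE x in lebesgue_on \<Omega>. norm (weak_grad \<Omega> (\<lambda>x. - u x) x) = norm (weak_grad \<Omega> u x)"
  proof (cases "\<exists>g. is_weak_gradient \<Omega> u g")
    case True
    then have "is_weak_gradient \<Omega> u (weak_grad \<Omega> u)" unfolding weak_grad_def by (rule someI_ex)
    from weak_grad_AE_eq[OF \<Omega> neg[OF this]] show ?thesis by eventually_elim simp
  next
    case False
    then have "is_weak_gradient \<Omega> u = (\<lambda>g. False)" "is_weak_gradient \<Omega> (\<lambda>x. - u x) = (\<lambda>g. False)"
      using neg[of "\<lambda>x. - u x"] by auto
    then show ?thesis by (simp add: weak_grad_def)
  qed
  then have "powr_integral \<Omega> p (weak_grad \<Omega> (\<lambda>x. - u x)) =
      powr_integral \<Omega> p (weak_grad \<Omega> u)"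
    using \<Omega> by (intro integral_lebesgue_on_cong_AE) auto
  then show ?thesis by (simp add: W1p_norm_def)
qed

lemma is_weak_gradient_0: "is_weak_gradient \<Omega> (\<lambda>x. 0) (\<lambda>x. 0)"
  by (auto simp: is_weak_gradient_def locally_integrable_on_def set_integrable_def)

lemma W1p_norm_eq_0_iff:
  assumes \<Omega>: "open \<Omega>" and p: "1 \<le> p" and u: "W1p_function \<Omega> p u"
  shows "W1p_norm \<Omega> p u = 0 \<longleftrightarrow> (AE x in lebesgue_on \<Omega>. u x = 0)"
proof
  assume "W1p_norm \<Omega> p u = 0"
  then have sum: "(LINT x|lebesgue_on \<Omega>. \<bar>u x\<bar> powr p) + powr_integral \<Omega> p (weak_grad \<Omega> u) = 0"
    by (simp add: W1p_norm_def)
  have "0 \<le> (LINT x|lebesgue_on \<Omega>. \<bar>u x\<bar> powr p)" "0 \<le> powr_integral \<Omega> p (weak_grad \<Omega> u)"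
    by simp_all
  with sum have "(LINT x|lebesgue_on \<Omega>. \<bar>u x\<bar> powr p) = 0" by linarith
  then have "AE x in lebesgue_on \<Omega>. \<bar>u x\<bar> powr p = 0"
    using u by (subst (asm) integral_nonneg_eq_0_iff_AE) (auto simp: W1p_function_def Lp_function_def)
  then show "AE x in lebesgue_on \<Omega>. u x = 0" by eventually_elim simp
next
  assume u0: "AE x in lebesgue_on \<Omega>. u x = 0"
  have "W1p_norm \<Omega> p u = W1p_norm \<Omega> p (\<lambda>x. 0)"
    by (rule W1p_norm_cong_AE[OF \<Omega> u0])
  moreover have "powr_integral \<Omega> p (weak_grad \<Omega> (\<lambda>x. 0)) = (LINT x|lebesgue_on \<Omega>. 0)"
    using \<Omega> weak_grad_AE_eq[OF \<Omega> is_weak_gradient_0] by (intro integral_lebesgue_on_cong_AE) auto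
  ultimately show "W1p_norm \<Omega> p u = 0" by (simp add: W1p_norm_def)
qed

lemma W1p0_function_cong_AE:
  assumes \<Omega>: "open \<Omega>" and uv: "AE x in lebesgue_on \<Omega>. v x = u x" and u: "W1p0_function \<Omega> p u"
  shows "W1p0_function \<Omega> p v"
proof -
  have "W1p_norm \<Omega> p (\<lambda>x. v x - \<phi> x) = W1p_norm \<Omega> p (\<lambda>x. u x - \<phi> x)" for \<phi>
    using uv by (intro W1p_norm_cong_AE[OF \<Omega>]) auto
  then show ?thesis
    using u W1p_function_cong_AE[OF \<Omega> uv] by (simp add: W1p0_function_def)
qed

lemma rep_ae_class: "AE x in lebesgue_on \<Omega>. rep (ae_class \<Omega> u) x = u x"
proof -
  have "rep (ae_class \<Omega> u) \<in> ae_class \<Omega> u"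
    unfolding rep_def by (rule someI[of _ u]) (simp add: ae_class_def)
  then show ?thesis by (simp add: ae_class_def)
qed

lemma ae_class_eq_iff: "ae_class \<Omega> u = ae_class \<Omega> v \<longleftrightarrow> (AE x in lebesgue_on \<Omega>. u x = v x)"
proof
  assume "ae_class \<Omega> u = ae_class \<Omega> v"
  then have "u \<in> ae_class \<Omega> v" by (auto simp: ae_class_def)
  then show "AE x in lebesgue_on \<Omega>. u x = v x" by (simp add: ae_class_def)
next
  assume uv: "AE x in lebesgue_on \<Omega>. u x = v x"
  have "(AE x in lebesgue_on \<Omega>. w x = u x) \<longleftrightarrow> (AE x in lebesgue_on \<Omega>. w x = v x)" for w
    using uv by (auto elim: eventually_elim2)
  then show "ae_class \<Omega> u = ae_class \<Omega> v" by (simp add: ae_class_def)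
qed

lemma rep_W1p0:
  assumes "open \<Omega>" "U \<in> W1p0 \<Omega> p"
  shows "W1p0_function \<Omega> p (rep U)" "W1p_function \<Omega> p (rep U)" "U = ae_class \<Omega> (rep U)"
proof -
  obtain u where u: "W1p0_function \<Omega> p u" "U = ae_class \<Omega> u"
    using assms(2) by (auto simp: W1p0_def)
  show *: "W1p0_function \<Omega> p (rep U)"
    using W1p0_function_cong_AE[OF assms(1) _ u(1)] rep_ae_class u(2) by blast
  then show "W1p_function \<Omega> p (rep U)" by (simp add: W1p0_function_def)
  have "AE x in lebesgue_on \<Omega>. u x = rep U x"
    using rep_ae_class[of \<Omega> u] unfolding u(2) by eventually_elim simp
  then show "U = ae_class \<Omega> (rep U)"
    unfolding u(2) ae_class_eq_iff by simp
qed

lemma Metric_space_W1p0: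
  assumes \<Omega>: "open \<Omega>" and p: "1 \<le> p"
  shows "Metric_space (W1p0 \<Omega> p) (W1p0_dist \<Omega> p)"
proof
  fix U V
  show "0 \<le> W1p0_dist \<Omega> p U V" by (simp add: W1p0_dist_def W1p_norm_nonneg)
  show "W1p0_dist \<Omega> p U V = W1p0_dist \<Omega> p V U"
    unfolding W1p0_dist_def using W1p_norm_uminus[OF \<Omega>, of p "\<lambda>x. rep V x - rep U x"] by simp
next
  fix U V assume UV: "U \<in> W1p0 \<Omega> p" "V \<in> W1p0 \<Omega> p"
  note u = rep_W1p0[OF \<Omega> UV(1)] and v = rep_W1p0[OF \<Omega> UV(2)]
  have "W1p0_dist \<Omega> p U V = 0 \<longleftrightarrow> (AE x in lebesgue_on \<Omega>. rep U x - rep V x = 0)"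
    unfolding W1p0_dist_def by (rule W1p_norm_eq_0_iff[OF \<Omega> p W1p_function_diff[OF \<Omega> p u(2) v(2)]])
  also have "\<dots> \<longleftrightarrow> U = V"
    by (subst u(3), subst v(3)) (simp add: ae_class_eq_iff)
  finally show "W1p0_dist \<Omega> p U V = 0 \<longleftrightarrow> U = V" .
next
  fix U V W assume UVW: "U \<in> W1p0 \<Omega> p" "V \<in> W1p0 \<Omega> p" "W \<in> W1p0 \<Omega> p"
  have "W1p0_dist \<Omega> p U W = W1p_norm \<Omega> p (\<lambda>x. (rep U x - rep V x) + (rep V x - rep W x))"
    by (simp add: W1p0_dist_def)
  also have "\<dots> \<le> W1p0_dist \<Omega> p U V + W1p0_dist \<Omega> p V W"
    unfolding W1p0_dist_def
    by (intro W1p_norm_triangle W1p_function_diff \<Omega> p rep_W1p0(2) UVW)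
  finally show "W1p0_dist \<Omega> p U W \<le> W1p0_dist \<Omega> p U V + W1p0_dist \<Omega> p V W" .
qed

lemma topspace_W1p0_topology:
  assumes "open \<Omega>" "1 \<le> p"
  shows "topspace (W1p0_topology \<Omega> p) = W1p0 \<Omega> p"
  unfolding W1p0_topology_def by (rule Metric_space.topspace_mtopology[OF Metric_space_W1p0[OF assms]])

lemma openin_W1p0_topology:
  assumes "open \<Omega>" "1 \<le> p"
  shows "openin (W1p0_topology \<Omega> p) X \<longleftrightarrow> X \<subseteq> W1p0 \<Omega> p \<and>
    (\<forall>U\<in>X. \<exists>r>0. \<forall>V\<in>W1p0 \<Omega> p. W1p0_dist \<Omega> p U V < r \<longrightarrow> V \<in> X)"
proof -
  interpret Metric_space "W1p0 \<Omega> p" "W1p0_dist \<Omega> p"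
    by (rule Metric_space_W1p0[OF assms])
  show ?thesis
    unfolding W1p0_topology_def openin_mtopology mball_def by blast
qed

lemma W1p_function_test:
  assumes \<Omega>: "open \<Omega>" and p: "0 < p" and \<phi>: "\<phi> \<in> test_functions \<Omega>"
  shows "W1p_function \<Omega> p \<phi>" "AE x in lebesgue_on \<Omega>. weak_grad \<Omega> \<phi> x = grad \<phi> x"
    and "Lp_function \<Omega> p \<phi>" "Lp_function \<Omega> p (grad \<phi>)"
proof -
  obtain K where K: "compact K" "K \<subseteq> \<Omega>" "\<And>x. x \<notin> K \<Longrightarrow> \<phi> x = 0"
    "\<And>x. x \<notin> K \<Longrightarrow> grad \<phi> x = 0" "smooth_on UNIV \<phi>"
    using test_functionsE[OF \<phi>] by blast
  have wg: "is_weak_gradient \<Omega> \<phi> (grad \<phi>)" by (rule is_weak_gradient_smooth[OF \<Omega> K(5)])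
  then show "AE x in lebesgue_on \<Omega>. weak_grad \<Omega> \<phi> x = grad \<phi> x"
    by (rule weak_grad_AE_eq[OF \<Omega>])
  have sets: "\<Omega> \<in> sets lebesgue" using \<Omega> by simp
  show Lp: "Lp_function \<Omega> p \<phi>"
    by (rule Lp_function_compact_support[OF sets p smooth_on_continuous[OF K(5)] K(1,2,3)])
  show Lpg: "Lp_function \<Omega> p (grad \<phi>)"
    by (rule Lp_function_compact_support[OF sets p smooth_on_grad_continuous[OF K(5)] K(1,2,4)])
  show "W1p_function \<Omega> p \<phi>" using wg Lp Lpg by (auto simp: W1p_function_def)
qed

lemma W1p0_function_test:
  assumes \<Omega>: "open \<Omega>" and p: "1 \<le> p" and \<phi>: "\<phi> \<in> test_functions \<Omega>"
  shows "W1p0_function \<Omega> p \<phi>"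
proof -
  have u: "W1p_function \<Omega> p \<phi>" using W1p_function_test[OF \<Omega> _ \<phi>] p by simp
  have "W1p_norm \<Omega> p (\<lambda>x. \<phi> x - \<phi> x) = 0"
    using W1p_norm_eq_0_iff[OF \<Omega> p W1p_function_diff[OF \<Omega> p u u]] by simp
  then show ?thesis
    using u \<phi> by (auto simp: W1p0_function_def intro!: bexI[of _ \<phi>])
qed

section \<open>Continuity of the constraint and of the energy\<close>

text \<open>The factor is zero at \<open>t = 0\<close>; it is the relative loss in \<open>max_powr_diff_le\<close>.\<close>

lemma exists_small_convexity_loss:
  fixes p I e :: real
  assumes "0 < e"
  shows "\<exists>t. 0 < t \<and> t < 1 \<and> ((1 - t) powr (1 - p) - 1) * (1 - t) powr (1 - p) * I < e"
proof -
  have "((\<lambda>t. ((1 - t) powr (1 - p) - 1) * (1 - t) powr (1 - p) * I) \<longlongrightarrow>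
      ((1 - 0) powr (1 - p) - 1) * (1 - 0) powr (1 - p) * I) (at_right 0)"
    by (intro tendsto_intros) auto
  then have "\<forall>\<^sub>F t in at_right 0. ((1 - t) powr (1 - p) - 1) * (1 - t) powr (1 - p) * I < e"
    using assms by (intro order_tendstoD) auto
  moreover have "\<forall>\<^sub>F t::real in at_right 0. 0 < t \<and> t < 1"
    by (auto simp: eventually_at_right[of 0 1] intro!: exI[of _ 1])
  ultimately have "\<forall>\<^sub>F t in at_right 0. 0 < t \<and> t < 1 \<and>
      ((1 - t) powr (1 - p) - 1) * (1 - t) powr (1 - p) * I < e"
    by eventually_elim auto
  then show ?thesis
    using eventually_happens[of _ "at_right (0::real)"] trivial_limit_at_right_real by blast
qed

definition pos_integral :: "'a::euclidean_space set \<Rightarrow> ('a \<Rightarrow> real) \<Rightarrow> real \<Rightarrow> ('a \<Rightarrow> real) \<Rightarrow> real" where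
  "pos_integral S m p u = (LINT x|lebesgue_on S. m x * max (u x) 0 powr p)"

text \<open>\<open>max y 0\<close> exceeds \<open>max x 0\<close> by at most \<open>\<bar>y - x\<bar>\<close>, so \<open>powr_add_le\<close> bounds either \<open>p\<close>-th power by
  the other one; inserting one bound into the other leaves only \<open>x\<close> and the difference on the right.\<close>

lemma max_powr_diff_le:
  fixes x y :: real
  assumes p: "1 \<le> p" and t: "0 < t" "t < 1"
  defines "c \<equiv> (1 - t) powr (1 - p)" and "d \<equiv> t powr (1 - p)"
  shows "\<bar>max y 0 powr p - max x 0 powr p\<bar> \<le> (c - 1) * c * \<bar>x\<bar> powr p + c * d * \<bar>y - x\<bar> powr p"
proof -
  have c: "1 \<le> c" unfolding c_def
    using t p powr_mono2'[of "1 - p" "1 - t" 1] by simp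
  have d: "0 \<le> d" by (simp add: d_def)
  have *: "max z 0 powr p \<le> c * max w 0 powr p + d * \<bar>z - w\<bar> powr p" for z w :: real
  proof -
    have "max z 0 powr p \<le> (max w 0 + \<bar>z - w\<bar>) powr p"
      using p by (intro powr_mono2) auto
    also have "\<dots> \<le> c * max w 0 powr p + d * \<bar>z - w\<bar> powr p"
      unfolding c_def d_def by (intro powr_add_le p t) auto
    finally show ?thesis .
  qed
  define D where "D = \<bar>y - x\<bar> powr p"
  define X where "X = max x 0 powr p"
  define Y where "Y = max y 0 powr p"
  have nn: "0 \<le> D" "0 \<le> X" by (auto simp: D_def X_def)
  have 1: "Y \<le> c * X + d * D" unfolding X_def Y_def D_def by (rule *)
  have 2: "X \<le> c * Y + d * D" unfolding X_def Y_def D_def using *[of x y] by (simp add: abs_minus_commute)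
  have cX: "(c - 1) * X \<le> (c - 1) * c * X"
    using mult_left_mono[OF c, of "(c - 1) * X"] c nn by (simp add: ac_simps)
  have dD: "d * D \<le> c * d * D"
    using mult_left_mono[OF c, of "d * D"] d nn by (simp add: ac_simps)
  have "Y - X \<le> (c - 1) * c * X + c * d * D" using 1 cX dD by (simp add: algebra_simps)
  moreover have "X - Y \<le> (c - 1) * c * X + c * d * D"
  proof -
    have "X - Y \<le> (c - 1) * Y + d * D" using 2 by (simp add: algebra_simps)
    also have "\<dots> \<le> (c - 1) * (c * X + d * D) + d * D"
      using 1 c by (intro add_right_mono mult_left_mono) auto
    finally show ?thesis by (simp add: algebra_simps)
  qed
  moreover have "(c - 1) * c * X \<le> (c - 1) * c * \<bar>x\<bar> powr p"
    unfolding X_def using c p by (intro mult_left_mono powr_mono2) auto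
  ultimately show ?thesis unfolding X_def Y_def D_def by linarith
qed

lemma integrable_pos_integral:
  assumes p: "0 < p" and u: "Lp_function S p u"
    and m: "m \<in> borel_measurable (lebesgue_on S)" "\<forall>x\<in>S. \<bar>m x\<bar> \<le> B"
  shows "integrable (lebesgue_on S) (\<lambda>x. m x * max (u x) 0 powr p)"
proof (rule Bochner_Integration.integrable_bound)
  have [measurable]: "u \<in> borel_measurable (lebesgue_on S)" using u by (simp add: Lp_function_def)
  note m(1)[measurable]
  show "integrable (lebesgue_on S) (\<lambda>x. B * norm (u x) powr p)"
    using u by (auto simp: Lp_function_def)
  show "(\<lambda>x. m x * max (u x) 0 powr p) \<in> borel_measurable (lebesgue_on S)" by measurable
  show "AE x in lebesgue_on S. norm (m x * max (u x) 0 powr p) \<le> norm (B * norm (u x) powr p)"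
  proof (intro AE_I2)
    fix x assume "x \<in> space (lebesgue_on S)"
    then have B: "\<bar>m x\<bar> \<le> B" using m by simp
    have "max (u x) 0 powr p \<le> \<bar>u x\<bar> powr p" using p by (intro powr_mono2) auto
    then show "norm (m x * max (u x) 0 powr p) \<le> norm (B * norm (u x) powr p)"
      using B by (auto simp: abs_mult intro!: mult_mono)
  qed
qed

text \<open>The parameter \<open>t\<close> is fixed first, so that the relative loss is below \<open>e / 2\<close>; then \<open>\<delta>\<close> makes the
  contribution of \<open>v - u\<close> at most \<open>e / 2\<close>.\<close>

lemma pos_integral_continuous:
  assumes p: "1 \<le> p" and u: "Lp_function S p u" and e: "0 < e"
    and m: "m \<in> borel_measurable (lebesgue_on S)" "\<forall>x\<in>S. \<bar>m x\<bar> \<le> B" and B: "0 \<le> B"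
  shows "\<exists>d>0. \<forall>v. Lp_function S p v \<longrightarrow> (LINT x|lebesgue_on S. \<bar>v x - u x\<bar> powr p) < d \<longrightarrow>
     \<bar>pos_integral S m p v - pos_integral S m p u\<bar> < e"
proof -
  define I where "I = (LINT x|lebesgue_on S. \<bar>u x\<bar> powr p)"
  obtain t where t: "0 < t" "t < 1" "((1 - t) powr (1 - p) - 1) * (1 - t) powr (1 - p) * (B * I) < e / 2"
    using exists_small_convexity_loss[of "e / 2" p "B * I"] e by auto
  define c where "c = (1 - t) powr (1 - p)"
  define d where "d = t powr (1 - p)"
  have cd: "0 < c" "0 < d" using t by (auto simp: c_def d_def)
  define k where "k = (B + 1) * c * d"
  define \<delta> where "\<delta> = e / (2 * k)"
  have k: "0 < k" using B cd by (auto simp: k_def intro!: mult_pos_pos)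
  then have \<delta>: "0 < \<delta>" using e by (simp add: \<delta>_def)
  have p0: "0 < p" using p by simp
  show ?thesis
  proof (intro exI[of _ \<delta>] conjI allI impI \<delta>)
    fix v assume v: "Lp_function S p v" and vd: "(LINT x|lebesgue_on S. \<bar>v x - u x\<bar> powr p) < \<delta>"
    let ?D = "LINT x|lebesgue_on S. \<bar>v x - u x\<bar> powr p"
    have "Lp_function S p (\<lambda>x. v x + (-1) *\<^sub>R u x)"
      by (intro Lp_function_add p v Lp_function_scaleR u)
    then have vu: "integrable (lebesgue_on S) (\<lambda>x. \<bar>v x - u x\<bar> powr p)"
      by (simp add: Lp_function_def)
    have uu: "integrable (lebesgue_on S) (\<lambda>x. \<bar>u x\<bar> powr p)" using u by (simp add: Lp_function_def)
    note int = integrable_pos_integral[OF p0 v m] integrable_pos_integral[OF p0 u m]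
    have "\<bar>pos_integral S m p v - pos_integral S m p u\<bar> =
        \<bar>LINT x|lebesgue_on S. m x * max (v x) 0 powr p - m x * max (u x) 0 powr p\<bar>"
      unfolding pos_integral_def using int by simp
    also have "\<dots> \<le> (LINT x|lebesgue_on S. B * ((c - 1) * c * \<bar>u x\<bar> powr p + c * d * \<bar>v x - u x\<bar> powr p))"
    proof (rule integral_abs_bound[THEN order_trans], rule integral_mono)
      show "integrable (lebesgue_on S) (\<lambda>x. \<bar>m x * max (v x) 0 powr p - m x * max (u x) 0 powr p\<bar>)"
        using int by auto
      show "integrable (lebesgue_on S) (\<lambda>x. B * ((c - 1) * c * \<bar>u x\<bar> powr p + c * d * \<bar>v x - u x\<bar> powr p))"
        using uu vu by auto
      fix x assume "x \<in> space (lebesgue_on S)"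
      then have mB: "\<bar>m x\<bar> \<le> B" using m by simp
      have "\<bar>m x * max (v x) 0 powr p - m x * max (u x) 0 powr p\<bar> = \<bar>m x\<bar> * \<bar>max (v x) 0 powr p - max (u x) 0 powr p\<bar>"
        by (simp add: abs_mult right_diff_distrib[symmetric])
      also have "\<dots> \<le> B * ((c - 1) * c * \<bar>u x\<bar> powr p + c * d * \<bar>v x - u x\<bar> powr p)"
        using mB B max_powr_diff_le[OF p t(1,2), of "v x" "u x"]
        by (intro mult_mono) (auto simp: c_def d_def)
      finally show "\<bar>m x * max (v x) 0 powr p - m x * max (u x) 0 powr p\<bar> \<le>
        B * ((c - 1) * c * \<bar>u x\<bar> powr p + c * d * \<bar>v x - u x\<bar> powr p)" .
    qed
    also have "\<dots> = (c - 1) * c * (B * I) + B * c * d * ?D"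
      using uu vu by (simp add: I_def algebra_simps)
    also have "B * c * d * ?D \<le> (B + 1) * c * d * \<delta>"
      using vd cd B by (intro mult_mono) auto
    also have "(B + 1) * c * d * \<delta> = e / 2"
      unfolding k_def[symmetric] using k by (simp add: \<delta>_def)
    finally show "\<bar>pos_integral S m p v - pos_integral S m p u\<bar> < e"
      using t(3) by (simp add: c_def)
  qed
qed

lemma Lp_integral_upper_semicontinuous:
  assumes p: "1 \<le> p" and g: "Lp_function S p g" and e: "0 < e"
  shows "\<exists>d>0. \<forall>h. Lp_function S p h \<longrightarrow> (LINT x|lebesgue_on S. norm (h x - g x) powr p) < d \<longrightarrow>
     powr_integral S p h < powr_integral S p g + e"
proof -
  define I where "I = powr_integral S p g"
  have I: "0 \<le> I" by (simp add: I_def)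
  obtain t where t: "0 < t" "t < 1" "((1 - t) powr (1 - p) - 1) * (1 - t) powr (1 - p) * I < e / 2"
    using exists_small_convexity_loss[of "e / 2" p I] e by auto
  define c where "c = (1 - t) powr (1 - p)"
  define d where "d = t powr (1 - p)"
  have d: "0 < d" using t by (auto simp: d_def)
  have c: "1 \<le> c" unfolding c_def using t p powr_mono2'[of "1 - p" "1 - t" 1] by simp
  show ?thesis
  proof (intro exI[of _ "e / (2 * d)"] conjI allI impI)
    show "0 < e / (2 * d)" using e d by simp
    fix h assume h: "Lp_function S p h" and hd: "(LINT x|lebesgue_on S. norm (h x - g x) powr p) < e / (2 * d)"
    have "Lp_function S p (\<lambda>x. h x + (-1) *\<^sub>R g x)"
      by (intro Lp_function_add p h Lp_function_scaleR g)
    then have hg: "Lp_function S p (\<lambda>x. h x - g x)" by simp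
    have "powr_integral S p h \<le> c * I + d * (LINT x|lebesgue_on S. norm (h x - g x) powr p)"
      using Lp_integral_add_le[OF p g hg t(1,2)] by (simp add: c_def d_def I_def)
    also have "\<dots> < c * I + e / 2"
      using hd d by (simp add: field_simps)
    also have "c * I \<le> I + (c - 1) * c * I"
    proof -
      have "0 \<le> (c - 1) * I" using c I by simp
      from mult_left_mono[OF c this] show ?thesis by (simp add: algebra_simps)
    qed
    finally show "powr_integral S p h < powr_integral S p g + e"
      using t(3) by (simp add: I_def c_def)
  qed
qed

section \<open>A balanced element in every set of genus at least two\<close>

text \<open>A nowhere vanishing odd continuous function is an admissible map into the punctured line, which
  would bound the genus by one.\<close>

lemma genus_ge_2_odd_function_has_zero:
  assumes A: "A \<subseteq> topspace X" and genus: "genus X neg A \<ge> 2"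
    and f: "continuous_map (subtopology X A) euclideanreal f"
    and odd: "\<And>v. v \<in> A \<Longrightarrow> f (neg v) = - f v"
  shows "\<exists>v\<in>A. f v = 0"
proof (rule ccontr)
  assume "\<not> ?thesis"
  then have nz: "f v \<noteq> 0" if "v \<in> A" for v using that by blast
  define \<phi> where "\<phi> = (\<lambda>v i::nat. if i < 1 then f v else 0)"
  have "continuous_map (subtopology X A) (Euclidean_space 1) \<phi>"
    unfolding \<phi>_def using f continuous_map_componentwise_Euclidean_space[of "subtopology X A" 1 "\<lambda>v i. f v"] by simp
  moreover have "\<phi> v \<noteq> (\<lambda>i. 0)" if "v \<in> A" for v
    using nz[OF that] by (auto simp: \<phi>_def fun_eq_iff)
  ultimately have "continuous_map (subtopology X A) (subtopology (Euclidean_space 1) (- {\<lambda>i. 0})) \<phi>"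
    by (auto simp: continuous_map_in_subtopology)
  moreover have "\<forall>v\<in>A. \<forall>i. \<phi> (neg v) i = - \<phi> v i"
    using odd by (simp add: \<phi>_def)
  ultimately have "genus X neg A \<le> enat 1"
    unfolding genus_def by (intro Inf_lower) blast
  then show False using genus by (metis one_enat_def one_less_numeral_iff semiring_norm(76) leD order_trans)
qed

lemma W1p0_dist_powr_ge:
  assumes "0 < p"
  shows "(LINT x|lebesgue_on \<Omega>. \<bar>rep V x - rep U x\<bar> powr p) \<le> W1p0_dist \<Omega> p U V powr p"
proof -
  have "(LINT x|lebesgue_on \<Omega>. \<bar>rep V x - rep U x\<bar> powr p) = (LINT x|lebesgue_on \<Omega>. \<bar>rep U x - rep V x\<bar> powr p)"
    by (simp add: abs_minus_commute)
  then show ?thesis unfolding W1p0_dist_def W1p_norm_powr[OF assms] by simp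
qed

lemma rep_neg_class:
  assumes \<Omega>: "open \<Omega>" and U: "U \<in> W1p0 \<Omega> p"
  shows "AE x in lebesgue_on \<Omega>. rep (neg_class U) x = - rep U x"
proof -
  have U': "U = ae_class \<Omega> (rep U)" by (rule rep_W1p0(3)[OF assms])
  have "rep (neg_class U) \<in> neg_class U"
    unfolding rep_def neg_class_def by (rule someI[of _ "\<lambda>x. - rep U x"]) 
      (use U' in \<open>auto simp: ae_class_def intro!: imageI\<close>)
  then obtain w where w: "w \<in> U" "rep (neg_class U) = (\<lambda>x. - w x)"
    by (auto simp: neg_class_def)
  have "AE x in lebesgue_on \<Omega>. w x = rep U x" using w(1) U' by (auto simp: ae_class_def)
  then show ?thesis unfolding w(2) by eventually_elim simp
qed

lemma pos_integral_cong_AE: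
  assumes "S \<in> sets lebesgue" "AE x in lebesgue_on S. u x = v x"
  shows "pos_integral S m p u = pos_integral S m p v"
  unfolding pos_integral_def using assms by (intro integral_lebesgue_on_cong_AE) auto

locale weighted_domain =
  fixes \<Omega> :: "'a::euclidean_space set" and m :: "'a \<Rightarrow> real"
  assumes \<Omega>: "open \<Omega>" "bounded \<Omega>" and m: "continuous_on (closure \<Omega>) m"
    and pos: "{x\<in>\<Omega>. m x > 0} \<noteq> {}"
begin

abbreviation pos_mass :: "real \<Rightarrow> ('a \<Rightarrow> real) \<Rightarrow> real" where
  "pos_mass p u \<equiv> pos_integral \<Omega> m p u"

abbreviation mass :: "real \<Rightarrow> ('a \<Rightarrow> real) \<Rightarrow> real" where
  "mass p u \<equiv> LINT x|lebesgue_on \<Omega>. m x * \<bar>u x\<bar> powr p"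

lemma weight_bounded:
  shows "m \<in> borel_measurable (lebesgue_on \<Omega>)" "\<exists>B>0. \<forall>x\<in>\<Omega>. \<bar>m x\<bar> \<le> B"
proof -
  show "m \<in> borel_measurable (lebesgue_on \<Omega>)"
    using \<Omega> m closure_subset
    by (intro continuous_imp_measurable_on_sets_lebesgue) (auto intro: continuous_on_subset)
  have "bounded (m ` closure \<Omega>)"
    using \<Omega> m by (intro compact_imp_bounded compact_continuous_image) auto
  then obtain B where "B > 0" "\<forall>y\<in>m ` closure \<Omega>. norm y \<le> B" by (auto simp: bounded_pos)
  then show "\<exists>B>0. \<forall>x\<in>\<Omega>. \<bar>m x\<bar> \<le> B"
    using closure_subset by (intro exI[of _ B]) auto
qed

lemma pos_integral_pair_continuous:
  assumes p: "1 \<le> p" and u: "Lp_function \<Omega> p u" and e: "0 < e"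
  shows "\<exists>d>0. \<forall>v. Lp_function \<Omega> p v \<longrightarrow> (LINT x|lebesgue_on \<Omega>. \<bar>v x - u x\<bar> powr p) < d \<longrightarrow>
     \<bar>pos_mass p v - pos_mass p u\<bar> < e \<and>
     \<bar>pos_mass p (\<lambda>x. - v x) - pos_mass p (\<lambda>x. - u x)\<bar> < e"
proof -
  obtain B where B: "\<forall>x\<in>\<Omega>. \<bar>m x\<bar> \<le> B" "0 < B" using weight_bounded(2) by blast
  have neg: "Lp_function \<Omega> p (\<lambda>x. - v x)" if "Lp_function \<Omega> p v" for v :: "'a \<Rightarrow> real"
    using Lp_function_scaleR[OF that, of "-1"] by simp
  note C = pos_integral_continuous[OF p _ e weight_bounded(1) B(1) less_imp_le[OF B(2)]]
  obtain d1 where d1: "0 < d1" "\<forall>v. Lp_function \<Omega> p v \<longrightarrow> (LINT x|lebesgue_on \<Omega>. \<bar>v x - u x\<bar> powr p) < d1 \<longrightarrow>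
     \<bar>pos_mass p v - pos_mass p u\<bar> < e"
    using C[OF u] by (elim exE conjE)
  obtain d2 where d2: "0 < d2" "\<forall>v. Lp_function \<Omega> p v \<longrightarrow> (LINT x|lebesgue_on \<Omega>. \<bar>v x - - u x\<bar> powr p) < d2 \<longrightarrow>
     \<bar>pos_mass p v - pos_mass p (\<lambda>x. - u x)\<bar> < e"
    using C[OF neg[OF u]] by (elim exE conjE)
  have "\<bar>- v x - - u x\<bar> = \<bar>v x - u x\<bar>" for v x by simp
  then show ?thesis
    using d1 d2(1) d2(2)[rule_format, OF neg] by (intro exI[of _ "min d1 d2"]) simp
qed

lemma continuous_map_pos_integral:
  assumes p: "1 \<le> p"
  shows "continuous_map (W1p0_topology \<Omega> p) euclideanreal
    (\<lambda>U. pos_mass p (rep U) - pos_mass p (\<lambda>x. - rep U x))" (is "continuous_map _ _ ?f")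
  unfolding continuous_map_def
proof (intro conjI allI impI)
  fix G assume "openin euclideanreal G"
  then have G: "open G" using open_openin by blast
  show "openin (W1p0_topology \<Omega> p) {U \<in> topspace (W1p0_topology \<Omega> p). ?f U \<in> G}"
    unfolding openin_W1p0_topology[OF \<Omega>(1) p] topspace_W1p0_topology[OF \<Omega>(1) p]
  proof (intro conjI ballI)
    fix U assume "U \<in> {U \<in> W1p0 \<Omega> p. ?f U \<in> G}"
    then have U: "U \<in> W1p0 \<Omega> p" "?f U \<in> G" by auto
    obtain e where e: "0 < e" "\<And>y. dist y (?f U) < e \<Longrightarrow> y \<in> G"
      using G U(2) unfolding open_dist by blast
    have Lp: "Lp_function \<Omega> p (rep V)" if "V \<in> W1p0 \<Omega> p" for V
      using rep_W1p0(2)[OF \<Omega>(1) that] by (simp add: W1p_function_def)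
    have "0 < e / 2" using e(1) by simp
    from pos_integral_pair_continuous[OF p Lp[OF U(1)] this]
    obtain d where d: "0 < d" "\<forall>v. Lp_function \<Omega> p v \<longrightarrow> (LINT x|lebesgue_on \<Omega>. \<bar>v x - rep U x\<bar> powr p) < d \<longrightarrow>
       \<bar>pos_mass p v - pos_mass p (rep U)\<bar> < e / 2 \<and>
       \<bar>pos_mass p (\<lambda>x. - v x) - pos_mass p (\<lambda>x. - rep U x)\<bar> < e / 2"
      by (elim exE conjE)
    define r where "r = d powr (1 / p)"
    have p0: "0 < p" using p by simp
    show "\<exists>r>0. \<forall>V\<in>W1p0 \<Omega> p. W1p0_dist \<Omega> p U V < r \<longrightarrow> V \<in> {U \<in> W1p0 \<Omega> p. ?f U \<in> G}"
    proof (intro exI[of _ r] conjI ballI impI)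
      show "0 < r" using d(1) by (simp add: r_def)
      fix V assume V: "V \<in> W1p0 \<Omega> p" and "W1p0_dist \<Omega> p U V < r"
      then have "W1p0_dist \<Omega> p U V powr p < r powr p"
        using p by (intro powr_less_mono2) (auto simp: W1p0_dist_def W1p_norm_nonneg)
      also have "r powr p = d"
        using d(1) p by (simp add: r_def powr_powr)
      finally have "(LINT x|lebesgue_on \<Omega>. \<bar>rep V x - rep U x\<bar> powr p) < d"
        using W1p0_dist_powr_ge[OF p0, of \<Omega> V U] by linarith
      then have "\<bar>?f V - ?f U\<bar> < e"
        using d(2)[rule_format, OF Lp[OF V]] by linarith
      then show "V \<in> {U \<in> W1p0 \<Omega> p. ?f U \<in> G}"
        using V e(2) by (simp add: dist_real_def)
    qed
  qed auto
qed auto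

text \<open>The difference of the weighted masses of the positive and the negative part is odd and continuous, and
  the constraint says that the two masses add up to one.\<close>

lemma Sigma2_balanced_element:
  assumes p: "1 \<le> p" and A: "A \<in> Sigma2 \<Omega> m p"
  shows "\<exists>U\<in>A. pos_mass p (rep U) = 1/2 \<and> pos_mass p (\<lambda>x. - rep U x) = 1/2"
proof -
  let ?f = "\<lambda>U. pos_mass p (rep U) - pos_mass p (\<lambda>x. - rep U x)"
  have sets: "\<Omega> \<in> sets lebesgue" using \<Omega> by simp
  have AW: "A \<subseteq> W1p0 \<Omega> p" using A by (auto simp: Sigma2_def A_plus_def)
  have "\<exists>U\<in>A. ?f U = 0"
  proof (rule genus_ge_2_odd_function_has_zero)
    show "A \<subseteq> topspace (W1p0_topology \<Omega> p)"
      using AW topspace_W1p0_topology[OF \<Omega>(1) p] by simp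
    show "2 \<le> genus (W1p0_topology \<Omega> p) neg_class A" using A by (simp add: Sigma2_def)
    show "continuous_map (subtopology (W1p0_topology \<Omega> p) A) euclideanreal ?f"
      by (rule continuous_map_from_subtopology[OF continuous_map_pos_integral[OF p]])
    fix U assume U: "U \<in> A"
    then have ae: "AE x in lebesgue_on \<Omega>. rep (neg_class U) x = - rep U x"
      using rep_neg_class[OF \<Omega>(1)] AW by blast
    then have ae': "AE x in lebesgue_on \<Omega>. - rep (neg_class U) x = rep U x"
      by eventually_elim simp
    show "?f (neg_class U) = - ?f U"
      using pos_integral_cong_AE[OF sets ae, of m p] pos_integral_cong_AE[OF sets ae', of m p] by simp
  qed
  then obtain U where U: "U \<in> A" "?f U = 0" by blast
  have Lp: "Lp_function \<Omega> p (rep U)" "Lp_function \<Omega> p (\<lambda>x. - rep U x)"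
    using rep_W1p0(2)[OF \<Omega>(1)] AW U Lp_function_scaleR[of \<Omega> p "rep U" "-1"] by (auto simp: W1p_function_def)
  obtain B where B: "0 < B" "\<forall>x\<in>\<Omega>. \<bar>m x\<bar> \<le> B" using weight_bounded by blast
  have p0: "0 < p" using p by simp
  have "1 = mass p (rep U)"
    using A U by (auto simp: Sigma2_def A_plus_def)
  also have "\<dots> = (LINT x|lebesgue_on \<Omega>. m x * max (rep U x) 0 powr p + m x * max (- rep U x) 0 powr p)"
  proof (intro Bochner_Integration.integral_cong refl)
    fix x
    show "m x * \<bar>rep U x\<bar> powr p = m x * max (rep U x) 0 powr p + m x * max (- rep U x) 0 powr p"
      by (cases "rep U x \<ge> 0") (auto simp: max_def)
  qed
  also have "\<dots> = pos_mass p (rep U) + pos_mass p (\<lambda>x. - rep U x)"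
    unfolding pos_integral_def
    by (intro Bochner_Integration.integral_add integrable_pos_integral[OF p0 _ weight_bounded(1) B(2)] Lp)
  finally show ?thesis using U by (intro bexI[of _ U]) auto
qed

text \<open>A compact set is bounded in the Sobolev metric. Without this bound the supremum of the energies over
  \<open>A\<close> would be an unspecified real number.\<close>

lemma Sigma2_energy_bdd_above:
  assumes p: "1 \<le> p" and A: "A \<in> Sigma2 \<Omega> m p"
  shows "bdd_above (grad_energy \<Omega> p ` A)"
proof -
  interpret Metric_space "W1p0 \<Omega> p" "W1p0_dist \<Omega> p"
    by (rule Metric_space_W1p0[OF \<Omega>(1) p])
  have p0: "0 < p" using p by simp
  have "compactin mtopology A"
    using A by (simp add: Sigma2_def W1p0_topology_def)
  then have "mbounded A" by (rule compactin_imp_mbounded)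
  then obtain V b where V: "A \<subseteq> mcball V b" unfolding mbounded_def by blast
  show ?thesis
  proof (rule bdd_aboveI2)
    fix U assume "U \<in> A"
    with V have U: "U \<in> W1p0 \<Omega> p" "V \<in> W1p0 \<Omega> p" "W1p0_dist \<Omega> p U V \<le> b"
      by (auto simp: subset_iff commute)
    have "grad_energy \<Omega> p U \<le> W1p_norm \<Omega> p (rep U) powr p"
      unfolding W1p_norm_powr[OF p0] grad_energy_def by simp
    also have "\<dots> \<le> (b + W1p_norm \<Omega> p (rep V)) powr p"
    proof (rule powr_mono2)
      have "W1p_norm \<Omega> p (rep U) = W1p_norm \<Omega> p (\<lambda>x. (rep U x - rep V x) + rep V x)" by simp
      also have "\<dots> \<le> W1p_norm \<Omega> p (\<lambda>x. rep U x - rep V x) + W1p_norm \<Omega> p (rep V)"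
        by (intro W1p_norm_triangle W1p_function_diff \<Omega>(1) p rep_W1p0(2) U)
      finally show "W1p_norm \<Omega> p (rep U) \<le> b + W1p_norm \<Omega> p (rep V)"
        using U(3) by (simp add: W1p0_dist_def)
    qed (use p0 W1p_norm_nonneg in auto)
    finally show "grad_energy \<Omega> p U \<le> (b + W1p_norm \<Omega> p (rep V)) powr p" .
  qed
qed

lemma Sigma2_test_function:
  assumes p: "1 \<le> p" and A: "A \<in> Sigma2 \<Omega> m p" and e: "0 < e"
  obtains f where "f \<in> test_functions \<Omega>"
    "pos_mass p f > 1/4" "pos_mass p (\<lambda>x. - f x) > 1/4"
    "(LINT x|lborel. norm (grad f x) powr p) < (SUP U\<in>A. grad_energy \<Omega> p U) + e"
proof -
  have sets: "\<Omega> \<in> sets lebesgue" using \<Omega> by simp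
  have p0: "0 < p" using p by simp
  obtain U where U: "U \<in> A" "pos_mass p (rep U) = 1/2" "pos_mass p (\<lambda>x. - rep U x) = 1/2"
    using Sigma2_balanced_element[OF p A] by blast
  have UW: "U \<in> W1p0 \<Omega> p" using A U by (auto simp: Sigma2_def A_plus_def)
  note u = rep_W1p0[OF \<Omega>(1) UW]
  note g = W1p_function_weak_grad[OF \<Omega>(1) u(2)]
  have Lp: "Lp_function \<Omega> p (rep U)" using u(2) by (simp add: W1p_function_def)
  have "0 < (1 / 4 :: real)" by simp
  from pos_integral_pair_continuous[OF p Lp this]
  obtain d1 where d1: "0 < d1" "\<forall>v. Lp_function \<Omega> p v \<longrightarrow> (LINT x|lebesgue_on \<Omega>. \<bar>v x - rep U x\<bar> powr p) < d1 \<longrightarrow>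
     \<bar>pos_mass p v - pos_mass p (rep U)\<bar> < 1 / 4 \<and>
     \<bar>pos_mass p (\<lambda>x. - v x) - pos_mass p (\<lambda>x. - rep U x)\<bar> < 1 / 4"
    by (elim exE conjE)
  obtain d2 where d2: "0 < d2" "\<forall>h. Lp_function \<Omega> p h \<longrightarrow>
      (LINT x|lebesgue_on \<Omega>. norm (h x - weak_grad \<Omega> (rep U) x) powr p) < d2 \<longrightarrow>
      powr_integral \<Omega> p h < powr_integral \<Omega> p (weak_grad \<Omega> (rep U)) + e"
    using Lp_integral_upper_semicontinuous[OF p g(2) e] by (elim exE conjE)
  define r where "r = min d1 d2 powr (1 / p)"
  have r: "0 < r" "r powr p = min d1 d2"
    using d1(1) d2(1) p by (simp_all add: r_def powr_powr)
  obtain f where f: "f \<in> test_functions \<Omega>" "W1p_norm \<Omega> p (\<lambda>x. rep U x - f x) < r"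
    using u(1) r(1) by (auto simp: W1p0_function_def)
  obtain K where K: "compact K" "K \<subseteq> \<Omega>" "\<And>x. x \<notin> K \<Longrightarrow> f x = 0"
    "\<And>x. x \<notin> K \<Longrightarrow> grad f x = 0" "smooth_on UNIV f"
    using test_functionsE[OF f(1)] by blast
  note W = W1p_function_test[OF \<Omega>(1) p0 f(1)]
  have "W1p_norm \<Omega> p (\<lambda>x. rep U x - f x) powr p < r powr p"
    using f(2) p0 by (intro powr_less_mono2 W1p_norm_nonneg) auto
  then have sum: "(LINT x|lebesgue_on \<Omega>. \<bar>rep U x - f x\<bar> powr p) +
      powr_integral \<Omega> p (weak_grad \<Omega> (\<lambda>x. rep U x - f x)) < min d1 d2"
    by (simp add: W1p_norm_powr[OF p0] r(2))
  have nn: "0 \<le> (LINT x|lebesgue_on \<Omega>. \<bar>rep U x - f x\<bar> powr p)"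
    "0 \<le> powr_integral \<Omega> p (weak_grad \<Omega> (\<lambda>x. rep U x - f x))" by simp_all
  have eq1: "(LINT x|lebesgue_on \<Omega>. \<bar>f x - rep U x\<bar> powr p) = (LINT x|lebesgue_on \<Omega>. \<bar>rep U x - f x\<bar> powr p)"
    by (simp add: abs_minus_commute)
  have ae: "AE x in lebesgue_on \<Omega>. weak_grad \<Omega> (\<lambda>x. rep U x - f x) x = weak_grad \<Omega> (rep U) x - grad f x"
    using is_weak_gradient_add_scaled[OF \<Omega>(1) g(1) is_weak_gradient_smooth[OF \<Omega>(1) K(5)], of 1 "-1"]
    by (intro weak_grad_AE_eq \<Omega>) simp
  have eq2: "(LINT x|lebesgue_on \<Omega>. norm (grad f x - weak_grad \<Omega> (rep U) x) powr p) =
      powr_integral \<Omega> p (weak_grad \<Omega> (\<lambda>x. rep U x - f x))"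
    using ae by (intro integral_lebesgue_on_cong_AE[OF sets]) (auto simp: norm_minus_commute)
  have "pos_mass p f > 1/4 \<and> pos_mass p (\<lambda>x. - f x) > 1/4"
    using d1(2)[rule_format, OF W(3)] sum nn U(2,3) unfolding eq1 by linarith
  moreover have "(LINT x|lborel. norm (grad f x) powr p) < (SUP U\<in>A. grad_energy \<Omega> p U) + e"
  proof -
    have cont: "continuous_on UNIV (\<lambda>x. norm (grad f x) powr p)"
      using p0 K by (intro continuous_on_powr' continuous_intros smooth_on_grad_continuous) auto
    have "(LINT x|lborel. norm (grad f x) powr p) = powr_integral \<Omega> p (grad f)"
      using K p0 compact_support_integral_lebesgue[OF cont K(1)]
      by (subst integral_lebesgue_on_support[OF sets]) auto
    also have "\<dots> < grad_energy \<Omega> p U + e"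
      using d2(2)[rule_format, OF W(4)] sum nn unfolding eq2 grad_energy_def by linarith
    also have "grad_energy \<Omega> p U \<le> (SUP U\<in>A. grad_energy \<Omega> p U)"
      by (intro cSUP_upper U Sigma2_energy_bdd_above[OF p A])
    finally show ?thesis by simp
  qed
  ultimately show ?thesis using that f(1) by blast
qed

end

section \<open>An almost sharp Lipschitz estimate\<close>

lemma integral_powr_dilation_le:
  fixes f :: "'a::euclidean_space \<Rightarrow> real"
  assumes f: "continuous_on UNIV f" "compact K" "\<And>x. x \<notin> K \<Longrightarrow> f x = 0" "\<And>x. 0 \<le> f x" and t: "0 < t"
  shows "integral (cbox 0 d) (\<lambda>z. f (t *\<^sub>R z + c)) \<le> integral\<^sup>L lborel f / t ^ DIM('a)"
proof -
  have cont: "continuous_on S (\<lambda>z. f (t *\<^sub>R z + c))" for S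
    by (intro continuous_on_compose2[OF f(1)] continuous_intros) auto
  show ?thesis
  proof (cases "cbox 0 d = {}")
    case True
    then show ?thesis using f(4) t by simp
  next
    case False
    have img: "(\<lambda>z. (1 / t) *\<^sub>R z + - ((1 / t) *\<^sub>R c)) ` cbox c (t *\<^sub>R d + c) = cbox 0 d"
    proof -
      have "cbox c (t *\<^sub>R d + c) \<noteq> {}"
        using False t by (auto simp: box_ne_empty inner_add_left)
      then show ?thesis
        using t by (subst image_affinity_cbox) (simp add: scaleR_add_right)
    qed
    let ?J = "integral (cbox c (t *\<^sub>R d + c)) f"
    have int: "(f has_integral ?J) (cbox c (t *\<^sub>R d + c))"
      using f(1) by (intro integrable_integral integrable_continuous) (rule continuous_on_subset, auto)
    have "((\<lambda>z. f (t *\<^sub>R z + c)) has_integral (1 / \<bar>t\<bar> ^ DIM('a)) *\<^sub>R ?J) (cbox 0 d)"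
      using has_integral_affinity[OF int, of t c] t img by simp
    then have "integral (cbox 0 d) (\<lambda>z. f (t *\<^sub>R z + c)) = ?J / t ^ DIM('a)"
      using t by (simp add: integral_unique)
    moreover have "?J \<le> integral\<^sup>L lborel f"
    proof -
      have U: "(f has_integral integral\<^sup>L lborel f) UNIV"
        by (intro has_integral_integral_lborel compact_support_integrable_lborel[OF f(1-3)])
      have "?J \<le> integral UNIV f"
        using int U f(4) by (intro integral_subset_le) auto
      then show ?thesis using U by (simp add: integral_unique)
    qed
    ultimately show ?thesis using t by (simp add: divide_right_mono)
  qed
qed

text \<open>Jensen's inequality for \<open>t\<^sup>p\<close>, obtained by integrating Young's inequality for \<open>f x\<close> and
  \<open>a powr (p - 1)\<close>.\<close>

lemma integral_le_powr_mean:
  fixes f :: "'a::euclidean_space \<Rightarrow> real"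
  assumes f: "continuous_on (cbox 0 d) f" "\<And>x. 0 \<le> f x" and p: "1 < p" and a: "0 < a"
    and le: "integral (cbox 0 d) (\<lambda>x. f x powr p) \<le> measure lborel (cbox 0 d) * a powr p"
  shows "integral (cbox 0 d) f \<le> measure lborel (cbox 0 d) * a"
proof -
  define q where "q = p / (p - 1)"
  have q: "1 < q" "1 / p + 1 / q = 1" "(p - 1) * q = p" using p by (auto simp: q_def field_simps)
  have fp: "(\<lambda>x. f x powr p) integrable_on cbox 0 d"
    using f p by (intro integrable_continuous continuous_on_powr' continuous_intros) auto
  have fi: "f integrable_on cbox 0 d" using f by (intro integrable_continuous)
  have young: "f x * a powr (p - 1) \<le> f x powr p / p + a powr p / q" for x
    using Youngs_inequality[OF p q(1,2), of "f x" "a powr (p - 1)"] f(2) q(3) by (simp add: powr_powr)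
  have "integral (cbox 0 d) f * a powr (p - 1) = integral (cbox 0 d) (\<lambda>x. f x * a powr (p - 1))"
    by simp
  also have "\<dots> \<le> integral (cbox 0 d) (\<lambda>x. f x powr p / p + a powr p / q)"
    using fi fp by (intro integral_le young integrable_add integrable_on_mult_left integrable_on_divide integrable_const) auto
  also have "\<dots> = integral (cbox 0 d) (\<lambda>x. f x powr p) / p + measure lborel (cbox 0 d) * (a powr p / q)"
    using fp by (subst Henstock_Kurzweil_Integration.integral_add) (auto intro: integrable_on_divide)
  also have "\<dots> \<le> measure lborel (cbox 0 d) * a powr p / p + measure lborel (cbox 0 d) * (a powr p / q)"
    using le p by (intro add_right_mono divide_right_mono) auto
  also have "\<dots> = measure lborel (cbox 0 d) * a powr p * (1 / p + 1 / q)"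
    by (simp add: algebra_simps)
  also have "\<dots> = measure lborel (cbox 0 d) * a * a powr (p - 1)"
    using q a by (simp add: powr_diff)
  finally show ?thesis using a by simp
qed

lemma content_cube: "0 < d \<Longrightarrow> measure lborel (cbox 0 (d *\<^sub>R One :: 'a::euclidean_space)) = d ^ DIM('a)"
  by (subst content_cbox) auto

lemma norm_cube_le:
  fixes z :: "'a::euclidean_space" and d :: real
  assumes "0 < d" "z \<in> cbox 0 (d *\<^sub>R One)"
  shows "norm z \<le> real DIM('a) * d"
proof -
  have "norm z \<le> (\<Sum>i\<in>Basis. \<bar>z \<bullet> i\<bar>)" by (rule norm_le_l1)
  also have "\<dots> \<le> (\<Sum>i\<in>(Basis::'a set). d)" using assms by (intro sum_mono) (auto simp: mem_box)
  finally show ?thesis by simp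
qed

text \<open>Shrink the cube \<open>y + [0, d]\<^sup>n\<close> linearly to the point \<open>x\<close>, and let \<open>F t\<close> be the integral of \<open>f\<close> over
  the cube at stage \<open>t\<close>, pulled back to \<open>[0, d]\<^sup>n\<close>. By Jensen's inequality and the substitution that
  undoes the dilation, \<open>F'\<close> is of order \<open>t\<close> to the power \<open>-n/p\<close>, which is integrable at zero
  exactly for \<open>p > n\<close>; its integral contributes the factor \<open>1 / (1 - n/p)\<close>. The power of \<open>d\<close> tends to
  \<open>1\<close> as \<open>p\<close> grows with \<open>d\<close> fixed, so nothing is lost in the limit.\<close>

lemma cube_average_difference_le:
  fixes f :: "'a::euclidean_space \<Rightarrow> real" and p d G :: real
  assumes f: "smooth_on UNIV f" and K: "compact K" "\<And>x. x \<notin> K \<Longrightarrow> f x = 0"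
    and p: "real DIM('a) < p" and d: "0 < d" and G: "0 < G"
    and energy: "(LINT x|lborel. norm (grad f x) powr p) \<le> G powr p"
  shows "\<bar>f x - integral (cbox 0 (d *\<^sub>R One)) (\<lambda>z. f (y + z)) / d ^ DIM('a)\<bar> \<le>
    (norm (y - x) + real DIM('a) * d) * d powr (- real DIM('a) / p) * G / (1 - real DIM('a) / p)"
proof -
  let ?n = "DIM('a)"
  let ?Q = "cbox 0 (d *\<^sub>R One) :: 'a set"
  define v where "v = y - x"
  define N where "N = norm v + real ?n * d"
  have N: "0 < N" using d by (auto simp: N_def intro!: add_nonneg_pos mult_pos_pos)
  have p1: "1 < p" using p DIM_positive[where 'a='a] by linarith
  define s where "s = 1 - real ?n / p"
  have s: "0 < s" using p p1 by (simp add: s_def)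
  define F where "F t = integral ?Q (\<lambda>z. f (x + t *\<^sub>R (v + z)))" for t
  define F' where "F' t = integral ?Q (\<lambda>z. grad f (x + t *\<^sub>R (v + z)) \<bullet> (v + z))" for t
  have contg: "continuous_on S (\<lambda>z. grad f (x + t *\<^sub>R (v + z)))" for S t
    by (intro continuous_on_compose2[OF smooth_on_grad_continuous[OF f, of UNIV]] continuous_intros) auto
  have F: "(F has_vector_derivative F' t) (at t)" for t
    unfolding F_def[abs_def] F'_def
  proof (rule leibniz_rule_vector_derivative)
    show "((\<lambda>t. f (x + t *\<^sub>R (v + z))) has_vector_derivative grad f (x + t *\<^sub>R (v + z)) \<bullet> (v + z)) (at t)" for z t
      by (rule smooth_chain[OF f]) (auto intro!: derivative_eq_intros)
    show "(\<lambda>z. f (x + t *\<^sub>R (v + z))) integrable_on ?Q" for t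
      by (intro integrable_continuous continuous_on_compose2[OF smooth_on_continuous[OF f, of UNIV]]
          continuous_intros) auto
    show "continuous_on (UNIV \<times> ?Q) (\<lambda>(t, z). grad f (x + t *\<^sub>R (v + z)) \<bullet> (v + z))"
      unfolding case_prod_unfold
      by (intro continuous_intros continuous_on_compose2[OF smooth_on_grad_continuous[OF f, of UNIV]]) auto
  qed auto
  define C where "C = d ^ ?n * (N * (d powr (- real ?n / p) * G))"
  have bound: "norm (F' t) \<le> C * t powr (- real ?n / p)" if t: "0 < t" for t
  proof -
    \<comment> \<open>Chosen so that \<open>a\<^sup>p\<close> is the bound \<open>G\<^sup>p / t\<^sup>n\<close> divided by the volume of the cube.\<close>
    define a where "a = t powr (- real ?n / p) * d powr (- real ?n / p) * G"
    have a: "0 < a" using t d G by (simp add: a_def)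
    have "a powr p = t powr (- real ?n) * d powr (- real ?n) * G powr p"
      using p1 by (simp add: a_def powr_mult powr_powr)
    then have ap: "d ^ ?n * a powr p = G powr p / t ^ ?n"
      using t d by (simp add: powr_minus powr_realpow divide_inverse)
    have "norm (F' t) \<le> integral ?Q (\<lambda>z. norm (grad f (x + t *\<^sub>R (v + z))) * N)"
      unfolding F'_def
    proof (rule integral_norm_bound_integral)
      show "(\<lambda>z. grad f (x + t *\<^sub>R (v + z)) \<bullet> (v + z)) integrable_on ?Q"
        "(\<lambda>z. norm (grad f (x + t *\<^sub>R (v + z))) * N) integrable_on ?Q"
        by (intro integrable_continuous continuous_intros contg)+
      fix z assume z: "z \<in> ?Q"
      have "norm (v + z) \<le> N"
        using norm_triangle_ineq[of v z] norm_cube_le[OF d z] by (simp add: N_def)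
      then have "norm (grad f (x + t *\<^sub>R (v + z))) * norm (v + z) \<le> norm (grad f (x + t *\<^sub>R (v + z))) * N"
        by (rule mult_left_mono) simp
      with Cauchy_Schwarz_ineq2[of "grad f (x + t *\<^sub>R (v + z))" "v + z"]
      show "norm (grad f (x + t *\<^sub>R (v + z)) \<bullet> (v + z)) \<le> norm (grad f (x + t *\<^sub>R (v + z))) * N"
        unfolding real_norm_def by (rule order_trans)
    qed
    also have "\<dots> = integral ?Q (\<lambda>z. norm (grad f (x + t *\<^sub>R (v + z)))) * N" by simp
    also have "\<dots> \<le> (d ^ ?n * a) * N"
    proof (rule mult_right_mono)
      have pw: "continuous_on UNIV (\<lambda>w. norm (grad f w) powr p)"
        using p1 by (intro continuous_on_powr' continuous_intros smooth_on_grad_continuous[OF f]) auto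
      have "integral ?Q (\<lambda>z. norm (grad f (t *\<^sub>R z + (x + t *\<^sub>R v))) powr p) \<le>
          (LINT w|lborel. norm (grad f w) powr p) / t ^ ?n"
        using p1 grad_eq_0_outside[OF K] by (intro integral_powr_dilation_le[OF pw K(1) _ _ t]) auto
      also have "\<dots> \<le> d ^ ?n * a powr p"
        unfolding ap using energy t by (intro divide_right_mono) auto
      finally have "integral ?Q (\<lambda>z. norm (grad f (x + t *\<^sub>R (v + z))) powr p) \<le> measure lborel ?Q * a powr p"
        by (simp add: content_cube[OF d] algebra_simps)
      then show "integral ?Q (\<lambda>z. norm (grad f (x + t *\<^sub>R (v + z)))) \<le> d ^ ?n * a"
        using integral_le_powr_mean[OF _ _ p1 a, of "d *\<^sub>R One" "\<lambda>z. norm (grad f (x + t *\<^sub>R (v + z)))"]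
        by (simp add: content_cube[OF d] continuous_on_norm contg)
    qed (use N in auto)
    finally show ?thesis by (simp add: C_def a_def mult_ac)
  qed
  have "norm (F 1 - F 0) \<le> C * 1 powr s / s - C * 0 powr s / s"
  proof (rule differentiable_bound_general[of 0 1 F "\<lambda>t. C * t powr s / s" F' "\<lambda>t. C * t powr (- real ?n / p)"])
    show "continuous_on {0..1} F"
      using F by (intro continuous_at_imp_continuous_on ballI) (blast intro: has_vector_derivative_continuous)
    show "continuous_on {0..1} (\<lambda>t. C * t powr s / s)"
      using s by (intro continuous_intros continuous_on_powr') auto
    fix t :: real assume t: "0 < t" "t < 1"
    show "(F has_vector_derivative F' t) (at t)" by (rule F)
    have "((\<lambda>t. C * t powr s / s) has_real_derivative C * (s * t powr (s - 1)) / s) (at t)"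
      using t by (intro DERIV_cdivide DERIV_cmult has_real_derivative_powr)
    then show "((\<lambda>t. C * t powr s / s) has_vector_derivative C * t powr (- real ?n / p)) (at t)"
      using s by (simp add: has_real_derivative_iff_has_vector_derivative) (simp add: s_def)
    show "norm (F' t) \<le> C * t powr (- real ?n / p)" by (rule bound[OF t(1)])
  qed auto
  then have "\<bar>F 0 - F 1\<bar> \<le> C / s" by (simp add: abs_minus_commute)
  moreover have "F 0 = d ^ ?n * f x"
    by (simp add: F_def content_cube[OF d])
  moreover have "F 1 = integral ?Q (\<lambda>z. f (y + z))"
    by (simp add: F_def v_def)
  ultimately have "\<bar>d ^ ?n * (f x - integral ?Q (\<lambda>z. f (y + z)) / d ^ ?n)\<bar> \<le> C / s"
    using d by (simp add: right_diff_distrib)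
  then have "d ^ ?n * \<bar>f x - integral ?Q (\<lambda>z. f (y + z)) / d ^ ?n\<bar> \<le> d ^ ?n * (N * (d powr (- real ?n / p) * G) / s)"
    using d by (simp add: abs_mult C_def)
  then have "\<bar>f x - integral ?Q (\<lambda>z. f (y + z)) / d ^ ?n\<bar> \<le> N * (d powr (- real ?n / p) * G) / s"
    by (rule mult_left_le_imp_le) (use d in simp)
  then show ?thesis by (simp add: N_def v_def s_def mult.assoc)
qed

text \<open>Compare \<open>f x\<close> and \<open>f y\<close> with the average of \<open>f\<close> over the same cube at \<open>y\<close>.\<close>

lemma almost_Lipschitz:
  fixes f :: "'a::euclidean_space \<Rightarrow> real" and p d G :: real
  assumes "smooth_on UNIV f" "compact K" "\<And>x. x \<notin> K \<Longrightarrow> f x = 0"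
    "real DIM('a) < p" "0 < d" "0 < G" "(LINT x|lborel. norm (grad f x) powr p) \<le> G powr p"
  shows "\<bar>f x - f y\<bar> \<le> d powr (- real DIM('a) / p) * G / (1 - real DIM('a) / p) * (norm (x - y) + 2 * real DIM('a) * d)"
proof -
  define k where "k = d powr (- real DIM('a) / p) * G / (1 - real DIM('a) / p)"
  let ?a = "integral (cbox 0 (d *\<^sub>R One)) (\<lambda>z. f (y + z)) / d ^ DIM('a)"
  have "\<bar>f x - ?a\<bar> \<le> (norm (y - x) + real DIM('a) * d) * k"
    using cube_average_difference_le[OF assms, of x y] by (simp add: k_def)
  moreover have "\<bar>f y - ?a\<bar> \<le> (norm (y - y) + real DIM('a) * d) * k"
    using cube_average_difference_le[OF assms, of y y] by (simp add: k_def)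
  ultimately have "\<bar>f x - f y\<bar> \<le> (norm (y - x) + real DIM('a) * d) * k + (norm (y - y) + real DIM('a) * d) * k"
    by linarith
  then show ?thesis
    unfolding k_def[symmetric] by (simp add: norm_minus_commute algebra_simps)
qed

section \<open>The lower bound\<close>

definition R2_radii :: "'a::euclidean_space set \<Rightarrow> ('a \<Rightarrow> real) \<Rightarrow> real set" where
  "R2_radii \<Omega> m = {r. r > 0 \<and> (\<exists>x1\<in>Omega_plus \<Omega> m. \<exists>x2\<in>Omega_plus \<Omega> m.
            ball x1 r \<inter> ball x2 r = {} \<and> ball x1 r \<subseteq> \<Omega> \<and> ball x2 r \<subseteq> \<Omega>)}"

lemma R2_plus_eq: "R2_plus \<Omega> m = Sup (R2_radii \<Omega> m)"
  by (simp add: R2_plus_def R2_radii_def)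

lemma R2_radiiI:
  assumes "0 < r" "x1 \<in> Omega_plus \<Omega> m" "x2 \<in> Omega_plus \<Omega> m"
    "ball x1 r \<inter> ball x2 r = {}" "ball x1 r \<subseteq> \<Omega>" "ball x2 r \<subseteq> \<Omega>"
  shows "r \<in> R2_radii \<Omega> m"
  unfolding R2_radii_def using assms by blast

lemma bdd_above_R2_radii:
  assumes "bounded \<Omega>"
  shows "bdd_above (R2_radii \<Omega> m)"
proof -
  obtain x B where B: "\<Omega> \<subseteq> cball x B" using assms bounded_subset_cball by metis
  show ?thesis
  proof (rule bdd_aboveI[of _ B])
    fix r assume "r \<in> R2_radii \<Omega> m"
    then obtain x1 where "0 < r" "ball x1 r \<subseteq> \<Omega>" by (auto simp: R2_radii_def)
    with B have "ball x1 r \<subseteq> cball x B" by blast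
    with \<open>0 < r\<close> have "dist x1 x + r \<le> B" by (simp add: ball_subset_cball_iff)
    then show "r \<le> B" using zero_le_dist[of x1 x] by linarith
  qed
qed

context weighted_domain
begin

lemma R2_plus_pos:
  shows "R2_radii \<Omega> m \<noteq> {}" "0 < R2_plus \<Omega> m"
proof -
  have "continuous_on \<Omega> m"
    using m closure_subset by (rule continuous_on_subset)
  then have "open (\<Omega> \<inter> m -` {0<..})"
    by (rule continuous_open_preimage) (use \<Omega> in auto)
  moreover have "\<Omega> \<inter> m -` {0<..} = {x\<in>\<Omega>. m x > 0}" by auto
  ultimately have "open {x\<in>\<Omega>. m x > 0}" by simp
  then obtain x0 e where e: "0 < e" "ball x0 e \<subseteq> {x\<in>\<Omega>. m x > 0}"
    using pos unfolding open_contains_ball by blast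
  obtain i :: 'a where i: "i \<in> Basis" using nonempty_Basis by blast
  let ?x = "x0 + (e / 2) *\<^sub>R i"
  have d: "dist x0 ?x = e / 2" using i e by (simp add: dist_norm)
  have "e / 4 \<in> R2_radii \<Omega> m"
  proof (rule R2_radiiI[of _ x0 _ _ ?x])
    show "x0 \<in> Omega_plus \<Omega> m" "?x \<in> Omega_plus \<Omega> m"
      unfolding Omega_plus_def by (rule subsetD[OF closure_subset], rule subsetD[OF e(2)], use e d in simp)+
    show "ball x0 (e / 4) \<inter> ball ?x (e / 4) = {}"
    proof (rule ccontr)
      assume "\<not> ?thesis"
      then obtain z where "dist x0 z < e / 4" "dist ?x z < e / 4" by auto
      then show False using d dist_triangle2[of x0 ?x z] by linarith
    qed
    show "ball x0 (e / 4) \<subseteq> \<Omega>" using e by force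
    show "ball ?x (e / 4) \<subseteq> \<Omega>"
    proof
      fix z assume "z \<in> ball ?x (e / 4)"
      then have "z \<in> ball x0 e" using d dist_triangle[of x0 z ?x] e by simp
      then show "z \<in> \<Omega>" using e by blast
    qed
  qed (use e in auto)
  then show "R2_radii \<Omega> m \<noteq> {}" by blast
  from \<open>e / 4 \<in> R2_radii \<Omega> m\<close> show "0 < R2_plus \<Omega> m"
    unfolding R2_plus_eq using e cSup_upper[OF _ bdd_above_R2_radii[OF \<Omega>(2)]] by fastforce
qed

lemma pos_integral_gt_imp_large_value:
  assumes B: "\<forall>x\<in>\<Omega>. \<bar>m x\<bar> \<le> B" "0 \<le> B"
    and p: "0 < p" and u: "Lp_function \<Omega> p u" and c: "0 \<le> c"
    and gt: "pos_mass p u > B * c powr p * measure lebesgue \<Omega>"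
  shows "\<exists>x\<in>\<Omega>. m x > 0 \<and> u x > c"
proof (rule ccontr)
  assume "\<not> ?thesis"
  then have le: "u x \<le> c" if "x \<in> \<Omega>" "m x > 0" for x using that by force
  have lm: "\<Omega> \<in> lmeasurable" using \<Omega> by (simp add: lmeasurable_open)
  then have sets: "\<Omega> \<in> sets lebesgue" by (rule fmeasurableD)
  have "pos_mass p u \<le> (LINT x|lebesgue_on \<Omega>. B * c powr p)"
    unfolding pos_integral_def
  proof (rule integral_mono)
    show "integrable (lebesgue_on \<Omega>) (\<lambda>x. m x * max (u x) 0 powr p)"
      by (rule integrable_pos_integral[OF p u weight_bounded(1) B(1)])
    show "integrable (lebesgue_on \<Omega>) (\<lambda>x. B * c powr p)"
      by (rule finite_measure.integrable_const[OF finite_measure_lebesgue_on[OF lm]])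
    fix x assume "x \<in> space (lebesgue_on \<Omega>)"
    then have x: "x \<in> \<Omega>" by simp
    show "m x * max (u x) 0 powr p \<le> B * c powr p"
    proof (cases "m x > 0")
      case True
      then show ?thesis using x le[OF x True] B c p by (intro mult_mono powr_mono2) auto
    next
      case False
      then have "m x * max (u x) 0 powr p \<le> 0" by (simp add: mult_nonpos_nonneg)
      also have "0 \<le> B * c powr p" using B by simp
      finally show ?thesis .
    qed
  qed
  also have "\<dots> = B * c powr p * measure lebesgue \<Omega>"
    using sets by (simp add: measure_restrict_space)
  finally show False using gt by simp
qed

text \<open>A ball of radius \<open>\<rho>\<close> around a point where \<open>\<bar>f\<bar> > c\<close> cannot leave \<open>\<Omega>\<close> if \<open>L (\<rho> + k) < c\<close>, since \<open>f\<close>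
  vanishes outside; and the two balls cannot meet, since \<open>f\<close> drops by more than \<open>2 c\<close> between the
  centres.\<close>

lemma R2_plus_ge:
  assumes f: "\<And>x. x \<notin> \<Omega> \<Longrightarrow> f x = 0" and lip: "\<And>x y. \<bar>f x - f y\<bar> \<le> L * (norm (x - y) + k)"
    and L: "0 \<le> L" and k: "0 \<le> k"
    and x1: "x1 \<in> \<Omega>" "m x1 > 0" "f x1 > c" and x2: "x2 \<in> \<Omega>" "m x2 > 0" "- f x2 > c"
  shows "c \<le> L * (R2_plus \<Omega> m + k)"
proof (rule ccontr)
  assume not: "\<not> ?thesis"
  define g where "g = c - L * (R2_plus \<Omega> m + k)"
  \<comment> \<open>A radius beyond the supremum that still satisfies \<open>L * (\<rho> + k) < c\<close>.\<close>
  define \<rho> where "\<rho> = R2_plus \<Omega> m + g / (L + 1)"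
  have g: "0 < g" using not by (simp add: g_def)
  have "L * (\<rho> + k) = L * (R2_plus \<Omega> m + k) + L / (L + 1) * g"
    by (simp add: \<rho>_def algebra_simps)
  also have "\<dots> < L * (R2_plus \<Omega> m + k) + 1 * g"
    using g L by (intro add_strict_left_mono mult_strict_right_mono) auto
  finally have \<rho>c: "L * (\<rho> + k) < c" by (simp add: g_def)
  have \<rho>R: "R2_plus \<Omega> m < \<rho>" using g L by (simp add: \<rho>_def)
  have ball: "ball x \<rho> \<subseteq> \<Omega>" if "\<bar>f x\<bar> > c" for x
  proof (rule subsetI, rule ccontr)
    fix y assume "y \<in> ball x \<rho>" "y \<notin> \<Omega>"
    then have "\<bar>f x\<bar> \<le> L * (norm (x - y) + k)" "norm (x - y) \<le> \<rho>"
      using lip[of x y] f by (auto simp: dist_norm)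
    then have "\<bar>f x\<bar> \<le> L * (\<rho> + k)" using L by (smt (verit) mult_left_mono)
    then show False using that \<rho>c by simp
  qed
  have "ball x1 \<rho> \<inter> ball x2 \<rho> = {}"
  proof (rule ccontr)
    assume "\<not> ?thesis"
    then obtain z where "dist x1 z < \<rho>" "dist x2 z < \<rho>" by auto
    then have "norm (x1 - x2) + k \<le> 2 * (\<rho> + k)"
      using dist_triangle2[of x1 x2 z] k by (simp add: dist_norm)
    then have "L * (norm (x1 - x2) + k) \<le> L * (2 * (\<rho> + k))" using L by (rule mult_left_mono)
    then show False using lip[of x1 x2] x1(3) x2(3) \<rho>c by (simp add: algebra_simps)
  qed
  moreover have "x1 \<in> Omega_plus \<Omega> m" "x2 \<in> Omega_plus \<Omega> m"
    unfolding Omega_plus_def using x1 x2 by (auto intro: subsetD[OF closure_subset])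
  moreover have "\<bar>f x1\<bar> > c" "\<bar>f x2\<bar> > c" using x1(3) x2(3) by auto
  ultimately have "\<rho> \<in> R2_radii \<Omega> m"
    using R2_plus_pos(2) \<rho>R ball by (intro R2_radiiI[of _ x1 _ _ x2]) auto
  then have "\<rho> \<le> R2_plus \<Omega> m" unfolding R2_plus_eq by (intro cSup_upper bdd_above_R2_radii \<Omega>(2))
  then show False using \<rho>R by simp
qed

text \<open>The left-hand side tends to \<open>1 / (R2_plus \<Omega> m + 2 n d)\<close> as \<open>p\<close> grows, and the scale \<open>d\<close> is
  arbitrary.\<close>

lemma lambda2_ge:
  fixes p d B :: real
  assumes p: "real DIM('a) < p" and d: "0 < d" and B: "\<forall>x\<in>\<Omega>. \<bar>m x\<bar> \<le> B" "0 < B"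
    and ne: "Sigma2 \<Omega> m p \<noteq> {}"
  shows "(1 - real DIM('a) / p) * (d ^ DIM('a) / (4 * B * measure lebesgue \<Omega> + 1)) powr (1 / p) /
     (R2_plus \<Omega> m + 2 * real DIM('a) * d) \<le> lambda2 \<Omega> m p powr (1 / p)"
proof -
  have p1: "1 < p" using p DIM_positive[where 'a='a] by linarith
  define W where "W = 4 * B * measure lebesgue \<Omega> + 1"
  have W: "0 < W" using B by (simp add: W_def add_nonneg_pos)
  \<comment> \<open>The level \<open>c\<close> is chosen so that a function bounded by \<open>c\<close> where \<open>m > 0\<close> has weighted mass below \<open>1/4\<close>.\<close>
  define c where "c = (1 / W) powr (1 / p)"
  have c: "0 < c" "c powr p = 1 / W" using W p1 by (auto simp: c_def powr_powr)
  define s where "s = 1 - real DIM('a) / p"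
  have s: "0 < s" using p p1 by (simp add: s_def)
  define R where "R = R2_plus \<Omega> m + 2 * real DIM('a) * d"
  have R0: "0 < R2_plus \<Omega> m" by (rule R2_plus_pos(2))
  then have R: "0 < R" using d by (simp add: R_def add_pos_nonneg)
  \<comment> \<open>The bound that solving \<open>c \<le> L * R\<close> for the \<open>p\<close>-norm \<open>G\<close> inside \<open>L\<close> will give.\<close>
  define b where "b = s * (d powr (real DIM('a) / p) * c) / R"
  have b: "0 < b" using s d c R by (simp add: b_def)
  have step: "b powr p \<le> (SUP U\<in>A. grad_energy \<Omega> p U) + e" if A: "A \<in> Sigma2 \<Omega> m p" and e: "0 < e" for A e
  proof -
    obtain f where f: "f \<in> test_functions \<Omega>"
      "pos_mass p f > 1/4" "pos_mass p (\<lambda>x. - f x) > 1/4"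
      "(LINT x|lborel. norm (grad f x) powr p) < (SUP U\<in>A. grad_energy \<Omega> p U) + e"
      by (rule Sigma2_test_function[OF less_imp_le[OF p1] A e])
    define S where "S = (SUP U\<in>A. grad_energy \<Omega> p U) + e"
    have "0 \<le> (LINT x|lborel. norm (grad f x) powr p)" by simp
    then have S: "0 < S" using f(4) unfolding S_def by linarith
    define G where "G = S powr (1 / p)"
    have G: "0 < G" "G powr p = S" using S p1 by (auto simp: G_def powr_powr)
    obtain K where K: "compact K" "K \<subseteq> \<Omega>" "\<And>x. x \<notin> K \<Longrightarrow> f x = 0"
      "\<And>x. x \<notin> K \<Longrightarrow> grad f x = 0" "smooth_on UNIV f"
      using test_functionsE[OF f(1)] by blast
    define L where "L = d powr (- real DIM('a) / p) * G / s"
    have lip: "\<bar>f x - f y\<bar> \<le> L * (norm (x - y) + 2 * real DIM('a) * d)" for x y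
      unfolding L_def s_def using f(4) G(2)
      by (intro almost_Lipschitz[OF K(5,1,3) p d G(1)]) (auto simp: S_def)
    have p0: "0 < p" using p1 by simp
    have Lp: "Lp_function \<Omega> p f" by (rule W1p_function_test(3)[OF \<Omega>(1) p0 f(1)])
    then have Lp': "Lp_function \<Omega> p (\<lambda>x. - f x)" using Lp_function_scaleR[of \<Omega> p f "-1"] by simp
    have small: "B * c powr p * measure lebesgue \<Omega> < 1/4"
      using W unfolding c(2) by (simp add: W_def field_simps)
    note large = pos_integral_gt_imp_large_value[OF B(1) less_imp_le[OF B(2)] p0 _ less_imp_le[OF c(1)]]
    obtain x1 where x1: "x1 \<in> \<Omega>" "m x1 > 0" "f x1 > c"
      using large[OF Lp less_trans[OF small f(2)]] by blast
    obtain x2 where x2: "x2 \<in> \<Omega>" "m x2 > 0" "- f x2 > c"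
      using large[OF Lp' less_trans[OF small f(3)]] by blast
    have "c \<le> L * R"
      unfolding R_def
    proof (rule R2_plus_ge[OF _ lip _ _ x1 x2])
      show "f x = 0" if "x \<notin> \<Omega>" for x using that K(2,3) by blast
    qed (use s G d in \<open>auto simp: L_def\<close>)
    then have "b \<le> s * (d powr (real DIM('a) / p) * (L * R)) / R"
      unfolding b_def using s d R by (intro divide_right_mono mult_left_mono) auto
    also have "\<dots> = d powr (real DIM('a) / p) * d powr (- real DIM('a) / p) * G"
      using s R by (simp add: L_def)
    also have "\<dots> = G" using d by (simp add: powr_add[symmetric])
    finally have "b powr p \<le> G powr p" using b p1 by (intro powr_mono2) auto
    then show ?thesis using G by (simp add: S_def)
  qed
  have "b powr p \<le> (SUP U\<in>A. grad_energy \<Omega> p U)" if "A \<in> Sigma2 \<Omega> m p" for A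
    by (rule field_le_epsilon) (rule step[OF that])
  then have "b powr p \<le> lambda2 \<Omega> m p"
    unfolding lambda2_def by (intro cINF_greatest ne)
  then have "(b powr p) powr (1 / p) \<le> lambda2 \<Omega> m p powr (1 / p)"
    using p1 by (intro powr_mono2) auto
  then have "b \<le> lambda2 \<Omega> m p powr (1 / p)" using b p1 by (simp add: powr_powr)
  moreover have "d powr (real DIM('a) / p) * c = (d ^ DIM('a) / W) powr (1 / p)"
    using d W by (simp add: c_def powr_divide powr_powr powr_realpow[symmetric])
  ultimately show ?thesis by (simp add: b_def s_def R_def W_def)
qed

end

section \<open>Smooth cones\<close>

text \<open>A smooth replacement of \<open>max t 0\<close>: for \<open>t > 0\<close> it is \<open>t exp(-e/t)\<close>.\<close>

definition soft_pos :: "real \<Rightarrow> real \<Rightarrow> real" where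
  "soft_pos e t = t * flat (t / e)"

lemma flat_derivative:
  "(flat has_real_derivative (if s > 0 then (1 / s)\<^sup>2 * exp (- 1 / s) else 0)) (at s)"
proof -
  have "flat_poly 1 = flat"
    by (auto simp: flat_poly_def flat_def fun_eq_iff)
  then show ?thesis
    using flat_poly_derivative[of 1 s]
    by (cases "s > 0") (simp_all add: flat_poly_def power2_eq_square)
qed

text \<open>With \<open>s = t / e > 0\<close> the derivative is \<open>(1 + 1/s) exp(-1/s)\<close>, and \<open>1 + 1/s \<le> exp(1/s)\<close>.\<close>

lemma soft_pos_derivative:
  assumes "0 < e"
  shows "\<exists>D. (soft_pos e has_real_derivative D) (at t) \<and> 0 \<le> D \<and> D \<le> 1"
proof -
  define s where "s = t / e"
  define E where "E = (if s > 0 then (1 / s)\<^sup>2 * exp (- 1 / s) else 0)"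
  define D where "D = flat s + s * E"
  have div: "((\<lambda>t. t / e) has_real_derivative 1 / e) (at t)"
    using DERIV_cdivide[OF DERIV_ident] .
  have "(flat has_real_derivative E) (at (t / e))"
    using flat_derivative[of s] unfolding E_def[symmetric] by (simp add: s_def)
  then have "((\<lambda>t. flat (t / e)) has_real_derivative E * (1 / e)) (at t)"
    using div by (rule DERIV_chain2)
  from DERIV_mult[OF DERIV_ident this] have "(soft_pos e has_real_derivative D) (at t)"
    unfolding soft_pos_def[abs_def] D_def by (simp add: s_def mult_ac)
  moreover have "0 \<le> D \<and> D \<le> 1"
  proof (cases "s > 0")
    case True
    then have D: "D = (1 + 1 / s) * exp (- (1 / s))"
      by (simp add: D_def E_def flat_def power2_eq_square distrib_right)
    also have "\<dots> \<le> exp (1 / s) * exp (- (1 / s))"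
      by (intro mult_right_mono exp_ge_add_one_self) simp
    also have "\<dots> = 1" by (simp add: exp_minus)
    finally show ?thesis using True D by simp
  qed (simp add: D_def E_def flat_def)
  ultimately show ?thesis by blast
qed

lemma soft_pos_eq_0: "t \<le> 0 \<Longrightarrow> 0 < e \<Longrightarrow> soft_pos e t = 0"
  by (simp add: soft_pos_def flat_def zero_less_divide_iff)

lemma soft_pos_nonneg: "0 < e \<Longrightarrow> 0 \<le> soft_pos e t"
  by (cases "t \<le> 0") (simp add: soft_pos_eq_0, simp add: soft_pos_def flat_nonneg)

lemma soft_pos_strict: "s < t \<Longrightarrow> 0 < t \<Longrightarrow> 0 < e \<Longrightarrow> soft_pos e s < soft_pos e t"
proof (cases "s \<le> 0")
  case True
  assume t: "0 < t" "0 < e"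
  then have "0 < soft_pos e t" by (simp add: soft_pos_def flat_def)
  then show ?thesis using soft_pos_eq_0[OF True t(2)] by simp
next
  case False
  assume st: "s < t" "0 < t" "0 < e"
  have "s * exp (- (e / s)) < t * exp (- (e / t))"
    using st False by (intro mult_strict_mono) (auto intro: divide_strict_left_mono)
  then show ?thesis using st False by (simp add: soft_pos_def flat_def)
qed

lemma soft_pos_mono: "s \<le> t \<Longrightarrow> 0 < e \<Longrightarrow> soft_pos e s \<le> soft_pos e t"
  using soft_pos_strict[of s t e] soft_pos_eq_0[of s e] soft_pos_eq_0[of t e]
  by (cases "s = t"; cases "t \<le> 0") auto

lemma soft_pos_ge: "0 < e \<Longrightarrow> t - e \<le> soft_pos e t"
proof (cases "t \<le> 0")
  case False
  assume "0 < e"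
  have "t * (1 + - (e / t)) \<le> t * exp (- (e / t))"
    using False by (intro mult_left_mono exp_ge_add_one_self) auto
  then show ?thesis using False \<open>0 < e\<close> by (simp add: soft_pos_def flat_def algebra_simps)
qed (auto simp: soft_pos_eq_0)

text \<open>The distance from \<open>x0\<close>, smoothed at \<open>x0\<close>. It is spelled out in coordinates because the closure
  properties of smooth functions then apply directly.\<close>

definition soft_dist :: "real \<Rightarrow> 'a::euclidean_space \<Rightarrow> 'a \<Rightarrow> real" where
  "soft_dist e x0 x = sqrt ((\<Sum>i\<in>Basis. (x \<bullet> i - x0 \<bullet> i) * (x \<bullet> i - x0 \<bullet> i)) + e\<^sup>2)"

lemma soft_dist_eq: "soft_dist e x0 x = sqrt ((norm (x - x0))\<^sup>2 + e\<^sup>2)"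
  unfolding soft_dist_def power2_norm_eq_inner
  by (subst euclidean_inner) (simp add: inner_diff_left)

lemma smooth_on_soft_dist:
  assumes "0 < e"
  shows "smooth_on UNIV (soft_dist e x0)"
proof -
  have "smooth_on UNIV (\<lambda>x::'a. x \<bullet> i - x0 \<bullet> i)" for i
    using smooth_on_add[OF smooth_on_inner[of i] smooth_on_const[of "- (x0 \<bullet> i)"]] by simp
  moreover have "0 < (\<Sum>i\<in>Basis. (x \<bullet> i - x0 \<bullet> i) * (x \<bullet> i - x0 \<bullet> i)) + e\<^sup>2" for x :: 'a
    using assms by (intro add_nonneg_pos sum_nonneg) auto
  ultimately show ?thesis
    unfolding soft_dist_def[abs_def]
    by (intro smooth_on_sqrt smooth_on_add smooth_on_sum smooth_on_mult smooth_on_const) auto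
qed

lemma soft_dist_pos: "0 < e \<Longrightarrow> 0 < soft_dist e x0 x"
  unfolding soft_dist_eq by (simp add: add_nonneg_pos)

lemma norm_grad_soft_dist_le:
  assumes "0 < e"
  shows "norm (grad (soft_dist e x0) x) \<le> 1"
proof -
  define w where "w = soft_dist e x0 x"
  have w: "0 < w" using soft_dist_pos[OF assms] by (simp add: w_def)
  have le: "norm (x - x0) \<le> w" unfolding w_def soft_dist_eq by (rule real_le_rsqrt) simp
  have "((\<lambda>x. sqrt ((x - x0) \<bullet> (x - x0) + e\<^sup>2)) has_derivative
      (\<lambda>h. ((1 / w) *\<^sub>R (x - x0)) \<bullet> h)) (at x)"
  proof -
    have "((\<lambda>x. (x - x0) \<bullet> (x - x0) + e\<^sup>2) has_derivative (\<lambda>h. 2 * ((x - x0) \<bullet> h))) (at x)"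
      by (auto intro!: derivative_eq_intros simp: inner_commute)
    moreover have "(sqrt has_real_derivative inverse w / 2) (at ((x - x0) \<bullet> (x - x0) + e\<^sup>2))"
      using DERIV_real_sqrt[of "(x - x0) \<bullet> (x - x0) + e\<^sup>2"] assms
      by (simp add: w_def soft_dist_eq power2_norm_eq_inner add_nonneg_pos)
    ultimately have "((\<lambda>x. sqrt ((x - x0) \<bullet> (x - x0) + e\<^sup>2)) has_derivative
      (\<lambda>h. 2 * ((x - x0) \<bullet> h) * (inverse w / 2))) (at x)"
      by (intro DERIV_compose_FDERIV[where f=sqrt])
    moreover have "(\<lambda>h. 2 * ((x - x0) \<bullet> h) * (inverse w / 2)) = (\<lambda>h. ((1 / w) *\<^sub>R (x - x0)) \<bullet> h)"
      by (rule ext) (simp add: inverse_eq_divide)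
    ultimately show ?thesis by simp
  qed
  moreover have "soft_dist e x0 = (\<lambda>x. sqrt ((x - x0) \<bullet> (x - x0) + e\<^sup>2))"
    by (simp add: fun_eq_iff soft_dist_eq power2_norm_eq_inner)
  ultimately have "grad (soft_dist e x0) x = (1 / w) *\<^sub>R (x - x0)"
    by (simp add: grad_eqI)
  then show ?thesis using w le by simp
qed

text \<open>The function is \<open>soft_pos e (1 - soft_dist e x0 x / r)\<close> for small \<open>e\<close>. Both functions have slope at
  most one. The support is a closed ball of radius less than \<open>r\<close>, because \<open>soft_dist\<close> exceeds the true
  distance.\<close>

lemma exists_smooth_cone:
  fixes x0 :: "'a::euclidean_space"
  assumes r: "0 < r" and \<kappa>: "0 < \<kappa>" "\<kappa> < 1" and sub: "ball x0 r \<subseteq> \<Omega>"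
  obtains u where "u \<in> test_functions \<Omega>" "\<And>x. x \<notin> ball x0 r \<Longrightarrow> u x = 0 \<and> grad u x = 0"
    "\<And>x. 0 \<le> u x" "\<And>x. norm (grad u x) \<le> 1 / r" "\<kappa> < u x0"
    "\<And>x. x \<noteq> x0 \<Longrightarrow> u x < u x0" "\<And>x y. norm (x - x0) \<le> norm (y - x0) \<Longrightarrow> u y \<le> u x"
proof -
  define a where "a = 1 / r + 1"
  \<comment> \<open>The peak has height at least \<open>1 - e / r - e\<close>, which this choice makes larger than \<open>\<kappa>\<close>.\<close>
  define e where "e = (1 - \<kappa>) / (2 * a)"
  have a: "0 < a" using r by (simp add: a_def add_pos_pos)
  then have e0: "0 < e" using \<kappa> by (simp add: e_def)
  have "e * a = (1 - \<kappa>) / 2" using a by (simp add: e_def)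
  then have e: "e / r + e = (1 - \<kappa>) / 2" by (simp add: a_def algebra_simps)
  define q where "q = e / r"
  have q: "q + e = (1 - \<kappa>) / 2" using e by (simp add: q_def)
  then have "q < 1" using \<kappa> e0 by (simp add: field_simps)
  then have "e / r < 1" by (simp add: q_def)
  then have er: "e < r" using r by simp
  define u where "u x = soft_pos e (1 - soft_dist e x0 x / r)" for x
  have smooth_t: "smooth_on UNIV (\<lambda>x. 1 - soft_dist e x0 x / r)"
    using smooth_on_add[OF smooth_on_const[of 1] smooth_on_mult[OF smooth_on_const[of "- 1 / r"] smooth_on_soft_dist[OF e0]]]
    by simp
  have smooth: "smooth_on UNIV u"
    unfolding u_def[abs_def] soft_pos_def
    using smooth_on_mult[OF smooth_t smooth_on_flat[OF smooth_on_mult[OF smooth_on_const[of "1 / e"] smooth_t]]]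
    by simp
  define K where "K = cball x0 (sqrt (r\<^sup>2 - e\<^sup>2))"
  have K: "compact K" by (simp add: K_def)
  have KB: "K \<subseteq> ball x0 r"
  proof -
    have "sqrt (r\<^sup>2 - e\<^sup>2) < r" using r e0 by (intro real_less_lsqrt) auto
    then show ?thesis by (auto simp: K_def)
  qed
  have u0: "u x = 0" if "x \<notin> K" for x
  proof -
    have "sqrt (r\<^sup>2 - e\<^sup>2) < norm (x - x0)" using that by (simp add: K_def dist_norm norm_minus_commute)
    then have "r\<^sup>2 - e\<^sup>2 < (norm (x - x0))\<^sup>2" using real_sqrt_less_iff[of "r\<^sup>2 - e\<^sup>2" "(norm (x - x0))\<^sup>2"] by simp
    then have "r \<le> soft_dist e x0 x" unfolding soft_dist_eq by (intro real_le_rsqrt) simp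
    then show ?thesis using r e0 by (simp add: u_def soft_pos_eq_0)
  qed
  have anti: "u y \<le> u x" if "norm (x - x0) \<le> norm (y - x0)" for x y
  proof -
    have "soft_dist e x0 x \<le> soft_dist e x0 y"
      unfolding soft_dist_eq using that by (simp add: power_mono)
    then show ?thesis unfolding u_def using r e0 by (intro soft_pos_mono) (auto simp: divide_right_mono)
  qed
  have x0: "soft_dist e x0 x0 = e" using e0 by (simp add: soft_dist_eq)
  have strict: "u x < u x0" if "x \<noteq> x0" for x
  proof -
    have "e < soft_dist e x0 x"
      unfolding soft_dist_eq by (rule real_less_rsqrt) (use that in simp)
    then show ?thesis unfolding u_def using r e0 er x0
      by (intro soft_pos_strict) (auto simp: divide_strict_right_mono)
  qed
  have "1 - e / r - e \<le> u x0"
    unfolding u_def x0 by (rule soft_pos_ge[OF e0])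
  then have "1 - (q + e) \<le> u x0" by (simp add: q_def)
  then have big: "\<kappa> < u x0" using \<kappa> unfolding q by (simp add: field_simps)
  have gradle: "norm (grad u x) \<le> 1 / r" for x
  proof -
    obtain D where D: "(soft_pos e has_real_derivative D) (at (1 - soft_dist e x0 x / r))" "0 \<le> D" "D \<le> 1"
      using soft_pos_derivative[OF e0] by blast
    have "(soft_dist e x0 has_derivative (\<lambda>h. grad (soft_dist e x0) x \<bullet> h)) (at x)"
      by (intro has_derivative_grad smooth_on_differentiable smooth_on_soft_dist e0)
    then have "((\<lambda>x. 1 - (1 / r) * soft_dist e x0 x) has_derivative
        (\<lambda>h. 0 - (1 / r) * (grad (soft_dist e x0) x \<bullet> h))) (at x)"
      by (intro has_derivative_diff has_derivative_const has_derivative_mult_right)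
    then have "((\<lambda>x. 1 - soft_dist e x0 x / r) has_derivative
        (\<lambda>h. 0 - (1 / r) * (grad (soft_dist e x0) x \<bullet> h))) (at x)"
      by simp
    from DERIV_compose_FDERIV[OF D(1) this]
    have "(u has_derivative (\<lambda>h. ((- D / r) *\<^sub>R grad (soft_dist e x0) x) \<bullet> h)) (at x)"
      unfolding u_def[abs_def] by (simp add: mult.commute)
    then have "grad u x = (- D / r) *\<^sub>R grad (soft_dist e x0) x" by (rule grad_eqI)
    then have "norm (grad u x) = D / r * norm (grad (soft_dist e x0) x)"
      using D(2) r by simp
    also have "\<dots> \<le> 1 / r * 1"
      using D r norm_grad_soft_dist_le[OF e0, of x0 x] by (intro mult_mono divide_right_mono) auto
    finally show ?thesis by simp
  qed
  have "u \<in> test_functions \<Omega>"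
    by (rule test_functionsI[OF smooth K _ u0]) (use KB sub in blast)
  moreover have "u x = 0 \<and> grad u x = 0" if "x \<notin> ball x0 r" for x
  proof -
    have "x \<notin> K" using that KB by blast
    then show ?thesis using u0 grad_eq_0_outside[OF K u0] by simp
  qed
  moreover have "0 \<le> u x" for x by (simp add: u_def soft_pos_nonneg[OF e0])
  ultimately show ?thesis using that[OF _ _ _ gradle big strict anti] by blast
qed

section \<open>The weighted mass of a peaked function\<close>

lemma powr_exponent_tendsto_0:
  fixes a :: real
  assumes "0 \<le> a" "a < 1"
  shows "((\<lambda>p. a powr p) \<longlongrightarrow> 0) at_top"
proof (cases "a = 0")
  case False
  have "LIM p at_top. ln a * p :> at_bot"
    using assms False by (intro filterlim_tendsto_neg_mult_at_bot[OF tendsto_const]) (auto simp: filterlim_ident)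
  then have "((\<lambda>p. exp (ln a * p)) \<longlongrightarrow> 0) at_top" by (rule filterlim_compose[OF exp_at_bot])
  then show ?thesis using False by (simp add: powr_def mult.commute)
qed simp

context weighted_domain
begin

text \<open>The weight is bounded below near the peak but may be negative elsewhere. Away from the peak \<open>u\<close> is
  at most a level \<open>k1\<close>, and on a small ball around it \<open>u\<close> exceeds a level \<open>k2 > k1\<close>; the \<open>p\<close>-th powers of
  these levels become incomparable as \<open>p\<close> grows, so the negative contribution is negligible.\<close>

lemma eventually_weighted_mass_ge:
  assumes x0: "x0 \<in> \<Omega>" "0 < m x0" and u: "u \<in> test_functions \<Omega>" and \<kappa>: "0 < \<kappa>" "\<kappa> < u x0"
    and nonneg: "\<And>x. 0 \<le> u x" and strict: "\<And>x. x \<noteq> x0 \<Longrightarrow> u x < u x0"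
    and anti: "\<And>x y. norm (x - x0) \<le> norm (y - x0) \<Longrightarrow> u y \<le> u x"
  shows "\<forall>\<^sub>F p in at_top. \<kappa> powr p \<le> mass p u"
proof -
  obtain B where B: "\<forall>x\<in>\<Omega>. \<bar>m x\<bar> \<le> B" "0 < B" using weight_bounded(2) by blast
  have lm: "\<Omega> \<in> lmeasurable" using \<Omega> by (simp add: lmeasurable_open)
  have sets: "\<Omega> \<in> sets lebesgue" using \<Omega> by simp
  define c where "c = m x0 / 2"
  have c: "0 < c" using x0 by (simp add: c_def)
  have contm: "continuous_on \<Omega> m" using m closure_subset by (rule continuous_on_subset)
  then have "open (\<Omega> \<inter> m -` {c<..})" by (rule continuous_open_preimage) (use \<Omega> in auto)
  moreover have "x0 \<in> \<Omega> \<inter> m -` {c<..}" using x0 by (simp add: c_def)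
  ultimately obtain d where d: "0 < d" "ball x0 d \<subseteq> \<Omega> \<inter> m -` {c<..}"
    unfolding open_contains_ball by blast
  obtain i :: 'a where i: "i \<in> Basis" using nonempty_Basis by blast
  \<comment> \<open>As \<open>u\<close> decreases with the distance, its value at distance \<open>d\<close> bounds it outside the ball.\<close>
  define k1 where "k1 = u (x0 + d *\<^sub>R i)"
  have k1: "0 \<le> k1" "k1 < u x0" using nonneg strict[of "x0 + d *\<^sub>R i"] d i nonzero_Basis by (auto simp: k1_def)
  have far: "u x \<le> k1" if "x \<notin> ball x0 d" for x
    unfolding k1_def using that d i by (intro anti) (simp add: dist_norm norm_minus_commute)
  obtain k2 where k2: "max \<kappa> k1 < k2" "k2 < u x0" using dense[of "max \<kappa> k1" "u x0"] \<kappa> k1 by auto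
  have k2pos: "0 < k2" using k2 \<kappa> by simp
  have contu: "continuous_on UNIV u" by (rule test_functionsE[OF u]) (rule smooth_on_continuous)
  have "open (u -` {k2<..} \<inter> ball x0 d)"
    using open_vimage[of "{k2<..}" u] contu by (intro open_Int) auto
  moreover have "x0 \<in> u -` {k2<..} \<inter> ball x0 d" using k2 d by simp
  ultimately obtain d' where d': "0 < d'" "ball x0 d' \<subseteq> u -` {k2<..} \<inter> ball x0 d"
    unfolding open_contains_ball by blast
  define b where "b = measure lebesgue (ball x0 d')"
  have b: "0 < b" using d' by (simp add: b_def content_ball_pos)
  have sub: "ball x0 d' \<subseteq> \<Omega>" using d d' by blast
  have ge: "c * k2 powr p * b - B * k1 powr p * measure lebesgue \<Omega> \<le> mass p u"
    if p: "1 \<le> p" for p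
  proof -
    have p0: "0 < p" using p by simp
    have Lp: "Lp_function \<Omega> p u" by (rule W1p_function_test(3)[OF \<Omega>(1) p0 u])
    have eq: "(\<lambda>x. m x * max (u x) 0 powr p) = (\<lambda>x. m x * \<bar>u x\<bar> powr p)"
      using nonneg by (simp add: max_absorb1 abs_of_nonneg)
    have int: "integrable (lebesgue_on \<Omega>) (\<lambda>x. m x * \<bar>u x\<bar> powr p)"
      using integrable_pos_integral[OF p0 Lp weight_bounded(1) B(1)] unfolding eq .
    have ind: "integrable (lebesgue_on \<Omega>) (indicat_real (ball x0 d'))"
      using sub sets by (subst integrable_restrict_space)
        (auto simp: indicator_inter_arith[symmetric] Int_absorb1 lmeasurable_iff_integrable[symmetric])
    have const: "integrable (lebesgue_on \<Omega>) (\<lambda>x. k)" for k :: real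
      by (rule finite_measure.integrable_const[OF finite_measure_lebesgue_on[OF lm]])
    have "(LINT x|lebesgue_on \<Omega>. indicat_real (ball x0 d') x) = b"
      using sub sets by (simp add: b_def measure_restrict_space Int_absorb2)
    moreover have "(LINT x|lebesgue_on \<Omega>. (1::real)) = measure lebesgue \<Omega>"
      using sets by (simp add: measure_restrict_space)
    ultimately have "c * k2 powr p * b - B * k1 powr p * measure lebesgue \<Omega> =
       (LINT x|lebesgue_on \<Omega>. c * k2 powr p * indicat_real (ball x0 d') x - B * k1 powr p * 1)"
      using ind const by (subst Bochner_Integration.integral_diff) auto
    also have "\<dots> \<le> mass p u"
    proof (rule integral_mono)
      show "integrable (lebesgue_on \<Omega>) (\<lambda>x. c * k2 powr p * indicat_real (ball x0 d') x - B * k1 powr p * 1)"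
        using ind const by auto
      fix x assume "x \<in> space (lebesgue_on \<Omega>)"
      then have x: "x \<in> \<Omega>" by simp
      show "c * k2 powr p * indicat_real (ball x0 d') x - B * k1 powr p * 1 \<le> m x * \<bar>u x\<bar> powr p"
      proof (cases "x \<in> ball x0 d")
        case True
        then have mx: "c < m x" using d by blast
        have "c * k2 powr p * indicat_real (ball x0 d') x \<le> m x * \<bar>u x\<bar> powr p"
        proof (cases "x \<in> ball x0 d'")
          case True
          then have "k2 < u x" using d' by blast
          then show ?thesis using True mx c k2pos p by (auto intro!: mult_mono powr_mono2)
        qed (use mx c in auto)
        moreover have "0 \<le> B * k1 powr p" using B by simp
        ultimately show ?thesis by linarith
      next
        case False
        then have "x \<notin> ball x0 d'" using d' by blast
        moreover have "\<bar>m x\<bar> * \<bar>u x\<bar> powr p \<le> B * k1 powr p"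
          using B x far[OF False] nonneg[of x] p by (intro mult_mono powr_mono2) auto
        moreover have "- (\<bar>m x\<bar> * \<bar>u x\<bar> powr p) \<le> m x * \<bar>u x\<bar> powr p"
          using mult_right_mono[of "- \<bar>m x\<bar>" "m x" "\<bar>u x\<bar> powr p"] by simp
        ultimately show ?thesis by simp
      qed
    qed (rule int)
    finally show ?thesis .
  qed
  have "((\<lambda>p. (\<kappa> / k2) powr p + B * measure lebesgue \<Omega> * (k1 / k2) powr p) \<longlongrightarrow>
      0 + B * measure lebesgue \<Omega> * 0) at_top"
    using \<kappa> k1 k2 k2pos by (intro tendsto_intros powr_exponent_tendsto_0) auto
  then have "\<forall>\<^sub>F p in at_top. (\<kappa> / k2) powr p + B * measure lebesgue \<Omega> * (k1 / k2) powr p < c * b"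
    by (rule order_tendstoD) (use c b in simp)
  moreover have "\<forall>\<^sub>F p in at_top. (1::real) \<le> p" by (rule eventually_ge_at_top)
  ultimately show ?thesis
  proof eventually_elim
    case (elim p)
    have "((\<kappa> / k2) powr p + B * measure lebesgue \<Omega> * (k1 / k2) powr p) * k2 powr p \<le> c * b * k2 powr p"
      using elim(1) by (intro mult_right_mono) auto
    then have "\<kappa> powr p + B * measure lebesgue \<Omega> * k1 powr p \<le> c * b * k2 powr p"
      using k2pos by (simp add: powr_divide distrib_right)
    then show ?case using ge[OF elim(2)] by (simp add: algebra_simps)
  qed
qed

lemma exists_peak:
  assumes y: "y \<in> Omega_plus \<Omega> m" "ball y r \<subseteq> \<Omega>" and \<rho>: "0 < \<rho>" "\<rho> < r" and \<kappa>: "0 < \<kappa>" "\<kappa> < 1"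
  obtains u where "u \<in> test_functions \<Omega>" "\<And>x. x \<notin> ball y r \<Longrightarrow> u x = 0 \<and> grad u x = 0"
    "\<And>x. norm (grad u x) \<le> 1 / \<rho>"
    "\<forall>\<^sub>F p in at_top. \<kappa> powr p \<le> mass p u"
proof -
  have "0 < r - \<rho>" using \<rho> by simp
  then obtain x where x: "x \<in> {x\<in>\<Omega>. m x > 0}" "dist x y < r - \<rho>"
    using y(1) unfolding Omega_plus_def closure_approachable by blast
  then have sub: "ball x \<rho> \<subseteq> ball y r" by (simp add: ball_subset_ball_iff)
  have xm: "x \<in> \<Omega>" "0 < m x" using x by auto
  obtain u where u: "u \<in> test_functions \<Omega>" "\<And>z. z \<notin> ball x \<rho> \<Longrightarrow> u z = 0 \<and> grad u z = 0"
    "\<And>z. 0 \<le> u z" "\<And>z. norm (grad u z) \<le> 1 / \<rho>" "\<kappa> < u x"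
    "\<And>z. z \<noteq> x \<Longrightarrow> u z < u x" "\<And>z w. norm (z - x) \<le> norm (w - x) \<Longrightarrow> u w \<le> u z"
    using exists_smooth_cone[OF \<rho>(1) \<kappa> subset_trans[OF sub y(2)]] by blast
  show ?thesis
  proof (rule that[OF u(1) _ u(4)])
    show "u z = 0 \<and> grad u z = 0" if "z \<notin> ball y r" for z using u(2)[of z] sub that by blast
    show "\<forall>\<^sub>F p in at_top. \<kappa> powr p \<le> mass p u"
      by (rule eventually_weighted_mass_ge[OF xm u(1) \<kappa>(1) u(5,3,6,7)])
  qed
qed

end

section \<open>A circle of genus two\<close>

text \<open>A map into a punctured space of dimension at most one is determined by its zeroth coordinate, which
  would have to be nonzero along \<open>c\<close> and yet change sign between the parameters \<open>0\<close> and \<open>pi\<close>.\<close>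

lemma odd_circle_genus_ge_2:
  fixes c :: "real \<Rightarrow> 'v"
  assumes c: "continuous_map euclideanreal X c" and neg: "\<And>s. c (s + pi) = neg (c s)"
  shows "genus X neg (range c) \<ge> 2"
  unfolding genus_def
proof (rule Inf_greatest, clarify)
  fix j \<phi>
  assume \<phi>: "continuous_map (subtopology X (range c)) (subtopology (Euclidean_space j) (- {\<lambda>i. 0})) \<phi>"
    and odd: "\<forall>v\<in>range c. \<forall>i. \<phi> (neg v) i = - \<phi> v i"
  have c': "continuous_map euclideanreal (subtopology X (range c)) c"
    using c by (simp add: continuous_map_in_subtopology)
  note \<phi>c = continuous_map_compose[OF c' \<phi>]
  have "continuous_map (Euclidean_space j) euclideanreal (\<lambda>x. x 0)"
    unfolding Euclidean_space_def
    by (intro continuous_map_from_subtopology continuous_map_product_projection) simp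
  from continuous_map_compose[OF continuous_map_into_fulltopology[OF \<phi>c] this]
  have cont: "continuous_on S (\<lambda>s. \<phi> (c s) 0)" for S
    by (auto simp: o_def intro: continuous_on_subset)
  have im: "\<phi> (c s) \<in> topspace (subtopology (Euclidean_space j) (- {\<lambda>i. 0}))" for s
  proof -
    have "(\<phi> \<circ> c) s \<in> topspace (subtopology (Euclidean_space j) (- {\<lambda>i. 0}))"
      by (rule subsetD[OF continuous_map_image_subset_topspace[OF \<phi>c]]) (rule imageI, simp)
    then show ?thesis by (simp only: o_apply)
  qed
  have E: "\<phi> (c s) i = 0" if "j \<le> i" for s i
    using im[of s] that by (simp add: topspace_Euclidean_space)
  have nz: "\<phi> (c s) \<noteq> (\<lambda>i. 0)" for s
    using im[of s] by simp
  show "2 \<le> enat j"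
  proof (rule ccontr)
    assume "\<not> 2 \<le> enat j"
    then have j: "j \<le> 1" by (simp add: numeral_eq_enat)
    have nz0: "\<phi> (c s) 0 \<noteq> 0" for s
    proof
      assume 0: "\<phi> (c s) 0 = 0"
      have "\<phi> (c s) i = 0" for i
        using 0 E[of i s] j by (cases "i = 0") auto
      then show False using nz[of s] by auto
    qed
    have "\<phi> (c pi) 0 = - \<phi> (c 0) 0"
      using odd neg[of 0] by simp
    then have "\<exists>s. \<phi> (c s) 0 = 0"
      using IVT'[of "\<lambda>s. \<phi> (c s) 0" 0 0 pi, OF _ _ _ cont] IVT2'[of "\<lambda>s. \<phi> (c s) 0" pi 0 0, OF _ _ _ cont]
      by (cases "\<phi> (c 0) 0 \<le> 0") auto
    then show False using nz0 by blast
  qed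
qed

lemma neg_class_ae_class: "neg_class (ae_class \<Omega> u) = ae_class \<Omega> (\<lambda>x. - u x)"
proof (intro set_eqI iffI)
  fix v assume "v \<in> neg_class (ae_class \<Omega> u)"
  then obtain w where w: "v = (\<lambda>x. - w x)" "AE x in lebesgue_on \<Omega>. w x = u x"
    by (auto simp: neg_class_def ae_class_def)
  from w(2) have "AE x in lebesgue_on \<Omega>. v x = - u x" unfolding w(1) by eventually_elim simp
  then show "v \<in> ae_class \<Omega> (\<lambda>x. - u x)" by (simp add: ae_class_def)
next
  fix v assume "v \<in> ae_class \<Omega> (\<lambda>x. - u x)"
  then have "AE x in lebesgue_on \<Omega>. v x = - u x" by (simp add: ae_class_def)
  then have "AE x in lebesgue_on \<Omega>. - v x = u x" by eventually_elim simp
  then have "(\<lambda>x. - v x) \<in> ae_class \<Omega> u" by (simp add: ae_class_def)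
  then show "v \<in> neg_class (ae_class \<Omega> u)"
    unfolding neg_class_def by (intro image_eqI[of _ _ "\<lambda>x. - v x"]) auto
qed

lemma weighted_integral_disjoint:
  fixes f g :: "'a \<Rightarrow> 'b::real_normed_vector"
  assumes disj: "\<And>x. f x = 0 \<or> g x = 0"
    and "integrable M (\<lambda>x. w x * norm (f x) powr p)" "integrable M (\<lambda>x. w x * norm (g x) powr p)"
  shows "(LINT x|M. w x * norm (a *\<^sub>R f x + b *\<^sub>R g x) powr p) =
    \<bar>a\<bar> powr p * (LINT x|M. w x * norm (f x) powr p) + \<bar>b\<bar> powr p * (LINT x|M. w x * norm (g x) powr p)"
proof -
  have "w x * norm (a *\<^sub>R f x + b *\<^sub>R g x) powr p =
      \<bar>a\<bar> powr p * (w x * norm (f x) powr p) + \<bar>b\<bar> powr p * (w x * norm (g x) powr p)" for x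
    using disj[of x] by (auto simp: powr_mult)
  then show ?thesis using assms by simp
qed

lemma const_powr_inverse_tendsto_1:
  fixes V :: real
  assumes "0 < V"
  shows "((\<lambda>p. V powr (1 / p)) \<longlongrightarrow> 1) at_top"
proof -
  have "((\<lambda>p::real. 1 / p) \<longlongrightarrow> 0) at_top"
    using tendsto_inverse_0_at_top[OF filterlim_ident] by (simp add: inverse_eq_divide)
  then have "((\<lambda>p. V powr (1 / p)) \<longlongrightarrow> V powr 0) at_top"
    using assms by (intro tendsto_intros) auto
  then show ?thesis using assms by simp
qed

context weighted_domain
begin

text \<open>The curve consists of \<open>a u1 + b u2\<close> with \<open>(a, b)\<close> proportional to \<open>(cos s, sin s)\<close> and normalised to
  the constraint. As the bumps are nowhere nonzero together, all integrals involved are linear in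
  \<open>\<bar>a\<bar>\<^sup>p\<close> and \<open>\<bar>b\<bar>\<^sup>p\<close>; the constraint bounds \<open>\<bar>a\<bar>\<^sup>p + \<bar>b\<bar>\<^sup>p\<close> by \<open>1 / k\<close>.\<close>

lemma two_bumps_Sigma2:
  fixes p l k :: real
  assumes p: "1 \<le> p"
    and u1: "u1 \<in> test_functions \<Omega>" and u2: "u2 \<in> test_functions \<Omega>"
    and disj: "\<And>x. u1 x = 0 \<or> u2 x = 0" and disjg: "\<And>x. grad u1 x = 0 \<or> grad u2 x = 0"
    and l1: "\<And>x. norm (grad u1 x) \<le> l" and l2: "\<And>x. norm (grad u2 x) \<le> l"
    and k: "0 < k" "k \<le> mass p u1" "k \<le> mass p u2"
  shows "\<exists>A\<in>Sigma2 \<Omega> m p. \<forall>U\<in>A. grad_energy \<Omega> p U \<le> l powr p * measure lebesgue \<Omega> / k"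
proof -
  have p0: "0 < p" using p by simp
  have sets: "\<Omega> \<in> sets lebesgue" using \<Omega> by simp
  define comb where "comb a b x = a * u1 x + b * u2 x" for a b x
  define M1 where "M1 = mass p u1"
  define M2 where "M2 = mass p u2"
  have M: "0 < M1" "0 < M2" "k \<le> M1" "k \<le> M2" using k by (auto simp: M1_def M2_def)
  have smooth: "smooth_on UNIV u1" "smooth_on UNIV u2" using u1 u2 by (auto simp: test_functions_def)
  have test: "comb a b \<in> test_functions \<Omega>" for a b
    unfolding comb_def[abs_def] by (rule test_functions_add_scaled[OF u1 u2])
  have grad_comb: "grad (comb a b) x = a *\<^sub>R grad u1 x + b *\<^sub>R grad u2 x" for a b x
    unfolding comb_def[abs_def] by (rule grad_add_scaled[OF smooth])
  note Lpu = W1p_function_test(3,4)[OF \<Omega>(1) p0]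
  have mint: "integrable (lebesgue_on \<Omega>) (\<lambda>x. m x * norm (u x) powr p)" if "u \<in> test_functions \<Omega>" for u
  proof -
    obtain B where B: "\<forall>x\<in>\<Omega>. \<bar>m x\<bar> \<le> B" using weight_bounded(2) by blast
    have "Lp_function \<Omega> p (\<lambda>x. \<bar>u x\<bar>)" using Lpu(1)[OF that] by (auto simp: Lp_function_def intro: borel_measurable_abs)
    from integrable_pos_integral[OF p0 this weight_bounded(1) B] show ?thesis by (simp add: max_absorb1)
  qed
  have mass_comb: "mass p (comb a b) = \<bar>a\<bar> powr p * M1 + \<bar>b\<bar> powr p * M2" for a b
    using weighted_integral_disjoint[OF disj mint[OF u1] mint[OF u2], where a=a and b=b]
    by (simp add: comb_def M1_def M2_def)
  have grad_int: "powr_integral \<Omega> p (grad (comb a b)) =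
      \<bar>a\<bar> powr p * powr_integral \<Omega> p (grad u1) +
      \<bar>b\<bar> powr p * powr_integral \<Omega> p (grad u2)" for a b
    using weighted_integral_disjoint[OF disjg, where M="lebesgue_on \<Omega>" and w="\<lambda>_. 1" and p=p and a=a and b=b] Lpu(2)[OF u1] Lpu(2)[OF u2]
    by (simp add: grad_comb Lp_function_def)
  have abs_int: "(LINT x|lebesgue_on \<Omega>. \<bar>comb a b x\<bar> powr p) =
      \<bar>a\<bar> powr p * (LINT x|lebesgue_on \<Omega>. \<bar>u1 x\<bar> powr p) +
      \<bar>b\<bar> powr p * (LINT x|lebesgue_on \<Omega>. \<bar>u2 x\<bar> powr p)" for a b
    using weighted_integral_disjoint[OF disj, where M="lebesgue_on \<Omega>" and w="\<lambda>_. 1" and p=p and a=a and b=b] Lpu(1)[OF u1] Lpu(1)[OF u2]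
    by (simp add: comb_def Lp_function_def)
  have weak_int: "powr_integral \<Omega> p (weak_grad \<Omega> (comb a b)) =
      powr_integral \<Omega> p (grad (comb a b))" for a b
    using W1p_function_test(2)[OF \<Omega>(1) p0 test[of a b]] by (intro integral_lebesgue_on_cong_AE[OF sets]) auto
  define N1 where "N1 = (LINT x|lebesgue_on \<Omega>. \<bar>u1 x\<bar> powr p) + powr_integral \<Omega> p (grad u1)"
  define N2 where "N2 = (LINT x|lebesgue_on \<Omega>. \<bar>u2 x\<bar> powr p) + powr_integral \<Omega> p (grad u2)"
  have N: "0 \<le> N1" "0 \<le> N2" by (auto simp: N1_def N2_def intro!: add_nonneg_nonneg)
  have norm_comb: "W1p_norm \<Omega> p (comb a b) = (\<bar>a\<bar> powr p * N1 + \<bar>b\<bar> powr p * N2) powr (1 / p)" for a b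
    unfolding W1p_norm_def weak_int grad_int abs_int N1_def N2_def by (simp add: algebra_simps)
  define D where "D s = (\<bar>cos s\<bar> powr p * M1 + \<bar>sin s\<bar> powr p * M2) powr (1 / p)" for s
  define a where "a s = cos s / D s" for s
  define b where "b s = sin s / D s" for s
  have inner_pos: "0 < \<bar>cos s\<bar> powr p * M1 + \<bar>sin s\<bar> powr p * M2" for s
  proof (cases "cos s = 0")
    case True
    then have "sin s \<noteq> 0" using sin_cos_squared_add[of s] by auto
    then show ?thesis using M by (intro add_nonneg_pos) auto
  qed (use M in \<open>auto intro!: add_pos_nonneg\<close>)
  have Dpos: "0 < D s" for s using inner_pos[of s] by (simp add: D_def)
  have Dp: "D s powr p = \<bar>cos s\<bar> powr p * M1 + \<bar>sin s\<bar> powr p * M2" for s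
    using inner_pos[of s] p0 by (simp add: D_def powr_powr)
  have contD: "continuous_on UNIV D"
    unfolding D_def using inner_pos p0
    by (intro continuous_on_powr' continuous_intros) (auto simp: less_imp_le)
  have conta: "continuous_on UNIV a" "continuous_on UNIV b"
    unfolding a_def b_def using contD Dpos by (auto intro!: continuous_intros simp: less_imp_neq[symmetric] order_less_imp_not_eq2)
  have unit: "\<bar>a s\<bar> powr p * M1 + \<bar>b s\<bar> powr p * M2 = 1" for s
  proof -
    have "\<bar>a s\<bar> powr p * M1 + \<bar>b s\<bar> powr p * M2 = (\<bar>cos s\<bar> powr p * M1 + \<bar>sin s\<bar> powr p * M2) / D s powr p"
      using Dpos[of s] by (simp add: a_def b_def abs_divide powr_divide add_divide_distrib)
    then show ?thesis using inner_pos[of s] by (simp add: Dp)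
  qed
  define c where "c s = ae_class \<Omega> (comb (a s) (b s))" for s
  have cW: "c s \<in> W1p0 \<Omega> p" for s
    unfolding c_def W1p0_def by (intro imageI CollectI W1p0_function_test \<Omega> p test)
  have rep: "AE x in lebesgue_on \<Omega>. rep (c s) x = comb (a s) (b s) x" for s
    unfolding c_def by (rule rep_ae_class)
  have neg: "c (s + pi) = neg_class (c s)" for s
  proof -
    have "D (s + pi) = D s" by (simp add: D_def)
    then have "comb (a (s + pi)) (b (s + pi)) = (\<lambda>x. - comb (a s) (b s) x)"
      by (simp add: a_def b_def comb_def fun_eq_iff)
    then show ?thesis by (simp add: c_def neg_class_ae_class)
  qed
  have dist: "W1p0_dist \<Omega> p (c s) (c t) = (\<bar>a s - a t\<bar> powr p * N1 + \<bar>b s - b t\<bar> powr p * N2) powr (1 / p)" for s t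
  proof -
    have "AE x in lebesgue_on \<Omega>. rep (c s) x - rep (c t) x = comb (a s - a t) (b s - b t) x"
      using rep[of s] rep[of t] by eventually_elim (simp add: comb_def algebra_simps)
    from W1p_norm_cong_AE[OF \<Omega>(1) this] show ?thesis
      by (simp add: W1p0_dist_def norm_comb)
  qed
  have cont: "continuous_map euclideanreal (W1p0_topology \<Omega> p) c"
    unfolding continuous_map_def topspace_W1p0_topology[OF \<Omega>(1) p]
  proof (intro conjI allI impI)
    show "c \<in> topspace euclideanreal \<rightarrow> W1p0 \<Omega> p" using cW by auto
    fix G assume "openin (W1p0_topology \<Omega> p) G"
    then have G: "\<forall>U\<in>G. \<exists>r>0. \<forall>V\<in>W1p0 \<Omega> p. W1p0_dist \<Omega> p U V < r \<longrightarrow> V \<in> G"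
      using openin_W1p0_topology[OF \<Omega>(1) p] by blast
    have "open {s. c s \<in> G}"
    proof (subst open_subopen, intro ballI)
      fix s assume "s \<in> {s. c s \<in> G}"
      then obtain r where r: "0 < r" "\<forall>V\<in>W1p0 \<Omega> p. W1p0_dist \<Omega> p (c s) V < r \<longrightarrow> V \<in> G"
        using G by blast
      define f where "f t = (\<bar>a s - a t\<bar> powr p * N1 + \<bar>b s - b t\<bar> powr p * N2) powr (1 / p)" for t
      have "continuous_on UNIV f"
        unfolding f_def using p0 N conta by (intro continuous_on_powr' continuous_intros) auto
      then have "open (f -` {..<r})" by (intro open_vimage) auto
      moreover have "s \<in> f -` {..<r}" using r p0 by (simp add: f_def)
      moreover have "f -` {..<r} \<subseteq> {s. c s \<in> G}" using r(2) cW dist by (auto simp: f_def)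
      ultimately show "\<exists>T. open T \<and> s \<in> T \<and> T \<subseteq> {s. c s \<in> G}" by blast
    qed
    then show "openin euclideanreal {x \<in> topspace euclideanreal. c x \<in> G}"
      using open_openin by auto
  qed
  have range: "range c = c ` {0..2 * pi}"
  proof
    show "range c \<subseteq> c ` {0..2 * pi}"
    proof
      fix U assume "U \<in> range c"
      then obtain s where s: "U = c s" by blast
      obtain t where t: "0 \<le> t" "t < 2 * pi" "cos s = cos t" "sin s = sin t"
        using sincos_total_2pi[of "cos s" "sin s"] by auto
      then have "c s = c t" by (simp add: c_def a_def b_def D_def)
      then show "U \<in> c ` {0..2 * pi}" using s t by auto
    qed
  qed auto
  have "range c \<in> Sigma2 \<Omega> m p"
    unfolding Sigma2_def
  proof (intro CollectI conjI ballI)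
    show "range c \<subseteq> A_plus \<Omega> m p"
    proof
      fix U assume "U \<in> range c"
      then obtain s where s: "U = c s" by blast
      have "mass p (rep (c s)) = mass p (comb (a s) (b s))"
        using rep[of s] by (intro integral_lebesgue_on_cong_AE[OF sets]) auto
      then show "U \<in> A_plus \<Omega> m p" using cW unit by (simp add: A_plus_def s mass_comb)
    qed
    show "neg_class U \<in> range c" if "U \<in> range c" for U
      using that neg by (metis rangeE rangeI)
    show "compactin (W1p0_topology \<Omega> p) (range c)"
      unfolding range by (rule image_compactin[OF _ cont]) (simp add: compactin_euclidean_iff)
    show "2 \<le> genus (W1p0_topology \<Omega> p) neg_class (range c)"
      by (rule odd_circle_genus_ge_2[OF cont neg])
  qed
  moreover have "grad_energy \<Omega> p U \<le> l powr p * measure lebesgue \<Omega> / k" if "U \<in> range c" for U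
  proof -
    obtain s where s: "U = c s" using \<open>U \<in> range c\<close> by blast
    define V where "V = l powr p * measure lebesgue \<Omega>"
    have V: "0 \<le> V" by (simp add: V_def)
    have lm: "\<Omega> \<in> lmeasurable" using \<Omega> by (simp add: lmeasurable_open)
    have le: "powr_integral \<Omega> p (grad u) \<le> V"
      if u: "u \<in> test_functions \<Omega>" and lu: "\<And>x. norm (grad u x) \<le> l" for u
    proof -
      have "powr_integral \<Omega> p (grad u) \<le> (LINT x|lebesgue_on \<Omega>. l powr p)"
      proof (rule integral_mono)
        show "integrable (lebesgue_on \<Omega>) (\<lambda>x. norm (grad u x) powr p)" using Lpu(2)[OF u] by (simp add: Lp_function_def)
        show "integrable (lebesgue_on \<Omega>) (\<lambda>x. l powr p)"
          by (rule finite_measure.integrable_const[OF finite_measure_lebesgue_on[OF lm]])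
      qed (use lu p0 in \<open>auto intro: powr_mono2\<close>)
      then show ?thesis using sets by (simp add: V_def measure_restrict_space mult.commute)
    qed
    have "grad_energy \<Omega> p U = powr_integral \<Omega> p (grad (comb (a s) (b s)))"
      unfolding grad_energy_def s weak_grad_cong_AE[OF \<Omega>(1) rep] weak_int ..
    also have "\<dots> \<le> \<bar>a s\<bar> powr p * V + \<bar>b s\<bar> powr p * V"
      unfolding grad_int by (intro add_mono mult_left_mono le u1 u2 l1 l2) auto
    also have "\<dots> = (\<bar>a s\<bar> powr p * k + \<bar>b s\<bar> powr p * k) * (V / k)"
      using k(1) by (simp add: field_simps)
    also have "\<dots> \<le> (\<bar>a s\<bar> powr p * M1 + \<bar>b s\<bar> powr p * M2) * (V / k)"
      using V k M by (intro mult_right_mono add_mono mult_left_mono) auto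
    finally show ?thesis by (simp add: unit V_def)
  qed
  ultimately show ?thesis by blast
qed

section \<open>The upper bound and the limit\<close>

lemma Sigma2_nonempty_SUP_nonneg:
  assumes p: "1 \<le> p" and A: "A \<in> Sigma2 \<Omega> m p"
  shows "A \<noteq> {}" "0 \<le> (SUP U\<in>A. grad_energy \<Omega> p U)"
proof -
  obtain U where U: "U \<in> A" using Sigma2_balanced_element[OF p A] by blast
  then show "A \<noteq> {}" by blast
  have "0 \<le> grad_energy \<Omega> p U" by (simp add: grad_energy_def)
  also have "\<dots> \<le> (SUP U\<in>A. grad_energy \<Omega> p U)"
    by (intro cSUP_upper U Sigma2_energy_bdd_above[OF p A])
  finally show "0 \<le> (SUP U\<in>A. grad_energy \<Omega> p U)" .
qed

lemma lambda2_le: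
  assumes p: "1 \<le> p" and A: "A \<in> Sigma2 \<Omega> m p" and C: "\<And>U. U \<in> A \<Longrightarrow> grad_energy \<Omega> p U \<le> C"
  shows "0 \<le> lambda2 \<Omega> m p" "lambda2 \<Omega> m p \<le> C"
proof -
  note nn = Sigma2_nonempty_SUP_nonneg[OF p]
  show "0 \<le> lambda2 \<Omega> m p"
    unfolding lambda2_def using A by (intro cINF_greatest nn(2)) auto
  show "lambda2 \<Omega> m p \<le> C"
    unfolding lambda2_def
  proof (rule cINF_lower2[OF _ A])
    show "bdd_below ((\<lambda>A. SUP U\<in>A. grad_energy \<Omega> p U) ` Sigma2 \<Omega> m p)"
      by (rule bdd_belowI2[of _ 0]) (rule nn(2))
    show "(SUP U\<in>A. grad_energy \<Omega> p U) \<le> C"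
      by (rule cSUP_least[OF nn(1)[OF A] C])
  qed
qed

lemma eventually_lambda2_less:
  assumes l: "1 / R2_plus \<Omega> m < l"
  shows "\<forall>\<^sub>F p in at_top. Sigma2 \<Omega> m p \<noteq> {} \<and> lambda2 \<Omega> m p powr (1 / p) < l"
proof -
  note R = R2_plus_pos
  have l0: "0 < l" using l R(2) by (meson less_trans zero_less_divide_1_iff)
  have "1 / l < R2_plus \<Omega> m" using l l0 R(2) by (simp add: field_simps)
  then obtain r where r: "r \<in> R2_radii \<Omega> m" "1 / l < r"
    unfolding R2_plus_eq using less_cSupD[OF R(1)] by blast
  obtain y1 y2 where y: "y1 \<in> Omega_plus \<Omega> m" "ball y1 r \<subseteq> \<Omega>" "y2 \<in> Omega_plus \<Omega> m" "ball y2 r \<subseteq> \<Omega>"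
    "ball y1 r \<inter> ball y2 r = {}"
    using r(1) by (auto simp: R2_radii_def)
  obtain \<rho> where \<rho>: "1 / l < \<rho>" "\<rho> < r" using dense[OF r(2)] by blast
  have \<rho>0: "0 < \<rho>" using \<rho>(1) l0 by (meson less_trans zero_less_divide_1_iff)
  \<comment> \<open>The cones will have height above \<open>\<kappa>\<close> and slope at most \<open>1 / \<rho>\<close>, and \<open>1 / (\<rho> * \<kappa>) < l\<close>.\<close>
  have "1 / (l * \<rho>) < 1" using \<rho> l0 \<rho>0 by (simp add: field_simps)
  then obtain \<kappa> where \<kappa>: "1 / (l * \<rho>) < \<kappa>" "\<kappa> < 1" using dense by blast
  have \<kappa>0: "0 < \<kappa>" using \<kappa>(1) l0 \<rho>0 by (meson less_trans zero_less_divide_1_iff mult_pos_pos)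
  obtain u1 where u1: "u1 \<in> test_functions \<Omega>" "\<And>x. x \<notin> ball y1 r \<Longrightarrow> u1 x = 0 \<and> grad u1 x = 0"
    "\<And>x. norm (grad u1 x) \<le> 1 / \<rho>"
    "\<forall>\<^sub>F p in at_top. \<kappa> powr p \<le> mass p u1"
    using exists_peak[OF y(1,2) \<rho>0 \<rho>(2) \<kappa>0 \<kappa>(2)] by blast
  obtain u2 where u2: "u2 \<in> test_functions \<Omega>" "\<And>x. x \<notin> ball y2 r \<Longrightarrow> u2 x = 0 \<and> grad u2 x = 0"
    "\<And>x. norm (grad u2 x) \<le> 1 / \<rho>"
    "\<forall>\<^sub>F p in at_top. \<kappa> powr p \<le> mass p u2"
    using exists_peak[OF y(3,4) \<rho>0 \<rho>(2) \<kappa>0 \<kappa>(2)] by blast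
  have "x \<notin> ball y1 r \<or> x \<notin> ball y2 r" for x using y(5) by blast
  then have disj: "u1 x = 0 \<or> u2 x = 0" "grad u1 x = 0 \<or> grad u2 x = 0" for x
    using u1(2) u2(2) by blast+
  define V where "V = measure lebesgue \<Omega> + 1"
  have V: "0 < V" by (simp add: V_def add_nonneg_pos)
  have "((\<lambda>p. V powr (1 / p) * (1 / (\<rho> * \<kappa>))) \<longlongrightarrow> 1 * (1 / (\<rho> * \<kappa>))) at_top"
    by (intro tendsto_mult tendsto_const const_powr_inverse_tendsto_1 V)
  moreover have "1 * (1 / (\<rho> * \<kappa>)) < l" using \<kappa>(1) \<kappa>0 \<rho>0 l0 by (simp add: field_simps)
  ultimately have ev: "\<forall>\<^sub>F p in at_top. V powr (1 / p) * (1 / (\<rho> * \<kappa>)) < l"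
    by (rule order_tendstoD(2))
  have "\<forall>\<^sub>F p in at_top. (1::real) \<le> p" by (rule eventually_ge_at_top)
  with ev u1(4) u2(4) show ?thesis
  proof eventually_elim
    case (elim p)
    have \<kappa>p: "0 < \<kappa> powr p" using \<kappa>0 by simp
    obtain A where A: "A \<in> Sigma2 \<Omega> m p"
      "\<forall>U\<in>A. grad_energy \<Omega> p U \<le> (1 / \<rho>) powr p * measure lebesgue \<Omega> / \<kappa> powr p"
      using two_bumps_Sigma2[OF elim(4) u1(1) u2(1) disj u1(3) u2(3) \<kappa>p elim(2,3)] by blast
    note le = lambda2_le[OF elim(4) A(1) A(2)[rule_format]]
    have "(1 / \<rho>) powr p * measure lebesgue \<Omega> / \<kappa> powr p \<le> V * (1 / (\<rho> * \<kappa>)) powr p"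
      using \<rho>0 \<kappa>0 by (simp add: V_def powr_divide powr_mult field_simps)
    then have "lambda2 \<Omega> m p \<le> V * (1 / (\<rho> * \<kappa>)) powr p" using le(2) by linarith
    then have "lambda2 \<Omega> m p powr (1 / p) \<le> (V * (1 / (\<rho> * \<kappa>)) powr p) powr (1 / p)"
      using le(1) elim(4) by (intro powr_mono2) auto
    also have "\<dots> = V powr (1 / p) * (1 / (\<rho> * \<kappa>))"
      using elim(4) \<rho>0 \<kappa>0 by (simp add: powr_mult powr_powr)
    also have "\<dots> < l" by (rule elim(1))
    finally show ?case using A(1) by blast
  qed
qed

lemma eventually_lambda2_greater:
  assumes l: "l < 1 / R2_plus \<Omega> m"
  shows "\<forall>\<^sub>F p in at_top. l < lambda2 \<Omega> m p powr (1 / p)"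
proof -
  let ?n = "real DIM('a)"
  let ?R = "R2_plus \<Omega> m"
  note R = R2_plus_pos(2)
  have "((\<lambda>d. 1 / (?R + 2 * ?n * d)) \<longlongrightarrow> 1 / (?R + 2 * ?n * 0)) (at_right 0)"
    using R by (intro tendsto_intros) auto
  then have "\<forall>\<^sub>F d in at_right 0. l < 1 / (?R + 2 * ?n * d)"
    by (rule order_tendstoD(1)) (use l in simp)
  then have "\<forall>\<^sub>F d in at_right 0. 0 < d \<and> l < 1 / (?R + 2 * ?n * d)"
    using eventually_at_right_less[of "0::real"] by eventually_elim simp
  then obtain d where d: "0 < d" "l < 1 / (?R + 2 * ?n * d)"
    using eventually_happens[of _ "at_right (0::real)"] trivial_limit_at_right_real by blast
  obtain B where B: "\<forall>x\<in>\<Omega>. \<bar>m x\<bar> \<le> B" "0 < B" using weight_bounded(2) by blast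
  define V where "V = d ^ DIM('a) / (4 * B * measure lebesgue \<Omega> + 1)"
  have V: "0 < V" unfolding V_def using d(1) B by (intro divide_pos_pos add_nonneg_pos) auto
  have "((\<lambda>p::real. ?n * (1 / p)) \<longlongrightarrow> ?n * 0) at_top"
    using tendsto_inverse_0_at_top[OF filterlim_ident] by (intro tendsto_mult tendsto_const) (simp add: inverse_eq_divide)
  then have inv: "((\<lambda>p::real. ?n / p) \<longlongrightarrow> 0) at_top" by simp
  have "((\<lambda>p. (1 - ?n / p) * V powr (1 / p) / (?R + 2 * ?n * d)) \<longlongrightarrow> (1 - 0) * 1 / (?R + 2 * ?n * d)) at_top"
    using R d(1) add_pos_nonneg[of ?R "2 * ?n * d"]
    by (intro tendsto_intros inv const_powr_inverse_tendsto_1 V) auto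
  then have ev: "\<forall>\<^sub>F p in at_top. l < (1 - ?n / p) * V powr (1 / p) / (?R + 2 * ?n * d)"
    by (rule order_tendstoD(1)) (use d in simp)
  have "1 / ?R < 1 / ?R + 1" by simp
  note ne = eventually_lambda2_less[OF this]
  have "\<forall>\<^sub>F p in at_top. ?n < p" by (rule eventually_gt_at_top)
  with ev ne show ?thesis
  proof eventually_elim
    case (elim p)
    then show ?case
      using lambda2_ge[OF elim(3) d(1) B] by (simp add: V_def)
  qed
qed

end

theorem theorem1p3:
  fixes \<Omega> :: "(real ^ 'n) set" and m :: "real ^ 'n \<Rightarrow> real"
  assumes "smooth_bounded_domain \<Omega>"
    and "continuous_on (closure \<Omega>) m"
    and "changes_sign \<Omega> m"
  shows "((\<lambda>p. lambda2 \<Omega> m p powr (1 / p)) \<longlongrightarrow> 1 / R2_plus \<Omega> m) at_top"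
proof -
  interpret weighted_domain \<Omega> m
    using assms by unfold_locales (auto simp: smooth_bounded_domain_def changes_sign_def)
  show ?thesis
  proof (rule order_tendstoI)
    fix l assume "l < 1 / R2_plus \<Omega> m"
    then show "\<forall>\<^sub>F p in at_top. l < lambda2 \<Omega> m p powr (1 / p)"
      by (rule eventually_lambda2_greater)
  next
    fix l assume "1 / R2_plus \<Omega> m < l"
    from eventually_lambda2_less[OF this]
    show "\<forall>\<^sub>F p in at_top. lambda2 \<Omega> m p powr (1 / p) < l"
      by eventually_elim simp
  qed
qed

end
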